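(* Let $n,a\ge 1$ and $b\ge 3$ be integers, $\mathbf{n}=(n,1)$ and $\mathbf{a}=(a,b)$. Then the Segre-Veronese variety $X_{\mathbf{n},\mathbf{a}}$ (that is, $\mathbb{P}^n\times\mathbb{P}^1$ embedded by $\mathcal{O}(a,b)$) is not defective, except when $a=2$ and $b=2k$ is even (for some integer $k$). In other words, $X_{\mathbf{n},\mathbf{a}}$ is defective if and only if $a=2$ and $b$ is even.
   Context: We work over $\mathbb{C}$. For $\mathbf{n}=(n_1,n_2)$ and $\mathbf{a}=(a_1,a_2)$ pairs of positive integers, let $N=\binom{n_1+a_1}{a_1}\binom{n_2+a_2}{a_2}$ and let $X_{\mathbf{n},\mathbf{a}}\subset\mathbb{P}^{N-1}$ be the Segre-Veronese variety, i.e. the image of $\mathbb{P}^{n_1}\times\mathbb{P}^{n_2}$ under the embedding given by the complete linear system of $\mathcal{O}(a_1,a_2)$. The $s$-th secant variety $\sigma_s(X)$ is the Zariski closure of the union of the linear spans of $s$-tuples of points of $X$. It has the expected dimension if $\dim\sigma_s(X_{\mathbf{n},\mathbf{a}})=\min\{N-1,\ s(1+n_1+n_2)-1\}$. The variety $X_{\mathbf{n},\mathbf{a}}$ is called defective if $\sigma_s(X_{\mathbf{n},\mathbf{a}})$ does not have the expected dimension for some positive integer $s$. *)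

theory Defs
  imports "HOL-Analysis.Analysis" "HOL-Library.Poly_Mapping"
begin

section \<open>Polynomials over the complex numbers\<close>

text \<open>
  Polynomials in variables indexed by \<open>'i\<close>: finitely supported families of coefficients, indexed
  by monomials (which are finitely supported families of exponents).
\<close>

type_synonym 'i cpoly = "('i \<Rightarrow>\<^sub>0 nat) \<Rightarrow>\<^sub>0 complex"

definition mono_eval :: "('i \<Rightarrow>\<^sub>0 nat) \<Rightarrow> ('i \<Rightarrow> complex) \<Rightarrow> complex" where
  "mono_eval m v = (\<Prod>i\<in>Poly_Mapping.keys m. v i ^ Poly_Mapping.lookup m i)"

definition poly_eval :: "'i cpoly \<Rightarrow> ('i \<Rightarrow> complex) \<Rightarrow> complex" where
  "poly_eval f v = (\<Sum>m\<in>Poly_Mapping.keys f. Poly_Mapping.lookup f m * mono_eval m v)"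

definition mono_degree :: "('i \<Rightarrow>\<^sub>0 nat) \<Rightarrow> nat" where
  "mono_degree m = (\<Sum>i\<in>Poly_Mapping.keys m. Poly_Mapping.lookup m i)"

definition homogeneous :: "nat \<Rightarrow> 'i cpoly \<Rightarrow> bool" where
  "homogeneous d f \<longleftrightarrow> (\<forall>m\<in>Poly_Mapping.keys f. mono_degree m = d)"

definition poly_vars :: "'i cpoly \<Rightarrow> 'i set" where
  "poly_vars f = (\<Union>m\<in>Poly_Mapping.keys f. Poly_Mapping.keys m)"

definition hom_polys :: "'i set \<Rightarrow> 'i cpoly set" where
  "hom_polys I = {f. poly_vars f \<subseteq> I \<and> (\<exists>d. homogeneous d f)}"


section \<open>Projective space and its Zariski topology\<close>

text \<open>
  \<open>coord_space I\<close> is the vector space of families indexed by \<open>I\<close>, realised as functions that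
  vanish outside \<open>I\<close>. A point of the projective space is a line through the origin, as a set of
  vectors (so the zero vector belongs to every point); \<open>proj_space I\<close> has dimension
  \<open>card I - 1\<close>.
\<close>

definition coord_space :: "'i set \<Rightarrow> ('i \<Rightarrow> complex) set" where
  "coord_space I = {v. \<forall>i. i \<notin> I \<longrightarrow> v i = 0}"

definition proj_point :: "('i \<Rightarrow> complex) \<Rightarrow> ('i \<Rightarrow> complex) set" where
  "proj_point v = {\<lambda>i. c * v i | c. True}"

definition proj_space :: "'i set \<Rightarrow> ('i \<Rightarrow> complex) set set" where
  "proj_space I = {proj_point v | v. v \<in> coord_space I \<and> v \<noteq> (\<lambda>i. 0)}"

definition zero_locus :: "'i set \<Rightarrow> 'i cpoly set \<Rightarrow> ('i \<Rightarrow> complex) set set" where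
  "zero_locus I F = {p \<in> proj_space I. \<forall>f\<in>F. \<forall>v\<in>p. poly_eval f v = 0}"

definition zariski_open :: "'i set \<Rightarrow> ('i \<Rightarrow> complex) set set \<Rightarrow> bool" where
  "zariski_open I U \<longleftrightarrow> (\<exists>F \<subseteq> hom_polys I. U = proj_space I - zero_locus I F)"

definition zariski :: "'i set \<Rightarrow> ('i \<Rightarrow> complex) set topology" where
  "zariski I = topology (zariski_open I)"


section \<open>Dimension of a topological space\<close>

definition irreducible_in :: "'a topology \<Rightarrow> 'a set \<Rightarrow> bool" where
  "irreducible_in T Z \<longleftrightarrow> Z \<noteq> {} \<and> Z \<subseteq> topspace T \<and>
     (\<forall>A B. closedin T A \<longrightarrow> closedin T B \<longrightarrow> Z \<subseteq> A \<union> B \<longrightarrow> Z \<subseteq> A \<or> Z \<subseteq> B)"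

text \<open>The supremum of the lengths \<open>k\<close> of chains \<open>Z 0 \<subset> \<dots> \<subset> Z k\<close> of irreducible closed subsets.\<close>

definition top_dim :: "'a topology \<Rightarrow> enat" where
  "top_dim T = Sup {enat k | k. \<exists>Z :: nat \<Rightarrow> 'a set.
     (\<forall>i\<le>k. closedin T (Z i) \<and> irreducible_in T (Z i)) \<and> (\<forall>i<k. Z i \<subset> Z (Suc i))}"


section \<open>Secant varieties\<close>

text \<open>
  The projective linear span of \<open>p 0, \<dots>, p (s - 1)\<close>. As points are lines, the linear span of their
  union consists of the sums of one vector from each.
\<close>

definition proj_span :: "nat \<Rightarrow> (nat \<Rightarrow> ('i \<Rightarrow> complex) set) \<Rightarrow> ('i \<Rightarrow> complex) set set" where
  "proj_span s p = {proj_point w | w. w \<noteq> (\<lambda>i. 0) \<and>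
     (\<exists>v. (\<forall>j<s. v j \<in> p j) \<and> w = (\<lambda>i. \<Sum>j<s. v j i))}"

definition secant_variety ::
    "'i set \<Rightarrow> ('i \<Rightarrow> complex) set set \<Rightarrow> nat \<Rightarrow> ('i \<Rightarrow> complex) set set" where
  "secant_variety I X s =
     zariski I closure_of (\<Union>p\<in>{p. \<forall>j<s. p j \<in> X}. proj_span s p)"


section \<open>Segre-Veronese varieties\<close>

text \<open>Exponents of the monomials of degree \<open>a\<close> in the variables \<open>x 0, \<dots>, x n\<close>.\<close>

definition exponents :: "nat \<Rightarrow> nat \<Rightarrow> (nat \<Rightarrow> nat) set" where
  "exponents n a = {\<alpha>. (\<forall>i. i > n \<longrightarrow> \<alpha> i = 0) \<and> (\<Sum>i\<le>n. \<alpha> i) = a}"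

type_synonym bidegree_index = "(nat \<Rightarrow> nat) \<times> (nat \<Rightarrow> nat)"

definition sv_index :: "nat \<times> nat \<Rightarrow> nat \<times> nat \<Rightarrow> bidegree_index set" where
  "sv_index n a = exponents (fst n) (fst a) \<times> exponents (snd n) (snd a)"

text \<open>The vector of all monomials of bidegree \<open>a\<close>; they form a basis of the sections of \<open>O(a)\<close>.\<close>

definition sv_map :: "nat \<times> nat \<Rightarrow> nat \<times> nat \<Rightarrow> (nat \<Rightarrow> complex) \<Rightarrow> (nat \<Rightarrow> complex)
    \<Rightarrow> (bidegree_index \<Rightarrow> complex)" where
  "sv_map n a x y = (\<lambda>(\<alpha>, \<beta>). if (\<alpha>, \<beta>) \<in> sv_index n a
     then (\<Prod>i\<le>fst n. x i ^ \<alpha> i) * (\<Prod>i\<le>snd n. y i ^ \<beta> i) else 0)"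

definition segre_veronese :: "nat \<times> nat \<Rightarrow> nat \<times> nat \<Rightarrow> (bidegree_index \<Rightarrow> complex) set set" where
  "segre_veronese n a = {proj_point (sv_map n a x y) | x y.
     x \<in> coord_space {..fst n} \<and> x \<noteq> (\<lambda>i. 0) \<and> y \<in> coord_space {..snd n} \<and> y \<noteq> (\<lambda>i. 0)}"

definition sv_N :: "nat \<times> nat \<Rightarrow> nat \<times> nat \<Rightarrow> nat" where
  "sv_N n a = ((fst n + fst a) choose fst a) * ((snd n + snd a) choose snd a)"

definition sv_secant :: "nat \<times> nat \<Rightarrow> nat \<times> nat \<Rightarrow> nat \<Rightarrow> (bidegree_index \<Rightarrow> complex) set set" where
  "sv_secant n a s = secant_variety (sv_index n a) (segre_veronese n a) s"

text \<open>For \<open>s \<ge> 1\<close> the truncated subtractions are genuine ones.\<close>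

definition expected_dimension :: "nat \<times> nat \<Rightarrow> nat \<times> nat \<Rightarrow> nat \<Rightarrow> bool" where
  "expected_dimension n a s \<longleftrightarrow>
     top_dim (subtopology (zariski (sv_index n a)) (sv_secant n a s)) =
       enat (min (sv_N n a - 1) (s * (1 + fst n + snd n) - 1))"

definition defective :: "nat \<times> nat \<Rightarrow> nat \<times> nat \<Rightarrow> bool" where
  "defective n a \<longleftrightarrow> (\<exists>s>0. \<not> expected_dimension n a s)"


section \<open>The Zariski topology is a topology\<close>

lemma mono_eval_superset:
  assumes "finite K" "Poly_Mapping.keys m \<subseteq> K"
  shows "mono_eval m v = (\<Prod>i\<in>K. v i ^ Poly_Mapping.lookup m i)"
  unfolding mono_eval_def
  by (rule prod.mono_neutral_left) (use assms in \<open>auto simp: in_keys_iff\<close>)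

lemma mono_eval_add: "mono_eval (m + n) v = mono_eval m v * mono_eval n v"
proof -
  let ?K = "Poly_Mapping.keys m \<union> Poly_Mapping.keys n"
  have "mono_eval (m + n) v = (\<Prod>i\<in>?K. v i ^ Poly_Mapping.lookup (m + n) i)"
    by (rule mono_eval_superset) (use keys_add[of m n] in auto)
  also have "\<dots> = (\<Prod>i\<in>?K. v i ^ Poly_Mapping.lookup m i) * (\<Prod>i\<in>?K. v i ^ Poly_Mapping.lookup n i)"
    by (simp add: lookup_add power_add prod.distrib)
  also have "\<dots> = mono_eval m v * mono_eval n v"
    by (subst (1 2) mono_eval_superset[where K = ?K]) auto
  finally show ?thesis .
qed

lemma mono_degree_add: "mono_degree (m + n) = mono_degree m + mono_degree n"
proof -
  let ?K = "Poly_Mapping.keys m \<union> Poly_Mapping.keys n"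
  have sup: "mono_degree k = (\<Sum>i\<in>?K. Poly_Mapping.lookup k i)" if "Poly_Mapping.keys k \<subseteq> ?K" for k
    unfolding mono_degree_def
    by (rule sum.mono_neutral_left) (use that in \<open>auto simp: in_keys_iff\<close>)
  show ?thesis
    using keys_add[of m n] by (simp add: sup lookup_add sum.distrib)
qed

lemma mono_eval_scale: "mono_eval m (\<lambda>i. c * v i) = c ^ mono_degree m * mono_eval m v"
  by (simp add: mono_eval_def mono_degree_def power_mult_distrib prod.distrib power_sum)

lemma poly_eval_superset:
  assumes "finite K" "Poly_Mapping.keys f \<subseteq> K"
  shows "poly_eval f v = (\<Sum>m\<in>K. Poly_Mapping.lookup f m * mono_eval m v)"
  unfolding poly_eval_def
  by (rule sum.mono_neutral_left) (use assms in \<open>auto simp: in_keys_iff\<close>)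

lemma poly_eval_add: "poly_eval (f + g) v = poly_eval f v + poly_eval g v"
proof -
  let ?K = "Poly_Mapping.keys f \<union> Poly_Mapping.keys g"
  have "poly_eval (f + g) v = (\<Sum>m\<in>?K. Poly_Mapping.lookup (f + g) m * mono_eval m v)"
    by (rule poly_eval_superset) (use keys_add[of f g] in auto)
  also have "\<dots> = (\<Sum>m\<in>?K. Poly_Mapping.lookup f m * mono_eval m v)
      + (\<Sum>m\<in>?K. Poly_Mapping.lookup g m * mono_eval m v)"
    by (simp add: lookup_add distrib_right sum.distrib)
  also have "\<dots> = poly_eval f v + poly_eval g v"
    by (subst (1 2) poly_eval_superset[where K = ?K]) auto
  finally show ?thesis .
qed

lemma poly_eval_0 [simp]: "poly_eval 0 v = 0"
  by (simp add: poly_eval_def)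

lemma poly_eval_single: "poly_eval (Poly_Mapping.single m c) v = c * mono_eval m v"
  by (subst poly_eval_superset[where K = "{m}"]) auto

lemma cpoly_induct [case_names zero add]:
  fixes f :: "'i cpoly"
  assumes "P 0" "\<And>f m c. P f \<Longrightarrow> P (Poly_Mapping.single m c + f)"
  shows "P f"
proof (induction f rule: update_induct)
  case const
  show ?case by (rule assms(1))
next
  case (update f a b)
  have "Poly_Mapping.update a b f = Poly_Mapping.single a b + f"
    using update(1) by (intro poly_mapping_eqI)
      (auto simp: lookup_update lookup_add lookup_single in_keys_iff when_def)
  then show ?case using assms(2) update by simp
qed

lemma poly_eval_mult: "poly_eval (f * g) v = poly_eval f v * poly_eval g v"
proof (induction f rule: cpoly_induct)
  case zero
  show ?case by simp
next
  case (add f m c)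
  have "poly_eval (Poly_Mapping.single m c * g) v = c * mono_eval m v * poly_eval g v"
    by (induction g rule: cpoly_induct)
      (simp_all add: distrib_left poly_eval_add mult_single poly_eval_single mono_eval_add)
  with add show ?case
    by (simp add: distrib_right poly_eval_add poly_eval_single)
qed

lemma poly_eval_scale:
  "homogeneous d f \<Longrightarrow> poly_eval f (\<lambda>i. c * v i) = c ^ d * poly_eval f v"
  by (simp add: poly_eval_def homogeneous_def mono_eval_scale sum_distrib_left mult_ac)

lemma hom_polys_mult:
  assumes "f \<in> hom_polys I" "g \<in> hom_polys I"
  shows "f * g \<in> hom_polys I"
proof -
  obtain d e where d: "homogeneous d f" and e: "homogeneous e g"
    using assms by (auto simp: hom_polys_def)
  have *: "\<exists>a\<in>Poly_Mapping.keys f. \<exists>b\<in>Poly_Mapping.keys g. m = a + b"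
    if "m \<in> Poly_Mapping.keys (f * g)" for m
    using that keys_mult[of f g] by blast
  have "homogeneous (d + e) (f * g)"
    using d e * unfolding homogeneous_def by (metis mono_degree_add)
  moreover have "poly_vars (f * g) \<subseteq> poly_vars f \<union> poly_vars g"
    unfolding poly_vars_def using * keys_add by fast
  ultimately show ?thesis
    using assms by (auto simp: hom_polys_def)
qed

lemma hom_polys_nonzero_rep:
  assumes "f \<in> hom_polys I" "w \<in> proj_point v" "poly_eval f w \<noteq> 0"
  shows "poly_eval f v \<noteq> 0"
  using assms by (auto simp: hom_polys_def proj_point_def poly_eval_scale)

lemma zero_locus_mult:
  assumes "F \<subseteq> hom_polys I" "G \<subseteq> hom_polys I"
  shows "zero_locus I {f * g | f g. f \<in> F \<and> g \<in> G} = zero_locus I F \<union> zero_locus I G"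
proof (intro equalityI subsetI)
  fix p assume p: "p \<in> zero_locus I {f * g | f g. f \<in> F \<and> g \<in> G}"
  then obtain v where v: "p = proj_point v" and P: "p \<in> proj_space I"
    by (auto simp: zero_locus_def proj_space_def)
  have vp: "v \<in> p"
    unfolding v proj_point_def by (auto intro!: exI[of _ 1])
  show "p \<in> zero_locus I F \<union> zero_locus I G"
  proof (rule ccontr)
    assume "\<not> ?thesis"
    then obtain f g u w where "f \<in> F" "g \<in> G" "u \<in> p" "w \<in> p" "poly_eval f u \<noteq> 0" "poly_eval g w \<noteq> 0"
      using P by (auto simp: zero_locus_def)
    then have "poly_eval (f * g) v \<noteq> 0"
      using hom_polys_nonzero_rep assms v by (metis poly_eval_mult mult_eq_0_iff subsetD)
    with p vp \<open>f \<in> F\<close> \<open>g \<in> G\<close> show False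
      by (auto simp: zero_locus_def)
  qed
qed (auto simp: zero_locus_def poly_eval_mult)

lemma istopology_zariski: "istopology (zariski_open I)"
  unfolding istopology_def
proof (intro conjI allI impI)
  fix U V assume "zariski_open I U" "zariski_open I V"
  then obtain F G where F: "F \<subseteq> hom_polys I" "U = proj_space I - zero_locus I F"
    and G: "G \<subseteq> hom_polys I" "V = proj_space I - zero_locus I G"
    by (auto simp: zariski_open_def)
  show "zariski_open I (U \<inter> V)"
    unfolding zariski_open_def
    by (rule exI[of _ "{f * g | f g. f \<in> F \<and> g \<in> G}"])
      (use F G in \<open>auto simp: zero_locus_mult intro!: hom_polys_mult\<close>)
next
  fix K assume "\<forall>U\<in>K. zariski_open I U"
  then obtain F where F: "\<And>U. U \<in> K \<Longrightarrow> F U \<subseteq> hom_polys I"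
    "\<And>U. U \<in> K \<Longrightarrow> U = proj_space I - zero_locus I (F U)"
    unfolding zariski_open_def by metis
  have "\<Union>K = (\<Union>U\<in>K. proj_space I - zero_locus I (F U))"
    using F(2) by auto
  also have "\<dots> = proj_space I - zero_locus I (\<Union>U\<in>K. F U)"
    by (auto simp: zero_locus_def)
  finally show "zariski_open I (\<Union>K)"
    unfolding zariski_open_def using F(1) by (intro exI[of _ "\<Union>U\<in>K. F U"]) auto
qed

lemma openin_zariski: "openin (zariski I) U \<longleftrightarrow> zariski_open I U"
  by (simp add: zariski_def topology_inverse' istopology_zariski)

lemma topspace_zariski: "topspace (zariski I) = proj_space I"
proof -
  have "Poly_Mapping.single 0 1 \<in> hom_polys I"
    by (auto simp: hom_polys_def poly_vars_def homogeneous_def)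
  moreover have "zero_locus I {Poly_Mapping.single 0 1} = {}"
    by (fastforce simp: zero_locus_def poly_eval_single mono_eval_def proj_space_def proj_point_def
        simp del: single_one)
  ultimately have "zariski_open I (proj_space I)"
    unfolding zariski_open_def by (intro exI[of _ "{Poly_Mapping.single 0 1}"]) auto
  then show ?thesis
    unfolding topspace_def openin_zariski by (auto simp: zariski_open_def)
qed

lemma closedin_zariski: "closedin (zariski I) C \<longleftrightarrow> (\<exists>F \<subseteq> hom_polys I. C = zero_locus I F)"
proof -
  have "zero_locus I F \<subseteq> proj_space I" for F
    by (auto simp: zero_locus_def)
  then show ?thesis
    unfolding closedin_def topspace_zariski openin_zariski zariski_open_def
    by (metis double_diff order_refl)
qed

end

theory Submission
  imports Defs "HOL-Library.Function_Algebras"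
begin

text \<open>
  The dimension of an irreducible closed set is read off the growth of its Hilbert function. Chains
  in the secant variety are therefore no longer than its number of parameters, and by the lowest
  order terms of forms pulled back along the parametrisation they can be as long as the rank of its
  differential, the dimension of the span of tangent spaces at \<open>s\<close> points.

  This rank is maximal by induction on \<open>n\<close> and \<open>a\<close>. Let \<open>u\<close> of the points tend to the divisor
  \<open>x (Suc m) = 0\<close>, with \<open>d\<close> further ones approaching it more slowly (the differential Horace method).
  The limit splits the rank into that of a trace of degree \<open>a\<close> on the divisor and residuals of degree
  \<open>a - 1\<close> and \<open>a - 2\<close>. For odd \<open>b\<close> and \<open>a = 2\<close> the numbers divide evenly. For even \<open>b\<close> the induction for
  \<open>a = 3, 4\<close> avoids the defective range of degree \<open>2\<close>, apart from some sporadic cases.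

  For \<open>a = 2\<close>, \<open>b = 2 k\<close> and \<open>s = (n + 1) (k + 1) - 1\<close> the expected dimension is that of the ambient
  space, but the square catalecticant matrix of size \<open>(n + 1) (k + 1)\<close> has rank at most \<open>s\<close> on the
  secant variety, which is thus proper.
\<close>

section \<open>Ranks of families of coefficient vectors\<close>

text \<open>The differential version of the method is forced by divisibility. The trace space has
  dimension \<open>(m + 2) * u + d\<close> with a remainder \<open>d\<close>: the tangent spaces at
  \<open>u\<close> points leave a gap of \<open>d\<close>, and \<open>d\<close> further points fill
  it with one vector each, at the price of the normal derivative at these points in the residual.
  This price is at most \<open>d\<close>, so the count balances up to two inequalities, which hold
  as soon as \<open>b\<close> and the degree are at least 3.

  The obstacle is degree 2 with \<open>b = 2 * k\<close>, which occurs as the first residual of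
  degree 3 and as the second residual of degree 4. There the rank is known to be maximal for at most
  \<open>k * (n + 1)\<close> and for at least \<open>(k + 1) * (n + 1)\<close> points, by comparison
  with the odd numbers \<open>b - 1\<close> and \<open>b + 1\<close>; strictly in between nothing is
  available.

  On the geometric side the dimension is that of a topological space, so a lower bound requires an
  actual chain of subvarieties, whose members must be proved distinct.\<close>

definition fscale :: "complex \<Rightarrow> ('a \<Rightarrow> complex) \<Rightarrow> 'a \<Rightarrow> complex" where
  "fscale c f = (\<lambda>x. c * f x)"

lemma fscale_apply [simp]: "fscale c f x = c * f x"
  by (simp add: fscale_def)

lemma sum_fun_apply: "(\<Sum>k\<in>K. f k) x = (\<Sum>k\<in>K. f k x)"
  for f :: "'k \<Rightarrow> 'a \<Rightarrow> 'b::comm_monoid_add"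
  by (induction K rule: infinite_finite_induct) auto

interpretation fs: vector_space fscale
  by unfold_locales (auto simp: fun_eq_iff algebra_simps)

interpretation fs: vector_space_pair fscale fscale ..

abbreviation flinear :: "(('a \<Rightarrow> complex) \<Rightarrow> ('b \<Rightarrow> complex)) \<Rightarrow> bool" where
  "flinear \<equiv> Vector_Spaces.linear fscale fscale"

lemma flinearI:
  assumes "\<And>v w x. f (v + w) x = f v x + f w x" "\<And>c v x. f (fscale c v) x = c * f v x"
  shows "flinear f"
  unfolding Vector_Spaces.linear_iff
  using assms by (auto simp: fun_eq_iff fs.vector_space_axioms)

lemma flinear_family:
  assumes "flinear f"
  shows "f (\<Sum>k\<in>K. fscale (c k) (w k)) = (\<Sum>k\<in>K. fscale (c k) (f (w k)))"
  by (subst fs.linear_sum[OF assms]) (rule sum.cong[OF refl fs.linear_scale[OF assms]])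

text \<open>A family rather than a set, so that a repeated vector counts as a dependency: deformed
  vectors keep their indices while their values may collide.\<close>

definition indep_family :: "'k set \<Rightarrow> ('k \<Rightarrow> 'a \<Rightarrow> complex) \<Rightarrow> bool" where
  "indep_family K w \<longleftrightarrow> (\<forall>c. (\<Sum>k\<in>K. fscale (c k) (w k)) = 0 \<longrightarrow> (\<forall>k\<in>K. c k = 0))"

lemma indep_familyD:
  "indep_family K w \<Longrightarrow> (\<Sum>k\<in>K. fscale (c k) (w k)) = 0 \<Longrightarrow> k \<in> K \<Longrightarrow> c k = 0"
  by (auto simp: indep_family_def)

lemma indep_family_iff:
  assumes "finite K"
  shows "indep_family K w \<longleftrightarrow> inj_on w K \<and> fs.independent (w ` K)"
proof
  assume L: "indep_family K w"
  have inj: "inj_on w K"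
  proof (rule inj_onI, rule ccontr)
    fix i j assume ij: "i \<in> K" "j \<in> K" "w i = w j" "i \<noteq> j"
    let ?c = "\<lambda>k. if k = i then 1 else if k = j then - 1 else 0"
    have "(\<Sum>k\<in>K. fscale (?c k) (w k)) = (\<Sum>k\<in>{i,j}. fscale (?c k) (w k))"
      by (rule sum.mono_neutral_right) (use ij assms in \<open>auto simp: fun_eq_iff\<close>)
    also have "\<dots> = 0"
      using ij by (auto simp: fun_eq_iff)
    finally show False
      using indep_familyD[OF L, of ?c i] ij by auto
  qed
  moreover have "fs.independent (w ` K)"
  proof (rule fs.independent_if_scalars_zero)
    fix g v assume *: "(\<Sum>x\<in>w ` K. fscale (g x) x) = 0" "v \<in> w ` K"
    then have "(\<Sum>k\<in>K. fscale (g (w k)) (w k)) = 0"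
      by (simp add: sum.reindex[OF inj])
    then show "g v = 0"
      using indep_familyD[OF L, of "\<lambda>k. g (w k)"] * by auto
  qed (use assms in auto)
  ultimately show "inj_on w K \<and> fs.independent (w ` K)" ..
next
  assume R: "inj_on w K \<and> fs.independent (w ` K)"
  show "indep_family K w"
    unfolding indep_family_def
  proof (intro allI impI ballI)
    fix c k assume *: "(\<Sum>k\<in>K. fscale (c k) (w k)) = 0" "k \<in> K"
    let ?g = "\<lambda>v. c (the_inv_into K w v)"
    have "(\<Sum>v\<in>w ` K. fscale (?g v) v) = (\<Sum>k\<in>K. fscale (c k) (w k))"
      using R by (simp add: sum.reindex the_inv_into_f_f)
    then have "?g (w k) = 0"
      using fs.independentD[of "w ` K" "w ` K" ?g "w k"] R * assms by auto
    then show "c k = 0"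
      using R * by (simp add: the_inv_into_f_f)
  qed
qed

lemma indep_family_subset:
  assumes "indep_family K w" "J \<subseteq> K" "finite K"
  shows "indep_family J w"
  using assms fs.independent_mono[of "w ` K" "w ` J"]
  by (auto simp: indep_family_iff finite_subset intro: inj_on_subset)

text \<open>A lower bound on the dimension of the span, meaningful also for infinite-dimensional
  spans, where the cardinality of a basis would read 0.\<close>

definition rank_ge :: "('a \<Rightarrow> complex) set \<Rightarrow> nat \<Rightarrow> bool" where
  "rank_ge S r \<longleftrightarrow> (\<exists>w. indep_family {..<r} w \<and> (\<forall>i<r. w i \<in> fs.span S))"

lemma rank_geI:
  assumes "finite K" "indep_family K w" "\<And>k. k \<in> K \<Longrightarrow> w k \<in> fs.span S"
  shows "rank_ge S (card K)"
proof -
  obtain h where h: "bij_betw h {..<card K} K"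
    using assms(1) by (metis bij_betw_from_nat_into_finite)
  have "(w \<circ> h) ` {..<card K} = w ` K"
    using h by (metis bij_betw_def image_comp)
  moreover have "inj_on (w \<circ> h) {..<card K}"
    using assms(1,2) h by (auto simp: indep_family_iff bij_betw_def intro!: comp_inj_on)
  ultimately have "indep_family {..<card K} (w \<circ> h)"
    using assms(1,2) by (simp add: indep_family_iff)
  then show ?thesis
    unfolding rank_ge_def using h assms(3)
    by (intro exI[of _ "w \<circ> h"]) (auto dest: bij_betwE)
qed

lemma rank_ge_independent:
  assumes "finite B" "fs.independent B" "B \<subseteq> fs.span S"
  shows "rank_ge S (card B)"
  by (rule rank_geI[of B id]) (use assms in \<open>auto simp: indep_family_iff\<close>)

lemma rank_ge_0 [simp]: "rank_ge S 0"
  by (auto simp: rank_ge_def indep_family_def)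

lemma rank_ge_mono:
  assumes "rank_ge S r" "S \<subseteq> fs.span T"
  shows "rank_ge T r"
proof -
  have "fs.span S \<subseteq> fs.span T"
    by (rule fs.span_minimal[OF assms(2)]) simp
  then show ?thesis
    using assms(1) by (auto simp: rank_ge_def)
qed

lemma rank_ge_subset: "rank_ge S r \<Longrightarrow> S \<subseteq> T \<Longrightarrow> rank_ge T r"
  by (erule rank_ge_mono) (meson fs.span_superset subset_trans)

lemma rank_ge_le:
  assumes "rank_ge S r" "r' \<le> r"
  shows "rank_ge S r'"
proof -
  obtain w where "indep_family {..<r} w" "\<forall>i<r. w i \<in> fs.span S"
    using assms(1) by (auto simp: rank_ge_def)
  then show ?thesis
    unfolding rank_ge_def using assms(2)
    by (intro exI[of _ w]) (auto intro: indep_family_subset)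
qed

lemma rank_ge_span_bound:
  assumes "rank_ge S r" "S \<subseteq> fs.span T" "finite T"
  shows "r \<le> card T"
proof -
  obtain w where w: "indep_family {..<r} w" "\<forall>i<r. w i \<in> fs.span T"
    using rank_ge_mono[OF assms(1,2)] by (auto simp: rank_ge_def)
  then have "card (w ` {..<r}) = r" "fs.independent (w ` {..<r})"
    by (auto simp: indep_family_iff card_image)
  then show ?thesis
    using fs.independent_span_bound[OF assms(3), of "w ` {..<r}"] w by auto
qed

lemma rank_ge_basis:
  assumes "finite S"
  obtains B where "B \<subseteq> S" "fs.independent B" "S \<subseteq> fs.span B" "\<And>r. rank_ge S r \<longleftrightarrow> r \<le> card B"
proof -
  obtain B where B: "B \<subseteq> S" "fs.independent B" "S \<subseteq> fs.span B"
    using fs.maximal_independent_subset[of S] by blast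
  have fin: "finite B"
    using B(1) assms finite_subset by blast
  have "rank_ge S (card B)"
    using B fin by (intro rank_ge_independent) (auto intro: fs.span_base)
  then have "rank_ge S r \<longleftrightarrow> r \<le> card B" for r
    using rank_ge_span_bound[OF _ B(3) fin, of r] rank_ge_le by blast
  then show ?thesis using that B by blast
qed

lemma rank_ge_family:
  assumes "finite K" "rank_ge (w ` K) r"
  obtains J where "J \<subseteq> K" "card J = r" "indep_family J w"
proof -
  obtain B where B: "B \<subseteq> w ` K" "fs.independent B" "r \<le> card B"
    using rank_ge_basis[of "w ` K"] assms by (metis finite_imageI)
  obtain C where C: "C \<subseteq> B" "card C = r"
    using B(3) by (meson obtain_subset_with_card_n)
  obtain J where J: "J \<subseteq> K" "inj_on w J" "C = w ` J"
    using B(1) C(1) by (meson subset_image_inj subset_trans)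
  have "finite J" using J assms finite_subset by blast
  then have "indep_family J w"
    using J fs.independent_mono[OF B(2) C(1)] by (simp add: indep_family_iff)
  then show ?thesis using that J C by (auto simp: card_image)
qed

lemma rank_ge_linear_image:
  assumes "flinear f" "rank_ge (f ` S) r"
  shows "rank_ge S r"
proof -
  obtain w where w: "indep_family {..<r} w" "\<forall>i<r. w i \<in> f ` fs.span S"
    using assms(2) unfolding rank_ge_def fs.linear_span_image[OF assms(1)] by (elim exE conjE)
  then have "\<forall>i\<in>{..<r}. \<exists>x. x \<in> fs.span S \<and> w i = f x"
    by blast
  from bchoice[OF this] obtain v where v: "\<And>i. i < r \<Longrightarrow> v i \<in> fs.span S \<and> w i = f (v i)"
    by auto
  have "indep_family {..<r} v"
    unfolding indep_family_def
  proof (intro allI impI)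
    fix c assume *: "(\<Sum>k<r. fscale (c k) (v k)) = 0"
    have "(\<Sum>k<r. fscale (c k) (f (v k))) = f (\<Sum>k<r. fscale (c k) (v k))"
      by (rule flinear_family[OF assms(1), symmetric])
    also have "\<dots> = 0"
      unfolding * by (rule fs.linear_0[OF assms(1)])
    finally have "(\<Sum>k<r. fscale (c k) (f (v k))) = 0" .
    then have "(\<Sum>k<r. fscale (c k) (w k)) = 0"
      using v by simp
    then show "\<forall>k\<in>{..<r}. c k = 0"
      using indep_familyD[OF w(1)] by blast
  qed
  then show ?thesis using v by (auto simp: rank_ge_def)
qed

text \<open>Take independent vectors in the kernel part and lifts of independent vectors of the
  image. Applying \<open>f\<close> to a relation isolates the coefficients of the lifts. Trace and
  residual are added in this way, and so are the ends of an exact sequence of graded pieces.\<close>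

lemma rank_ge_split:
  assumes "flinear f" "\<And>x. x \<in> T \<Longrightarrow> f x = 0" "rank_ge T r1" "rank_ge (f ` S) r2"
  shows "rank_ge (T \<union> S) (r1 + r2)"
proof -
  obtain w1 where w1: "indep_family {..<r1} w1" "\<And>i. i < r1 \<Longrightarrow> w1 i \<in> fs.span T"
    using assms(3) by (auto simp: rank_ge_def)
  obtain w where w: "indep_family {..<r2} w" "\<forall>i<r2. w i \<in> f ` fs.span S"
    using assms(4) unfolding rank_ge_def fs.linear_span_image[OF assms(1)] by (elim exE conjE)
  then have "\<forall>i\<in>{..<r2}. \<exists>x. x \<in> fs.span S \<and> w i = f x"
    by blast
  from bchoice[OF this] obtain w2 where w2: "\<And>i. i < r2 \<Longrightarrow> w2 i \<in> fs.span S \<and> w i = f (w2 i)"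
    by auto
  have f0: "f x = 0" if "x \<in> fs.span T" for x
    by (rule fs.linear_eq_0_on_span[OF assms(1) assms(2) that])
  let ?K = "{..<r1} <+> {..<r2}"
  let ?u = "case_sum w1 w2"
  have "indep_family ?K ?u"
    unfolding indep_family_def
  proof (intro allI impI ballI)
    fix c k assume *: "(\<Sum>k\<in>?K. fscale (c k) (?u k)) = 0" and k: "k \<in> ?K"
    have split: "(\<Sum>k<r1. fscale (c (Inl k)) (w1 k)) + (\<Sum>k<r2. fscale (c (Inr k)) (w2 k)) = 0"
      using * by (subst (asm) sum.Plus) auto
    have "f (\<Sum>k<r1. fscale (c (Inl k)) (w1 k)) = 0"
      by (rule f0) (auto intro!: fs.span_sum fs.span_scale w1)
    moreover have "f (\<Sum>k<r2. fscale (c (Inr k)) (w2 k)) = (\<Sum>k<r2. fscale (c (Inr k)) (w k))"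
      by (simp add: flinear_family[OF assms(1)] w2)
    ultimately have "(\<Sum>k<r2. fscale (c (Inr k)) (w k)) = 0"
      using arg_cong[OF split, of f] by (simp add: fs.linear_add[OF assms(1)] fs.linear_0[OF assms(1)])
    then have c2: "c (Inr k) = 0" if "k < r2" for k
      using indep_familyD[OF w(1), of "\<lambda>k. c (Inr k)" k] that by auto
    then have "(\<Sum>k<r1. fscale (c (Inl k)) (w1 k)) = 0"
      using split by (simp add: fun_eq_iff sum_fun_apply)
    then have "c (Inl k) = 0" if "k < r1" for k
      using indep_familyD[OF w1(1), of "\<lambda>k. c (Inl k)" k] that by auto
    with c2 k show "c k = 0" by auto
  qed
  moreover have "?u k \<in> fs.span (T \<union> S)" if "k \<in> ?K" for k
    using that w1(2) w2 fs.span_mono[of T "T \<union> S"] fs.span_mono[of S "T \<union> S"] by auto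
  ultimately have "rank_ge (T \<union> S) (card ?K)"
    by (intro rank_geI) auto
  then show ?thesis by (simp add: card_Plus)
qed

lemma rank_ge_Un_diff:
  assumes "finite S" "finite X" "rank_ge (S \<union> X) r"
  shows "rank_ge S (r - card X)"
proof -
  obtain B where B: "B \<subseteq> S" "S \<subseteq> fs.span B" "\<And>r. rank_ge S r \<longleftrightarrow> r \<le> card B"
    by (rule rank_ge_basis[OF assms(1)]) (rule that)
  have "S \<union> X \<subseteq> fs.span (B \<union> X)"
    using B(2) fs.span_mono[of B "B \<union> X"] fs.span_superset[of "B \<union> X"] by blast
  then have "r \<le> card (B \<union> X)"
    using rank_ge_span_bound[OF assms(3)] B(1) assms(1,2) finite_subset by blast
  also have "\<dots> \<le> card B + card X"
    by (rule card_Un_le)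
  finally show ?thesis
    using B(3) by simp
qed

lemma rank_ge_insert:
  assumes "rank_ge S r" "d \<notin> fs.span S"
  shows "rank_ge (insert d S) (Suc r)"
proof -
  obtain w where w: "indep_family {..<r} w" "\<And>i. i < r \<Longrightarrow> w i \<in> fs.span S"
    using assms(1) by (auto simp: rank_ge_def)
  have W: "w ` {..<r} \<subseteq> fs.span S" using w(2) by auto
  have nd: "d \<notin> fs.span (w ` {..<r})"
    using assms(2) fs.span_minimal[OF W] by auto
  have "fs.independent (w ` {..<r})"
    using w(1) by (simp add: indep_family_iff)
  then have "fs.independent (insert d (w ` {..<r}))"
    by (rule fs.independent_insertI[OF nd])
  moreover have "d \<notin> w ` {..<r}" using W assms(2) by auto
  then have "card (insert d (w ` {..<r})) = Suc r"
    using w(1) by (simp add: indep_family_iff card_image)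
  moreover have "insert d (w ` {..<r}) \<subseteq> fs.span (insert d S)"
    using W fs.span_mono[of S "insert d S"] by (auto intro: fs.span_base)
  ultimately show ?thesis
    using rank_ge_independent[of "insert d (w ` {..<r})"] by auto
qed

text \<open>Greedy choice: while the span of \<open>S\<close> misses an element of \<open>D\<close>,
  adding this element raises the rank by one; once it contains \<open>D\<close>, the rank
  \<open>r\<close> is reached. With \<open>D\<close> a set of points, suitable simple points impose
  independent conditions.\<close>

lemma rank_ge_extend:
  assumes "rank_ge S r0" "rank_ge (S \<union> D) r" "D \<noteq> {}"
  shows "\<exists>d. (\<forall>j<u. d j \<in> D) \<and> rank_ge (S \<union> d ` {..<u}) (min r (r0 + u))"
  using assms(1,2)
proof (induction u arbitrary: S r0)
  case 0
  then show ?case by (auto intro: rank_ge_le)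
next
  case (Suc u)
  obtain d0 where d0: "d0 \<in> D" using assms(3) by blast
  show ?case
  proof (cases "D \<subseteq> fs.span S")
    case True
    then have "S \<union> D \<subseteq> fs.span S"
      using fs.span_superset[of S] by blast
    with Suc.prems(2) have "rank_ge S r"
      using rank_ge_mono by blast
    then have "rank_ge (S \<union> (\<lambda>_. d0) ` {..<Suc u}) (min r (r0 + Suc u))"
      by (rule rank_ge_subset[OF rank_ge_le]) auto
    with d0 show ?thesis by (intro exI[of _ "\<lambda>_. d0"]) simp
  next
    case False
    then obtain e where e: "e \<in> D" "e \<notin> fs.span S" by blast
    have "rank_ge (insert e S \<union> D) r"
      by (rule rank_ge_subset[OF Suc.prems(2)]) auto
    from Suc.IH[OF rank_ge_insert[OF Suc.prems(1) e(2)] this]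
    obtain d where d: "\<forall>j<u. d j \<in> D"
      "rank_ge (insert e S \<union> d ` {..<u}) (min r (Suc r0 + u))"
      by (elim exE conjE)
    have "S \<union> (d(u := e)) ` {..<Suc u} = insert e S \<union> d ` {..<u}"
      by (auto simp: lessThan_Suc)
    with d e(1) show ?thesis
      by (intro exI[of _ "d(u := e)"]) auto
  qed
qed

definition unit_vec :: "'a \<Rightarrow> 'a \<Rightarrow> complex" where
  "unit_vec i = (\<lambda>x. if x = i then 1 else 0)"

text \<open>Duality: if the coordinates in \<open>I\<close> did not span all unit vectors, a
  functional would vanish on them, and its values at the unit vectors are the coefficients of a
  nonzero relation. Rank statements thus become uniqueness statements for interpolation.\<close>

lemma rank_ge_annihilator:
  assumes "finite I"
    and "\<And>c. (\<And>w. w \<in> S \<Longrightarrow> (\<Sum>i\<in>I. c i * w i) = 0) \<Longrightarrow> \<forall>i\<in>I. c i = 0"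
  shows "rank_ge S (card I)"
proof -
  define f :: "('a \<Rightarrow> complex) \<Rightarrow> 'a \<Rightarrow> complex" where "f v = (\<lambda>x. if x \<in> I then v x else 0)" for v
  have f: "flinear f"
    by (rule flinearI) (auto simp: f_def)
  have uv: "f v = (\<Sum>i\<in>I. fscale (v i) (unit_vec i))" for v
    using assms(1) by (auto simp: f_def fun_eq_iff sum_fun_apply unit_vec_def if_distrib cong: if_cong)
  have "unit_vec i \<in> fs.span (f ` S)" if i: "i \<in> I" for i
  proof (rule ccontr)
    assume ni: "unit_vec i \<notin> fs.span (f ` S)"
    obtain B where B: "B \<subseteq> f ` S" "fs.independent B" "f ` S \<subseteq> fs.span B"
      using fs.maximal_independent_subset by blast
    have "unit_vec i \<notin> fs.span B"
      using ni fs.span_mono[OF B(1)] by auto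
    then have "fs.independent (insert (unit_vec i) B)"
      using B(2) fs.independent_insertI by blast
    then obtain g :: "('a \<Rightarrow> complex) \<Rightarrow> unit \<Rightarrow> complex"
      where g: "flinear g" "\<And>x. x \<in> insert (unit_vec i) B \<Longrightarrow> g x = (if x = unit_vec i then 1 else 0)"
      using fs.linear_independent_extend[of _ "\<lambda>x. if x = unit_vec i then 1 else 0"] by metis
    have gB: "g x = 0" if "x \<in> fs.span B" for x
      by (rule fs.linear_eq_0_on_span[OF g(1) _ that])
        (use g(2) \<open>unit_vec i \<notin> fs.span B\<close> in \<open>auto dest: fs.span_base\<close>)
    have gi: "g (unit_vec i) = 1" using g(2) by auto
    have "(\<Sum>k\<in>I. g (unit_vec k) () * w k) = 0" if "w \<in> S" for w
    proof -
      have "g (f w) = 0" using gB B(3) that by blast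
      then show ?thesis
        unfolding uv flinear_family[OF g(1)] by (simp add: fun_eq_iff sum_fun_apply mult.commute)
    qed
    from assms(2)[OF this] i gi show False by (auto simp: fun_eq_iff)
  qed
  moreover have "indep_family I unit_vec"
    unfolding indep_family_def
  proof (intro allI impI ballI)
    fix c i assume "(\<Sum>k\<in>I. fscale (c k) (unit_vec k)) = 0" "i \<in> I"
    then show "c i = 0"
      using assms(1) by (auto simp: fun_eq_iff sum_fun_apply unit_vec_def if_distrib cong: if_cong
          dest!: spec[of _ i])
  qed
  ultimately have "rank_ge (f ` S) (card I)"
    using assms(1) by (intro rank_geI) auto
  then show ?thesis
    by (rule rank_ge_linear_image[OF f])
qed

text \<open>Fraction-free Gaussian elimination: the matrix entries are evaluated at a variable point
  \<open>q\<close>, and the product of the pivots is a polynomial in the entries. The grading of \<open>R\<close> keeps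
  track of homogeneity.\<close>

lemma indep_family_open:
  fixes w :: "'k \<Rightarrow> 'q \<Rightarrow> 'a \<Rightarrow> complex" and R :: "nat \<Rightarrow> ('q \<Rightarrow> complex) set"
  assumes "finite K" "indep_family K (\<lambda>k. w k q0)"
    and "\<And>k x. k \<in> K \<Longrightarrow> (\<lambda>q. w k q x) \<in> R d"
    and R1: "(\<lambda>_. 1) \<in> R 0"
    and Rm: "\<And>f g d e. f \<in> R d \<Longrightarrow> g \<in> R e \<Longrightarrow> (\<lambda>q. f q * g q) \<in> R (d + e)"
    and Rs: "\<And>f g d. f \<in> R d \<Longrightarrow> g \<in> R d \<Longrightarrow> (\<lambda>q. f q - g q) \<in> R d"
  shows "\<exists>F e. F \<in> R e \<and> F q0 \<noteq> 0 \<and> (\<forall>q. F q \<noteq> 0 \<longrightarrow> indep_family K (\<lambda>k. w k q))"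
  using assms(1-3)
proof (induction K arbitrary: w d rule: finite_induct)
  case empty
  show ?case
    by (intro exI[of _ "\<lambda>_. 1"] exI[of _ 0]) (auto simp: R1 indep_family_def)
next
  case (insert k K)
  have "w k q0 \<noteq> 0"
  proof
    assume "w k q0 = 0"
    then have "(\<Sum>j\<in>insert k K. fscale (if j = k then 1 else 0) (w j q0)) = 0"
      using insert.hyps by (auto simp: fun_eq_iff sum_fun_apply intro!: sum.neutral)
    from indep_familyD[OF insert.prems(1) this, of k] show False by simp
  qed
  then obtain i where i: "w k q0 i \<noteq> 0" by (auto simp: fun_eq_iff)
  \<comment> \<open>One elimination step with pivot \<open>w k q i\<close>: the entry at
    \<open>i\<close> of each \<open>v j\<close> becomes 0. Nothing is divided, so the entries stay
    in the graded family \<open>R\<close>, with the degree doubled.\<close>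
  define v where "v = (\<lambda>j q x. w k q i * w j q x - w k q x * w j q i)"
  have elim: "(\<Sum>j\<in>K. fscale (c j) (v j q)) =
      fscale (w k q i) (\<Sum>j\<in>K. fscale (c j) (w j q)) - fscale (\<Sum>j\<in>K. c j * w j q i) (w k q)" for c q
    by (simp add: fun_eq_iff sum_fun_apply v_def sum_distrib_left sum_distrib_right
        sum_subtractf[symmetric] algebra_simps)
  have "indep_family K (\<lambda>j. v j q0)"
    unfolding indep_family_def
  proof (intro allI impI ballI)
    fix c j assume *: "(\<Sum>j\<in>K. fscale (c j) (v j q0)) = 0" and j: "j \<in> K"
    let ?c = "\<lambda>j. if j = k then - (\<Sum>j\<in>K. c j * w j q0 i) else w k q0 i * c j"
    have "(\<Sum>j\<in>K. fscale (?c j) (w j q0)) = (\<Sum>j\<in>K. fscale (w k q0 i * c j) (w j q0))"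
      using insert.hyps by (intro sum.cong) auto
    then have "(\<Sum>j\<in>insert k K. fscale (?c j) (w j q0)) = (\<Sum>j\<in>K. fscale (c j) (v j q0))"
      using insert.hyps unfolding elim
      by (simp add: fun_eq_iff sum_fun_apply sum_distrib_left mult_ac)
    with * have "?c j = 0"
      using indep_familyD[OF insert.prems(1), of ?c j] j by simp
    then show "c j = 0" using i j insert.hyps by (auto split: if_splits)
  qed
  moreover have "(\<lambda>q. v j q x) \<in> R (d + d)" if "j \<in> K" for j x
    unfolding v_def using that insert.prems(2) by (intro Rs Rm) auto
  ultimately obtain F e where F: "F \<in> R e" "F q0 \<noteq> 0"
    "\<And>q. F q \<noteq> 0 \<Longrightarrow> indep_family K (\<lambda>k. v k q)"
    using insert.IH by blast
  have "indep_family (insert k K) (\<lambda>j. w j q)" if q: "F q * w k q i \<noteq> 0" for q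
    unfolding indep_family_def
  proof (intro allI impI)
    fix c assume *: "(\<Sum>j\<in>insert k K. fscale (c j) (w j q)) = 0"
    then have 1: "fscale (c k) (w k q) + (\<Sum>j\<in>K. fscale (c j) (w j q)) = 0"
      using insert.hyps by simp
    then have 2: "(\<Sum>j\<in>K. c j * w j q x) = - (c k * w k q x)" for x
      by (simp add: fun_eq_iff sum_fun_apply eq_neg_iff_add_eq_0 add.commute)
    have "(\<Sum>j\<in>K. fscale (c j) (v j q)) = 0"
      unfolding elim by (simp add: fun_eq_iff sum_fun_apply 2)
    with F(3) q have cK: "\<forall>j\<in>K. c j = 0"
      by (auto dest: indep_familyD)
    then have "c k * w k q i = 0"
      using 2[of i] by simp
    with q cK show "\<forall>j\<in>insert k K. c j = 0" by auto
  qed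
  moreover have "(\<lambda>q. F q * w k q i) \<in> R (e + d)"
    using F(1) insert.prems(2) by (intro Rm) auto
  ultimately show ?case
    using F(2) i by (intro exI[of _ "\<lambda>q. F q * w k q i"] exI[of _ "e + d"]) auto
qed

section \<open>Polynomial functions and general position\<close>

inductive_set polyfn :: "(('k \<Rightarrow> complex) \<Rightarrow> complex) set" where
  polyfn_const: "(\<lambda>_. c) \<in> polyfn"
| polyfn_coord: "(\<lambda>q. q k) \<in> polyfn"
| polyfn_add: "F \<in> polyfn \<Longrightarrow> G \<in> polyfn \<Longrightarrow> (\<lambda>q. F q + G q) \<in> polyfn"
| polyfn_mult: "F \<in> polyfn \<Longrightarrow> G \<in> polyfn \<Longrightarrow> (\<lambda>q. F q * G q) \<in> polyfn"

lemma polyfn_diff: "F \<in> polyfn \<Longrightarrow> G \<in> polyfn \<Longrightarrow> (\<lambda>q. F q - G q) \<in> polyfn"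
  using polyfn_add[OF _ polyfn_mult[OF polyfn_const[of "-1"]], of F G] by simp

lemma polyfn_sum: "(\<And>k. k \<in> K \<Longrightarrow> F k \<in> polyfn) \<Longrightarrow> (\<lambda>q. \<Sum>k\<in>K. F k q) \<in> polyfn"
  by (induction K rule: infinite_finite_induct) (auto intro: polyfn.intros)

lemma polyfn_prod: "(\<And>k. k \<in> K \<Longrightarrow> F k \<in> polyfn) \<Longrightarrow> (\<lambda>q. \<Prod>k\<in>K. F k q) \<in> polyfn"
  by (induction K rule: infinite_finite_induct) (auto intro: polyfn.intros)

lemma polyfn_power: "F \<in> polyfn \<Longrightarrow> (\<lambda>q. F q ^ m) \<in> polyfn"
  by (induction m) (auto intro: polyfn.intros)

lemmas polyfn_intros = polyfn_const polyfn_coord polyfn_add polyfn_mult polyfn_diff polyfn_sum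
  polyfn_prod polyfn_power

lemma polyfn_comp:
  assumes "F \<in> polyfn" "\<And>k. (\<lambda>q. h q k) \<in> polyfn"
  shows "(\<lambda>q. F (h q)) \<in> polyfn"
  using assms(1) by induction (auto intro: polyfn_intros assms(2))

lemma polyfn_curve:
  assumes "F \<in> polyfn" "\<And>k. \<exists>p. \<forall>t. h t k = poly p t"
  shows "\<exists>p. \<forall>t. F (h t) = poly p t"
  using assms(1)
proof induction
  case (polyfn_const c)
  show ?case by (intro exI[of _ "[:c:]"]) simp
next
  case (polyfn_coord k)
  show ?case by (rule assms(2))
next
  case (polyfn_add F G)
  then show ?case by (metis poly_add)
next
  case (polyfn_mult F G)
  then show ?case by (metis poly_mult)
qed

lemma polyfn_line:
  assumes "F \<in> polyfn"
  shows "\<exists>p. \<forall>t. F (\<lambda>k. a k + t * d k) = poly p t"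
  by (rule polyfn_curve[OF assms]) (auto intro!: exI[of _ "[:a _, d _:]"])

text \<open>On the line through the two witnesses both functions are nonzero polynomials in one
  variable, so their product has finitely many zeros. This is the irreducibility of affine
  space.\<close>

lemma polyfn_common_nonzero:
  assumes "F \<in> polyfn" "G \<in> polyfn" "F a \<noteq> 0" "G b \<noteq> 0"
  shows "\<exists>q. F q \<noteq> 0 \<and> G q \<noteq> 0"
proof -
  let ?h = "\<lambda>t k. a k + t * (b k - a k)"
  obtain p1 where p1: "\<And>t. F (?h t) = poly p1 t" using polyfn_line[OF assms(1), of a "\<lambda>k. b k - a k"] by auto
  obtain p2 where p2: "\<And>t. G (?h t) = poly p2 t" using polyfn_line[OF assms(2), of a "\<lambda>k. b k - a k"] by auto
  have "poly p1 0 \<noteq> 0" "poly p2 1 \<noteq> 0"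
    using assms(3,4) by (simp_all flip: p1 p2)
  then have "p1 * p2 \<noteq> 0" by auto
  then have "finite {t. poly (p1 * p2) t = 0}" by (rule poly_roots_finite)
  then have "{t. poly (p1 * p2) t = 0} \<noteq> UNIV"
    using infinite_UNIV_char_0[where 'a = complex] by metis
  then obtain t where "poly (p1 * p2) t \<noteq> 0"
    by blast
  then show ?thesis by (auto simp flip: p1 p2)
qed

text \<open>Validity on a nonempty principal open set. Conditions verified at different special
  points can then be imposed on one common point.\<close>

definition generic :: "(('k \<Rightarrow> complex) \<Rightarrow> bool) \<Rightarrow> bool" where
  "generic P \<longleftrightarrow> (\<exists>F\<in>polyfn. (\<exists>q. F q \<noteq> 0) \<and> (\<forall>q. F q \<noteq> 0 \<longrightarrow> P q))"

lemma generic_conj: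
  assumes "generic P" "generic Q"
  shows "generic (\<lambda>q. P q \<and> Q q)"
proof -
  obtain F G a b where F: "F \<in> polyfn" "F a \<noteq> 0" "\<And>q. F q \<noteq> 0 \<Longrightarrow> P q"
    and G: "G \<in> polyfn" "G b \<noteq> 0" "\<And>q. G q \<noteq> 0 \<Longrightarrow> Q q"
    using assms by (auto simp: generic_def)
  have "\<exists>q. F q \<noteq> 0 \<and> G q \<noteq> 0"
    using polyfn_common_nonzero[of F G a b] F(1,2) G(1,2) by simp
  then show ?thesis
    unfolding generic_def using F G
    by (intro bexI[of _ "\<lambda>q. F q * G q"]) (auto intro: polyfn_intros)
qed

lemma generic_ex: "generic P \<Longrightarrow> \<exists>q. P q"
  by (auto simp: generic_def)

lemma generic_nonzero: "F \<in> polyfn \<Longrightarrow> F q \<noteq> 0 \<Longrightarrow> generic (\<lambda>q. F q \<noteq> 0)"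
  by (auto simp: generic_def)

lemma generic_mono: "generic P \<Longrightarrow> (\<And>q. P q \<Longrightarrow> Q q) \<Longrightarrow> generic Q"
  by (auto simp: generic_def)

lemma generic_ball:
  assumes "finite A" "\<And>a. a \<in> A \<Longrightarrow> generic (P a)"
  shows "generic (\<lambda>q. \<forall>a\<in>A. P a q)"
  using assms
proof (induction A rule: finite_induct)
  case empty
  show ?case unfolding generic_def by (intro bexI[of _ "\<lambda>_. 1"]) (auto intro: polyfn_intros)
next
  case (insert a A)
  then show ?case
    by (auto intro: generic_mono[OF generic_conj[of "P a" "\<lambda>q. \<forall>a\<in>A. P a q"]])
qed

lemma indep_family_generic:
  assumes "finite K" "\<And>k x. k \<in> K \<Longrightarrow> (\<lambda>q. w k q x) \<in> polyfn" "indep_family K (\<lambda>k. w k q0)"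
  shows "generic (\<lambda>q. indep_family K (\<lambda>k. w k q))"
proof -
  have "\<exists>F e::nat. F \<in> polyfn \<and> F q0 \<noteq> 0 \<and> (\<forall>q. F q \<noteq> 0 \<longrightarrow> indep_family K (\<lambda>k. w k q))"
    by (rule indep_family_open[of K w q0 "\<lambda>_. polyfn" 0]) (use assms in \<open>auto intro: polyfn_intros\<close>)
  then show ?thesis by (auto simp: generic_def)
qed

lemma rank_generic:
  assumes "finite K" "\<And>k x. k \<in> K \<Longrightarrow> (\<lambda>q. w k q x) \<in> polyfn" "rank_ge ((\<lambda>k. w k q0) ` K) r"
  shows "generic (\<lambda>q. rank_ge ((\<lambda>k. w k q) ` K) r)"
proof -
  obtain J where J: "J \<subseteq> K" "card J = r" "indep_family J (\<lambda>k. w k q0)"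
    using rank_ge_family[OF assms(1,3)] by blast
  have fin: "finite J" using J(1) assms(1) finite_subset by blast
  have "generic (\<lambda>q. indep_family J (\<lambda>k. w k q))"
    by (rule indep_family_generic[of J w q0]) (use fin J assms(2) in auto)
  then show ?thesis
  proof (rule generic_mono)
    fix q assume "indep_family J (\<lambda>k. w k q)"
    then have "rank_ge ((\<lambda>k. w k q) ` K) (card J)"
      by (rule rank_geI[of J "\<lambda>k. w k q", OF fin]) (use J(1) in \<open>auto intro: fs.span_base\<close>)
    with J(2) show "rank_ge ((\<lambda>k. w k q) ` K) r" by simp
  qed
qed

text \<open>Lower semicontinuity of the rank. The \<open>w k e\<close> may be combinations from the
  span of \<open>X e\<close> whose coefficients blow up as \<open>e\<close> tends to 0, as long as
  the vectors themselves converge.\<close>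

lemma rank_limit:
  fixes w :: "'k \<Rightarrow> complex \<Rightarrow> 'a \<Rightarrow> complex"
  assumes "finite K" "\<And>k x. k \<in> K \<Longrightarrow> isCont (\<lambda>e. w k e x) 0"
    and "rank_ge ((\<lambda>k. w k 0) ` K) r"
    and "\<And>k e. k \<in> K \<Longrightarrow> e \<noteq> 0 \<Longrightarrow> w k e \<in> fs.span (X e)"
  shows "\<exists>e. e \<noteq> 0 \<and> rank_ge (X e) r"
proof -
  obtain J where J: "J \<subseteq> K" "card J = r" "indep_family J (\<lambda>k. w k 0)"
    using rank_ge_family[OF assms(1,3)] by blast
  have fin: "finite J" using J(1) assms(1) finite_subset by blast
  have "\<exists>F e::nat. F \<in> {F :: complex \<Rightarrow> complex. isCont F 0} \<and> F 0 \<noteq> 0 \<and> (\<forall>e. F e \<noteq> 0 \<longrightarrow> indep_family J (\<lambda>k. w k e))"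
    by (rule indep_family_open[of J w 0 "\<lambda>_. {F. isCont F 0}" 0])
      (use fin J assms(2) in \<open>auto intro: continuous_intros\<close>)
  then obtain F :: "complex \<Rightarrow> complex" where F: "isCont F 0" "F 0 \<noteq> 0" "\<forall>e. F e \<noteq> 0 \<longrightarrow> indep_family J (\<lambda>k. w k e)"
    by auto
  have "eventually (\<lambda>e. F e \<noteq> 0) (at 0)"
    using F(1,2) by (simp add: isCont_def tendsto_imp_eventually_ne)
  then have "eventually (\<lambda>e. F e \<noteq> 0 \<and> e \<noteq> 0) (at 0)"
    by (auto simp: eventually_at_filter elim: eventually_mono)
  then obtain e where e: "F e \<noteq> 0" "e \<noteq> 0"
    using eventually_happens[of _ "at (0::complex)"] by auto
  have "rank_ge (X e) (card J)"
    by (rule rank_geI[of J "\<lambda>k. w k e", OF fin F(3)[rule_format, OF e(1)]]) (use assms(4) J(1) e(2) in blast)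
  with e J(2) show ?thesis by blast
qed

lemma base_digits_inj:
  fixes D :: nat
  assumes "\<And>i. i < k \<Longrightarrow> f i < D" "\<And>i. i < k \<Longrightarrow> g i < D"
    and "(\<Sum>i<k. f i * D ^ i) = (\<Sum>i<k. g i * D ^ i)"
  shows "\<forall>i<k. f i = g i"
  using assms
proof (induction k arbitrary: f g)
  case 0
  then show ?case by simp
next
  case (Suc k)
  have split: "(\<Sum>i<Suc k. h i * D ^ i) = h 0 + D * (\<Sum>i<k. h (Suc i) * D ^ i)" for h :: "nat \<Rightarrow> nat"
    by (simp add: sum.lessThan_Suc_shift sum_distrib_left mult_ac del: sum.lessThan_Suc)
  have *: "f 0 + D * (\<Sum>i<k. f (Suc i) * D ^ i) = g 0 + D * (\<Sum>i<k. g (Suc i) * D ^ i)"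
    using Suc.prems(3) unfolding split .
  have lt: "f 0 < D" "g 0 < D" using Suc.prems(1,2) by auto
  have f0: "f 0 = g 0"
    using arg_cong[OF *, of "\<lambda>n. n mod D"] lt by simp
  with * lt have eq: "(\<Sum>i<k. f (Suc i) * D ^ i) = (\<Sum>i<k. g (Suc i) * D ^ i)"
    by simp
  have step: "\<forall>i<k. f (Suc i) = g (Suc i)"
    by (rule Suc.IH[of "\<lambda>i. f (Suc i)" "\<lambda>i. g (Suc i)", OF _ _ eq]) (simp_all add: Suc.prems(1,2))
  show ?case
  proof (intro allI impI)
    fix i assume i: "i < Suc k"
    show "f i = g i"
    proof (cases i)
      case 0
      with f0 show ?thesis by simp
    next
      case (Suc j)
      with i step show ?thesis by simp
    qed
  qed
qed

text \<open>Kronecker substitution \<open>X i = y ^ (D ^ i)\<close> turns distinct monomials into distinct powers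
  of \<open>y\<close>.\<close>

lemma monomials_independent:
  fixes c :: "(nat \<Rightarrow> nat) \<Rightarrow> complex"
  assumes fin: "finite G" and supp: "\<And>\<gamma> i. \<gamma> \<in> G \<Longrightarrow> k \<le> i \<Longrightarrow> \<gamma> i = 0"
    and zero: "\<And>X. (\<Sum>\<gamma>\<in>G. c \<gamma> * (\<Prod>i<k. X i ^ \<gamma> i)) = 0"
  shows "\<forall>\<gamma>\<in>G. c \<gamma> = 0"
proof -
  define D where "D = Suc (Max (insert 0 ((\<lambda>(\<gamma>, i). \<gamma> i) ` (G \<times> {..<k}))))"
  have D: "\<gamma> i < D" if "\<gamma> \<in> G" "i < k" for \<gamma> i
    unfolding D_def less_Suc_eq_le by (rule Max_ge) (use that fin in auto)
  define code where "code \<gamma> = (\<Sum>i<k. \<gamma> i * D ^ i)" for \<gamma> :: "nat \<Rightarrow> nat"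
  have inj: "inj_on code G"
  proof (rule inj_onI)
    fix \<gamma> \<delta> assume *: "\<gamma> \<in> G" "\<delta> \<in> G" "code \<gamma> = code \<delta>"
    then have "\<forall>i<k. \<gamma> i = \<delta> i"
      using D by (intro base_digits_inj[of k \<gamma> D \<delta>]) (auto simp: code_def)
    then show "\<gamma> = \<delta>"
      using supp * by (metis ext not_le_imp_less)
  qed
  define p where "p = (\<Sum>\<gamma>\<in>G. monom (c \<gamma>) (code \<gamma>))"
  have "poly p y = 0" for y
  proof -
    have "(\<Prod>i<k. (y ^ (D ^ i)) ^ \<gamma> i) = y ^ code \<gamma>" for \<gamma>
      by (simp add: code_def power_sum power_mult[symmetric] mult.commute)
    then show ?thesis
      using zero[of "\<lambda>i. y ^ (D ^ i)"] by (simp add: p_def poly_sum poly_monom)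
  qed
  then have p0: "p = 0" by (simp add: poly_all_0_iff_0[symmetric])
  show ?thesis
  proof
    fix \<gamma> assume g: "\<gamma> \<in> G"
    have "coeff p (code \<gamma>) = (\<Sum>\<delta>\<in>G. if \<delta> = \<gamma> then c \<delta> else 0)"
      unfolding p_def coeff_sum using inj g by (intro sum.cong) (auto simp: inj_on_def)
    then show "c \<gamma> = 0" using p0 g fin by simp
  qed
qed

section \<open>Tangent vectors of Segre-Veronese varieties\<close>

text \<open>A point \<open>P\<close> stands for the point \<open>x = (P 1, P 2, \<dots>)\<close>, \<open>y = (1, P 0)\<close> of the product;
  \<open>vpd n a b k\<close> is the partial derivative of \<open>vpt n a b\<close> with respect to the coordinate \<open>P k\<close>.\<close>

definition xmono :: "nat \<Rightarrow> (nat \<Rightarrow> nat) \<Rightarrow> (nat \<Rightarrow> complex) \<Rightarrow> complex" where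
  "xmono n \<alpha> P = (\<Prod>i\<le>n. P (Suc i) ^ \<alpha> i)"

definition vpt :: "nat \<Rightarrow> nat \<Rightarrow> nat \<Rightarrow> (nat \<Rightarrow> complex) \<Rightarrow> (nat \<Rightarrow> nat) \<times> nat \<Rightarrow> complex" where
  "vpt n a b P = (\<lambda>(\<alpha>, j). if \<alpha> \<in> exponents n a \<and> j \<le> b then xmono n \<alpha> P * P 0 ^ j else 0)"

definition vpd :: "nat \<Rightarrow> nat \<Rightarrow> nat \<Rightarrow> nat \<Rightarrow> (nat \<Rightarrow> complex) \<Rightarrow> (nat \<Rightarrow> nat) \<times> nat \<Rightarrow> complex" where
  "vpd n a b k P = (\<lambda>(\<alpha>, j). if \<alpha> \<in> exponents n a \<and> j \<le> b then
     (case k of 0 \<Rightarrow> xmono n \<alpha> P * (of_nat j * P 0 ^ (j - 1))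
      | Suc i \<Rightarrow> of_nat (\<alpha> i) * xmono n (\<alpha>(i := \<alpha> i - 1)) P * P 0 ^ j) else 0)"

text \<open>\<open>None\<close> is the point itself, kept as a direction of its own because at some
  points the degeneration retains this vector only.\<close>

definition tvec :: "nat \<Rightarrow> nat \<Rightarrow> nat \<Rightarrow> nat option \<Rightarrow> (nat \<Rightarrow> complex) \<Rightarrow> (nat \<Rightarrow> nat) \<times> nat \<Rightarrow> complex" where
  "tvec n a b d P = (case d of None \<Rightarrow> vpt n a b P | Some k \<Rightarrow> vpd n a b k P)"

definition dirs :: "nat \<Rightarrow> nat option set" where
  "dirs n = insert None (Some ` {..Suc n})"

definition tan_vecs :: "nat \<Rightarrow> nat \<Rightarrow> nat \<Rightarrow> (nat \<Rightarrow> complex) \<Rightarrow> ((nat \<Rightarrow> nat) \<times> nat \<Rightarrow> complex) set" where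
  "tan_vecs n a b P = (\<lambda>d. tvec n a b d P) ` dirs n"

lemma finite_dirs [simp]: "finite (dirs n)"
  by (simp add: dirs_def)

lemma tvec_simps [simp]: "tvec n a b None P = vpt n a b P" "tvec n a b (Some k) P = vpd n a b k P"
  by (simp_all add: tvec_def)

lemma polyfn_xmono: "(\<lambda>P. xmono n \<alpha> P) \<in> polyfn"
  unfolding xmono_def by (intro polyfn_intros)

lemma polyfn_tvec: "(\<lambda>P. tvec n a b d P x) \<in> polyfn"
proof -
  obtain \<alpha> j where x: "x = (\<alpha>, j)" by force
  show ?thesis
  proof (cases "\<alpha> \<in> exponents n a \<and> j \<le> b")
    case True
    show ?thesis
    proof (cases d)
      case None
      with True show ?thesis by (simp add: x vpt_def) (intro polyfn_intros polyfn_xmono)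
    next
      case (Some k)
      with True show ?thesis
        by (cases k; simp add: x vpd_def) (intro polyfn_intros polyfn_xmono)+
    qed
  next
    case False
    then have "tvec n a b d P x = 0" for P
      by (cases d) (auto simp: x vpt_def vpd_def)
    then show ?thesis by (simp add: polyfn_const)
  qed
qed

lemma xmono_Suc: "xmono (Suc m) \<alpha> P = xmono m \<alpha> P * P (Suc (Suc m)) ^ \<alpha> (Suc m)"
  by (simp add: xmono_def)

lemma xmono_remove:
  "i \<le> n \<Longrightarrow> xmono n \<alpha> P = P (Suc i) ^ \<alpha> i * (\<Prod>l\<in>{..n}-{i}. P (Suc l) ^ \<alpha> l)"
  unfolding xmono_def using prod.remove[of "{..n}" i "\<lambda>i. P (Suc i) ^ \<alpha> i"] by simp

lemma xmono_upd:
  "i \<le> n \<Longrightarrow> xmono n (\<alpha>(i := e)) P = P (Suc i) ^ e * (\<Prod>l\<in>{..n}-{i}. P (Suc l) ^ \<alpha> l)"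
  by (subst xmono_remove[of i]) (auto intro!: arg_cong2[of _ _ _ _ "(*)"] prod.cong)

lemma xmono_cong: "(\<And>i. i \<le> n \<Longrightarrow> P (Suc i) = Q (Suc i)) \<Longrightarrow> xmono n \<alpha> P = xmono n \<alpha> Q"
  unfolding xmono_def by (intro prod.cong) auto

lemma tvec_cong:
  assumes "\<And>k. k \<le> Suc n \<Longrightarrow> P k = Q k"
  shows "tvec n a b d P = tvec n a b d Q"
proof -
  have "xmono n \<alpha> P = xmono n \<alpha> Q" for \<alpha>
    by (rule xmono_cong) (use assms in auto)
  then show ?thesis
    using assms[of 0] by (cases d) (auto simp: vpt_def vpd_def fun_eq_iff split: nat.split)
qed

lemma finite_exponents [simp]: "finite (exponents n a)"
proof (rule finite_subset)
  show "exponents n a \<subseteq> {\<alpha>. \<forall>i. (i \<in> {..n} \<longrightarrow> \<alpha> i \<in> {..a}) \<and> (i \<notin> {..n} \<longrightarrow> \<alpha> i = 0)}"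
  proof
    fix \<alpha> assume *: "\<alpha> \<in> exponents n a"
    have "\<alpha> i \<le> a" if "i \<le> n" for i
      using * member_le_sum[of i "{..n}" \<alpha>] that by (auto simp: exponents_def)
    with * show "\<alpha> \<in> {\<alpha>. \<forall>i. (i \<in> {..n} \<longrightarrow> \<alpha> i \<in> {..a}) \<and> (i \<notin> {..n} \<longrightarrow> \<alpha> i = 0)}"
      by (auto simp: exponents_def)
  qed
qed (rule finite_set_of_finite_funs; simp)

lemma exponents_last_zero:
  "\<alpha> \<in> exponents m a \<longleftrightarrow> \<alpha> (Suc m) = 0 \<and> \<alpha> \<in> exponents (Suc m) a"
proof -
  have "(\<forall>i>m. \<alpha> i = 0) \<longleftrightarrow> \<alpha> (Suc m) = 0 \<and> (\<forall>i>Suc m. \<alpha> i = 0)"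
    by (metis Suc_lessD Suc_lessI lessI)
  then show ?thesis by (auto simp: exponents_def)
qed

lemma exponents_shift:
  assumes "\<alpha> (Suc m) > 0"
  shows "\<alpha>(Suc m := \<alpha> (Suc m) - 1) \<in> exponents (Suc m) c \<longleftrightarrow> \<alpha> \<in> exponents (Suc m) (Suc c)"
proof -
  have "(\<Sum>i\<le>m. (\<alpha>(Suc m := e)) i) = (\<Sum>i\<le>m. \<alpha> i)" for e
    by (intro sum.cong) auto
  then show ?thesis
    using assms by (auto simp: exponents_def)
qed

lemma exponents_Suc_Suc:
  "exponents (Suc m) (Suc c) =
    exponents m (Suc c) \<union> (\<lambda>\<alpha>. \<alpha>(Suc m := Suc (\<alpha> (Suc m)))) ` exponents (Suc m) c" (is "?L = ?R1 \<union> ?R2")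
proof (intro equalityI subsetI)
  fix \<alpha> assume *: "\<alpha> \<in> ?L"
  show "\<alpha> \<in> ?R1 \<union> ?R2"
  proof (cases "\<alpha> (Suc m) = 0")
    case True
    with * show ?thesis by (simp add: exponents_last_zero[of _ m])
  next
    case False
    then have "\<alpha>(Suc m := \<alpha> (Suc m) - 1) \<in> exponents (Suc m) c"
      using * exponents_shift[of \<alpha> m c] by simp
    moreover have "\<alpha> = (\<alpha>(Suc m := \<alpha> (Suc m) - 1))(Suc m := Suc ((\<alpha>(Suc m := \<alpha> (Suc m) - 1)) (Suc m)))"
      using False by auto
    ultimately show ?thesis by blast
  qed
next
  fix \<alpha> assume *: "\<alpha> \<in> ?R1 \<union> ?R2"
  then show "\<alpha> \<in> ?L"
  proof
    assume "\<alpha> \<in> ?R2"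
    then obtain \<beta> where \<beta>: "\<beta> \<in> exponents (Suc m) c" "\<alpha> = \<beta>(Suc m := Suc (\<beta> (Suc m)))" by blast
    have "\<alpha>(Suc m := \<alpha> (Suc m) - 1) = \<beta>" using \<beta>(2) by auto
    then show ?thesis using exponents_shift[of \<alpha> m c] \<beta> by simp
  qed (simp add: exponents_last_zero[of _ m])
qed

lemma exponents_degree_0: "exponents n 0 = {\<lambda>_. 0}"
  by (auto simp: exponents_def fun_eq_iff) (metis atMost_iff not_le_imp_less)

lemma exponents_0: "exponents 0 a = {(\<lambda>_. 0)(0 := a)}"
  by (auto simp: exponents_def fun_eq_iff)

lemma card_exponents: "card (exponents n a) = (n + a) choose a"
proof (induction n arbitrary: a)
  case 0
  show ?case by (simp add: exponents_0)
next
  case (Suc m)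
  note outer = Suc.IH
  show ?case
  proof (induction a)
    case 0
    show ?case by (simp add: exponents_degree_0)
  next
    case (Suc c)
    have inj: "inj_on (\<lambda>\<alpha>. \<alpha>(Suc m := Suc (\<alpha> (Suc m)))) (exponents (Suc m) c)"
    proof (rule inj_onI)
      fix \<alpha> \<beta> :: "nat \<Rightarrow> nat"
      assume *: "\<alpha>(Suc m := Suc (\<alpha> (Suc m))) = \<beta>(Suc m := Suc (\<beta> (Suc m)))"
      show "\<alpha> = \<beta>"
      proof
        fix i
        show "\<alpha> i = \<beta> i" using fun_cong[OF *, of i] by (cases "i = Suc m") auto
      qed
    qed
    have "exponents m (Suc c) \<inter> (\<lambda>\<alpha>. \<alpha>(Suc m := Suc (\<alpha> (Suc m)))) ` exponents (Suc m) c = {}"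
      by (auto simp: exponents_last_zero[of _ m])
    then show ?case
      unfolding exponents_Suc_Suc using outer[of "Suc c"] Suc.IH
      by (simp add: card_Un_disjoint card_image[OF inj])
  qed
qed

text \<open>Splitting off the last variable: monomials not involving \<open>x (Suc m)\<close>, and the multiples of
  \<open>x (Suc m)\<close>, which \<open>shift_up\<close> identifies with the monomials of degree one less.\<close>

definition shift_up :: "nat \<Rightarrow> ((nat \<Rightarrow> nat) \<times> nat \<Rightarrow> complex) \<Rightarrow> (nat \<Rightarrow> nat) \<times> nat \<Rightarrow> complex" where
  "shift_up m w = (\<lambda>(\<alpha>, j). if \<alpha> (Suc m) > 0 then w (\<alpha>(Suc m := \<alpha> (Suc m) - 1), j) else 0)"

definition shift_down :: "nat \<Rightarrow> ((nat \<Rightarrow> nat) \<times> nat \<Rightarrow> complex) \<Rightarrow> (nat \<Rightarrow> nat) \<times> nat \<Rightarrow> complex" where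
  "shift_down m w = (\<lambda>(\<alpha>, j). w (\<alpha>(Suc m := Suc (\<alpha> (Suc m))), j))"

lemma flinear_shift_down: "flinear (shift_down m)"
  by (rule flinearI) (auto simp: shift_down_def)

lemma shift_down_up [simp]: "shift_down m (shift_up m w) = w"
  by (auto simp: shift_down_def shift_up_def fun_eq_iff)

lemma shift_down_tvec [simp]: "shift_down m (tvec m a b d P) = 0"
  by (cases d) (auto simp: shift_down_def vpt_def vpd_def fun_eq_iff exponents_last_zero[of _ m])

text \<open>Monomials free of the last variable form the trace on the divisor; the others are the
  last variable times a monomial of lower degree. The directions in \<open>dirs m\<close> do not
  touch the last variable and respect this decomposition.\<close>

lemma tvec_split:
  assumes "d \<in> dirs m"
  shows "tvec (Suc m) (Suc c) b d P =
    tvec m (Suc c) b d P + fscale (P (Suc (Suc m))) (shift_up m (tvec (Suc m) c b d P))"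
proof
  fix x :: "(nat \<Rightarrow> nat) \<times> nat"
  obtain \<alpha> j where x: "x = (\<alpha>, j)" by force
  show "tvec (Suc m) (Suc c) b d P x =
    (tvec m (Suc c) b d P + fscale (P (Suc (Suc m))) (shift_up m (tvec (Suc m) c b d P))) x"
  proof (cases "\<alpha> (Suc m)")
    case 0
    show ?thesis
      using 0 assms by (cases d) (auto simp: x dirs_def vpt_def vpd_def shift_up_def xmono_Suc
          exponents_last_zero[of _ m] split: nat.split)
  next
    case (Suc e)
    have *: "\<alpha>(Suc m := e) \<in> exponents (Suc m) c \<longleftrightarrow> \<alpha> \<in> exponents (Suc m) (Suc c)"
      using exponents_shift[of \<alpha> m c] Suc by simp
    have **: "\<alpha> \<notin> exponents m (Suc c)" using Suc by (simp add: exponents_last_zero[of _ m])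
    have ***: "xmono m (\<beta>(Suc m := e)) P = xmono m \<beta> P" for \<beta>
      unfolding xmono_def by (intro prod.cong) auto
    have 4: "xmono m (\<alpha>(Suc m := e, i := f)) P = xmono m (\<alpha>(i := f)) P" if "i \<le> m" for i f
      using that ***[of "\<alpha>(i := f)"] by (simp add: fun_upd_twist)
    show ?thesis
      using Suc assms * ** *** 4 by (cases d) (auto simp: x dirs_def vpt_def vpd_def shift_up_def xmono_Suc
          algebra_simps split: nat.split)
  qed
qed

text \<open>The trace part does not depend on the last variable and disappears; the rest is the
  product rule for the last variable times a monomial.\<close>

lemma vpd_last:
  "vpd (Suc m) (Suc c) b (Suc (Suc m)) P =
    shift_up m (vpt (Suc m) c b P + fscale (P (Suc (Suc m))) (vpd (Suc m) c b (Suc (Suc m)) P))"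
proof
  fix x :: "(nat \<Rightarrow> nat) \<times> nat"
  obtain \<alpha> j where x: "x = (\<alpha>, j)" by force
  show "vpd (Suc m) (Suc c) b (Suc (Suc m)) P x =
    shift_up m (vpt (Suc m) c b P + fscale (P (Suc (Suc m))) (vpd (Suc m) c b (Suc (Suc m)) P)) x"
  proof (cases "\<alpha> (Suc m)")
    case 0
    then show ?thesis by (auto simp: x vpd_def shift_up_def)
  next
    case (Suc e)
    have *: "\<alpha>(Suc m := e) \<in> exponents (Suc m) c \<longleftrightarrow> \<alpha> \<in> exponents (Suc m) (Suc c)"
      using exponents_shift[of \<alpha> m c] Suc by simp
    have ***: "xmono m (\<alpha>(Suc m := e)) P = xmono m \<alpha> P" for e
      unfolding xmono_def by (intro prod.cong) auto
    have "of_nat e * P (Suc (Suc m)) ^ e = of_nat e * (P (Suc (Suc m)) * P (Suc (Suc m)) ^ (e - 1))"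
      by (cases e) auto
    then show ?thesis
      using Suc * *** by (auto simp: x vpd_def vpt_def shift_up_def xmono_Suc algebra_simps)
  qed
qed

lemma vpt_deriv:
  "((\<lambda>\<tau>. vpt n a b (\<lambda>k. A k + \<tau> * D k) x) has_field_derivative
     (\<Sum>k\<le>Suc n. D k * vpd n a b k (\<lambda>k. A k + \<tau> * D k) x)) (at \<tau>)"
proof -
  obtain \<alpha> j where x: "x = (\<alpha>, j)" by force
  let ?P = "\<lambda>\<tau> k. A k + \<tau> * D k"
  have lin: "((\<lambda>\<tau>. ?P \<tau> k) has_field_derivative D k) (at \<tau>)" for k
    by (auto intro!: derivative_eq_intros)
  have pow: "((\<lambda>\<tau>. ?P \<tau> k ^ e) has_field_derivative of_nat e * ?P \<tau> k ^ (e - 1) * D k) (at \<tau>)" for k e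
    using DERIV_power[OF lin[of k], of e] by (simp add: mult_ac)
  have xm: "((\<lambda>\<tau>. xmono n \<alpha> (?P \<tau>)) has_field_derivative
      (\<Sum>i\<le>n. D (Suc i) * (of_nat (\<alpha> i) * xmono n (\<alpha>(i := \<alpha> i - 1)) (?P \<tau>)))) (at \<tau>)"
    unfolding xmono_def[of n \<alpha>]
    by (rule DERIV_cong[OF has_field_derivative_prod[OF pow]])
      (auto intro!: sum.cong simp: xmono_upd mult_ac)
  show ?thesis
  proof (cases "\<alpha> \<in> exponents n a \<and> j \<le> b")
    case True
    have "((\<lambda>\<tau>. xmono n \<alpha> (?P \<tau>) * ?P \<tau> 0 ^ j) has_field_derivative
       (\<Sum>k\<le>Suc n. D k * vpd n a b k (?P \<tau>) x)) (at \<tau>)"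
      by (rule DERIV_cong[OF DERIV_mult[OF xm pow]])
        (simp add: True x vpd_def sum.atMost_Suc_shift sum_distrib_left sum_distrib_right
          algebra_simps del: sum.atMost_Suc)
    then show ?thesis using True by (simp add: x vpt_def)
  next
    case False
    then show ?thesis by (auto simp: x vpt_def vpd_def)
  qed
qed

definition pt :: "(nat \<times> nat \<Rightarrow> complex) \<Rightarrow> nat \<Rightarrow> nat \<Rightarrow> complex" where
  "pt q j = (\<lambda>k. q (j, k))"

lemma pt_case_prod [simp]: "pt (\<lambda>(j, k). f j k) = f"
  by (simp add: pt_def fun_eq_iff)

text \<open>By Terracini's lemma this says that the \<open>s\<close>-th secant variety has dimension at least \<open>r - 1\<close>.\<close>

definition sec_rank :: "nat \<Rightarrow> nat \<Rightarrow> nat \<Rightarrow> nat \<Rightarrow> nat \<Rightarrow> bool" where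
  "sec_rank n a b s r \<longleftrightarrow> (\<exists>q. rank_ge (\<Union>j<s. tan_vecs n a b (q j)) r)"

lemma sec_rank_le: "sec_rank n a b s r \<Longrightarrow> r' \<le> r \<Longrightarrow> sec_rank n a b s r'"
  unfolding sec_rank_def using rank_ge_le by blast

lemma sec_rank_more_points:
  assumes "sec_rank n a b s r" "s \<le> s'"
  shows "sec_rank n a b s' r"
proof -
  obtain q where "rank_ge (\<Union>j<s. tan_vecs n a b (q j)) r"
    using assms(1) by (auto simp: sec_rank_def)
  then have "rank_ge (\<Union>j<s'. tan_vecs n a b (q j)) r"
    by (rule rank_ge_subset) (intro UN_mono, use assms(2) in auto)
  then show ?thesis by (auto simp: sec_rank_def)
qed

text \<open>\<open>K\<close> selects the directions kept at each point, since traces and residuals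
  retain only part of some tangent spaces.\<close>

definition tan_family :: "nat \<Rightarrow> nat \<Rightarrow> nat \<Rightarrow> (nat \<times> nat option) set \<Rightarrow> (nat \<Rightarrow> nat \<Rightarrow> complex)
    \<Rightarrow> ((nat \<Rightarrow> nat) \<times> nat \<Rightarrow> complex) set" where
  "tan_family n a b K q = (\<lambda>(j, d). tvec n a b d (q j)) ` K"

lemma tan_family_Union: "(\<Union>j\<in>J. tan_vecs n a b (q j)) = tan_family n a b (J \<times> dirs n) q"
  by (auto simp: tan_family_def tan_vecs_def)

lemma tan_family_generic:
  assumes "finite K" "\<And>j k. (\<lambda>q. h q j k) \<in> polyfn" "rank_ge (tan_family n a b K (h q0)) r"
  shows "generic (\<lambda>q. rank_ge (tan_family n a b K (h q)) r)"
proof -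
  have "generic (\<lambda>q. rank_ge ((\<lambda>\<kappa>. case \<kappa> of (j, d) \<Rightarrow> tvec n a b d (h q j)) ` K) r)"
  proof (rule rank_generic[of K _ q0])
    show "(\<lambda>q. (case \<kappa> of (j, d) \<Rightarrow> tvec n a b d (h q j)) x) \<in> polyfn" for \<kappa> x
      by (cases \<kappa>) (auto intro: polyfn_comp[OF polyfn_tvec] assms(2))
  qed (use assms in \<open>auto simp: tan_family_def\<close>)
  then show ?thesis by (simp add: tan_family_def)
qed

lemma sec_rank_generic:
  assumes "sec_rank n a b s r"
  shows "generic (\<lambda>q. rank_ge (\<Union>j<s. tan_vecs n a b (pt q j)) r)"
proof -
  obtain q0 where "rank_ge (\<Union>j<s. tan_vecs n a b (q0 j)) r"
    using assms by (auto simp: sec_rank_def)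
  then have "rank_ge (tan_family n a b ({..<s} \<times> dirs n) (pt (\<lambda>(j, k). q0 j k))) r"
    by (simp add: tan_family_Union)
  then have "generic (\<lambda>q. rank_ge (tan_family n a b ({..<s} \<times> dirs n) (pt q)) r)"
    by (rule tan_family_generic[rotated 2]) (auto simp: pt_def intro: polyfn_intros)
  then show ?thesis by (simp add: tan_family_Union)
qed

text \<open>A linear relation that holds on all points is a polynomial that vanishes identically, so
  its coefficients are 0.\<close>

lemma rank_all_points:
  "rank_ge (range (vpt n a b)) (card (exponents n a) * Suc b)"
proof -
  let ?I = "exponents n a \<times> {..b}"
  have "rank_ge (range (vpt n a b)) (card ?I)"
  proof (rule rank_ge_annihilator)
    fix c assume c: "\<And>w. w \<in> range (vpt n a b) \<Longrightarrow> (\<Sum>i\<in>?I. c i * w i) = 0"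
    \<comment> \<open>The exponent of \<open>P 0\<close> and those of the
      \<open>x\<close>-coordinates are merged into one exponent vector in \<open>n + 2\<close>
      variables.\<close>
    define code :: "(nat \<Rightarrow> nat) \<times> nat \<Rightarrow> nat \<Rightarrow> nat" where "code = (\<lambda>(\<alpha>, j) k. case k of 0 \<Rightarrow> j | Suc i \<Rightarrow> \<alpha> i)"
    define dec :: "(nat \<Rightarrow> nat) \<Rightarrow> (nat \<Rightarrow> nat) \<times> nat" where "dec \<gamma> = ((\<lambda>i. \<gamma> (Suc i)), \<gamma> 0)" for \<gamma>
    have dec: "dec (code x) = x" for x by (cases x) (simp add: dec_def code_def)
    then have inj: "inj_on code ?I" by (metis inj_onI)
    have "\<forall>\<gamma>\<in>code ` ?I. c (dec \<gamma>) = 0"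
    proof (rule monomials_independent[where k = "Suc (Suc n)"])
      fix X :: "nat \<Rightarrow> complex"
      have "(\<Sum>\<gamma>\<in>code ` ?I. c (dec \<gamma>) * (\<Prod>i<Suc (Suc n). X i ^ \<gamma> i)) = (\<Sum>x\<in>?I. c x * vpt n a b X x)"
        unfolding sum.reindex[OF inj]
      proof (rule sum.cong)
        fix x assume x: "x \<in> ?I"
        obtain \<alpha> j where xx: "x = (\<alpha>, j)" by force
        have "(\<Prod>i<Suc (Suc n). X i ^ code x i) = X 0 ^ j * (\<Prod>i<Suc n. X (Suc i) ^ \<alpha> i)"
          by (subst prod.lessThan_Suc_shift) (simp add: xx code_def)
        then show "((\<lambda>\<gamma>. c (dec \<gamma>) * (\<Prod>i<Suc (Suc n). X i ^ \<gamma> i)) \<circ> code) x = c x * vpt n a b X x"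
          using x by (simp add: dec xx vpt_def xmono_def lessThan_Suc_atMost mult.commute del: prod.lessThan_Suc)
      qed simp
      then show "(\<Sum>\<gamma>\<in>code ` ?I. c (dec \<gamma>) * (\<Prod>i<Suc (Suc n). X i ^ \<gamma> i)) = 0"
        using c by (simp del: prod.lessThan_Suc)
    next
      fix \<gamma> i assume "\<gamma> \<in> code ` ?I" "Suc (Suc n) \<le> i"
      then show "\<gamma> i = 0"
        by (cases i) (auto simp: code_def exponents_def)
    qed simp
    then show "\<forall>x\<in>?I. c x = 0" by (simp add: dec)
  qed simp
  then show ?thesis by (simp add: card_cartesian_product)
qed


text \<open>The substitution \<open>x (Suc m) \<mapsto> x (Suc m) + c * x i\<close> acts linearly on the vectors of
  monomials.\<close>

definition shear :: "nat \<Rightarrow> nat \<Rightarrow> complex \<Rightarrow> (nat \<Rightarrow> complex) \<Rightarrow> nat \<Rightarrow> complex" where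
  "shear m i c P = P(Suc (Suc m) := P (Suc (Suc m)) + c * P (Suc i))"

text \<open>The sum is the binomial expansion of a power of the substituted last variable: its term
  \<open>k\<close> moves \<open>k\<close> factors from the last variable to
  \<open>x i\<close>.\<close>

definition shear_op :: "nat \<Rightarrow> nat \<Rightarrow> nat \<Rightarrow> complex \<Rightarrow> ((nat \<Rightarrow> nat) \<times> nat \<Rightarrow> complex)
    \<Rightarrow> (nat \<Rightarrow> nat) \<times> nat \<Rightarrow> complex" where
  "shear_op m a i c w = (\<lambda>(\<alpha>, j). if \<alpha> \<in> exponents (Suc m) a then
     \<Sum>k\<le>\<alpha> (Suc m). of_nat (\<alpha> (Suc m) choose k) * c ^ k *
       w (\<alpha>(i := \<alpha> i + k, Suc m := \<alpha> (Suc m) - k), j) else 0)"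

lemma flinear_shear_op: "flinear (shear_op m a i c)"
  by (rule flinearI) (auto simp: shear_op_def distrib_left sum.distrib sum_distrib_left mult_ac)

lemma shear_op_vpt:
  assumes "i \<le> m"
  shows "shear_op m a i c (vpt (Suc m) a b P) = vpt (Suc m) a b (shear m i c P)"
proof
  fix x :: "(nat \<Rightarrow> nat) \<times> nat"
  obtain \<alpha> j where x: "x = (\<alpha>, j)" by force
  show "shear_op m a i c (vpt (Suc m) a b P) x = vpt (Suc m) a b (shear m i c P) x"
  proof (cases "\<alpha> \<in> exponents (Suc m) a \<and> j \<le> b")
    case False
    then show ?thesis
      using assms by (auto simp: x shear_op_def vpt_def)
  next
    case True
    let ?z = "P (Suc (Suc m))"
    define R where "R = (\<Prod>l\<in>{..m}-{i}. P (Suc l) ^ \<alpha> l)"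
    have mem: "\<alpha>(i := \<alpha> i + k, Suc m := \<alpha> (Suc m) - k) \<in> exponents (Suc m) a" if "k \<le> \<alpha> (Suc m)" for k
    proof -
      have "(\<Sum>l\<le>m. (\<alpha>(i := \<alpha> i + k, Suc m := \<alpha> (Suc m) - k)) l) = (\<Sum>l\<le>m. \<alpha> l + (if l = i then k else 0))"
        by (intro sum.cong) auto
      also have "\<dots> = (\<Sum>l\<le>m. \<alpha> l) + k"
        using assms by (simp add: sum.distrib)
      finally show ?thesis using True that assms by (auto simp: exponents_def)
    qed
    have ev: "xmono (Suc m) (\<alpha>(i := \<alpha> i + k, Suc m := \<alpha> (Suc m) - k)) P
        = P (Suc i) ^ (\<alpha> i + k) * R * ?z ^ (\<alpha> (Suc m) - k)" for k
    proof -
      have "xmono m (\<alpha>(i := \<alpha> i + k, Suc m := \<alpha> (Suc m) - k)) P = xmono m (\<alpha>(i := \<alpha> i + k)) P"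
        unfolding xmono_def by (intro prod.cong) auto
      then show ?thesis
        using assms by (simp add: xmono_Suc xmono_upd R_def)
    qed
    have "shear_op m a i c (vpt (Suc m) a b P) x = (\<Sum>k\<le>\<alpha> (Suc m). of_nat (\<alpha> (Suc m) choose k) * c ^ k *
        (P (Suc i) ^ (\<alpha> i + k) * R * ?z ^ (\<alpha> (Suc m) - k) * P 0 ^ j))"
      using True mem by (auto simp: x shear_op_def vpt_def ev)
    also have "\<dots> = P (Suc i) ^ \<alpha> i * R * P 0 ^ j *
        (\<Sum>k\<le>\<alpha> (Suc m). of_nat (\<alpha> (Suc m) choose k) * (c * P (Suc i)) ^ k * ?z ^ (\<alpha> (Suc m) - k))"
      by (simp add: sum_distrib_left power_add power_mult_distrib mult_ac)
    also have "\<dots> = P (Suc i) ^ \<alpha> i * R * P 0 ^ j * (?z + c * P (Suc i)) ^ \<alpha> (Suc m)"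
      by (simp add: binomial_ring[symmetric] add.commute)
    also have "P (Suc i) ^ \<alpha> i * R = xmono m \<alpha> (shear m i c P)"
      using assms unfolding R_def xmono_remove[OF assms]
      by (auto simp: shear_def intro!: arg_cong2[of _ _ _ _ "(*)"] prod.cong)
    finally show ?thesis
      using True by (simp add: x vpt_def xmono_Suc) (simp add: shear_def)
  qed
qed

text \<open>Obtained by differentiating the identity for points along a line instead of comparing
  coefficients. The direction of \<open>x i\<close> is sheared too and acquires a component along
  the last variable.\<close>

lemma shear_op_vpd:
  assumes "i \<le> m"
  shows "shear_op m a i c (vpd (Suc m) a b k P) =
    vpd (Suc m) a b k (shear m i c P) +
      (if k = Suc i then fscale c (vpd (Suc m) a b (Suc (Suc m)) (shear m i c P)) else 0)"
proof (cases "k \<le> Suc (Suc m)")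
  case k: True
  show ?thesis
  proof
    fix x :: "(nat \<Rightarrow> nat) \<times> nat"
    obtain \<alpha> j where x: "x = (\<alpha>, j)" by force
    define D :: "nat \<Rightarrow> complex" where "D = (\<lambda>l. if l = k then 1 else 0)"
    define E where "E = shear m i c D"
    let ?L = "shear_op m a i c"
    let ?P = "\<lambda>\<tau> l. P l + \<tau> * D l"
    have line: "shear m i c (?P \<tau>) = (\<lambda>l. shear m i c P l + \<tau> * E l)" for \<tau>
      by (auto simp: shear_def E_def fun_eq_iff algebra_simps)
    have d: "((\<lambda>\<tau>. vpt (Suc m) a b (?P \<tau>) y) has_field_derivative vpd (Suc m) a b k P y) (at 0)" for y
      using vpt_deriv[of "Suc m" a b P D y 0] k by (simp add: D_def if_distrib if_distribR sum.delta cong: if_cong del: sum.atMost_Suc)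
    have 1: "((\<lambda>\<tau>. ?L (vpt (Suc m) a b (?P \<tau>)) x) has_field_derivative ?L (vpd (Suc m) a b k P) x) (at 0)"
    proof (cases "\<alpha> \<in> exponents (Suc m) a")
      case True
      then show ?thesis
        by (simp add: x shear_op_def) (intro DERIV_sum DERIV_cmult d)
    qed (simp add: x shear_op_def)
    have 2: "((\<lambda>\<tau>. vpt (Suc m) a b (shear m i c (?P \<tau>)) x) has_field_derivative
        (\<Sum>l\<le>Suc (Suc m). E l * vpd (Suc m) a b l (shear m i c P) x)) (at 0)"
      unfolding line using vpt_deriv[of "Suc m" a b "shear m i c P" E x 0] by simp
    have "?L (vpd (Suc m) a b k P) x = (\<Sum>l\<le>Suc (Suc m). E l * vpd (Suc m) a b l (shear m i c P) x)"
      using DERIV_unique[OF 1[unfolded shear_op_vpt[OF assms]] 2] .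
    also have "\<dots> = (\<Sum>l\<le>Suc (Suc m). (if l = k then vpd (Suc m) a b l (shear m i c P) x else 0)
        + (if l = Suc (Suc m) then (if k = Suc i then c * vpd (Suc m) a b l (shear m i c P) x else 0) else 0))"
      using assms by (intro sum.cong) (auto simp: E_def D_def shear_def)
    also have "\<dots> = vpd (Suc m) a b k (shear m i c P) x
        + (if k = Suc i then c * vpd (Suc m) a b (Suc (Suc m)) (shear m i c P) x else 0)"
      using k by (simp add: sum.distrib del: sum.atMost_Suc)
    finally show "?L (vpd (Suc m) a b k P) x = (vpd (Suc m) a b k (shear m i c P) +
      (if k = Suc i then fscale c (vpd (Suc m) a b (Suc (Suc m)) (shear m i c P)) else 0)) x"
      by simp
  qed
next
  case False
  have "vpd (Suc m) a b k Q = 0" for Q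
  proof -
    obtain l where "k = Suc l" "Suc m < l" using False by (cases k) auto
    then show ?thesis by (auto simp: vpd_def exponents_def fun_eq_iff)
  qed
  then show ?thesis
    using False assms fs.linear_0[OF flinear_shear_op[of m a i c]] by auto
qed

lemma shear_inverse: "i \<le> m \<Longrightarrow> shear m i (- c) (shear m i c P) = P"
  by (auto simp: shear_def fun_eq_iff)

text \<open>The operator of the inverse shear maps the tangent vectors at the sheared points to
  vectors whose span contains those at the original points, and a linear map does not raise the
  rank.\<close>

lemma rank_shear1:
  fixes s :: nat
  assumes "i \<le> m" "rank_ge (\<Union>j<s. tan_vecs (Suc m) a b (q j)) r"
  shows "rank_ge (\<Union>j<s. tan_vecs (Suc m) a b (shear m i c (q j))) r"
proof -
  let ?L = "shear_op m a i (- c)"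
  let ?S = "\<Union>j<s. tan_vecs (Suc m) a b (shear m i c (q j))"
  have "tvec (Suc m) a b d (q j) \<in> fs.span (?L ` ?S)" if d: "d \<in> dirs (Suc m)" and j: "j < s" for d j
  proof -
    let ?Q = "shear m i c (q j)"
    have base: "?L (tvec (Suc m) a b e ?Q) \<in> fs.span (?L ` ?S)" if "e \<in> dirs (Suc m)" for e
      using j that by (intro fs.span_base imageI) (auto simp: tan_vecs_def)
    show ?thesis
    proof (cases d)
      case None
      then show ?thesis
        using base[OF d] by (simp add: shear_op_vpt assms(1) shear_inverse)
    next
      case (Some k)
      have Z: "vpd (Suc m) a b (Suc (Suc m)) (q j) \<in> fs.span (?L ` ?S)"
        using base[of "Some (Suc (Suc m))"] assms(1)
        by (simp add: dirs_def shear_op_vpd shear_inverse)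
      have "?L (vpd (Suc m) a b k ?Q) + (if k = Suc i then fscale c (vpd (Suc m) a b (Suc (Suc m)) (q j)) else 0)
          = vpd (Suc m) a b k (q j)"
        by (auto simp: shear_op_vpd assms(1) shear_inverse fun_eq_iff)
      moreover have "?L (vpd (Suc m) a b k ?Q) +
          (if k = Suc i then fscale c (vpd (Suc m) a b (Suc (Suc m)) (q j)) else 0) \<in> fs.span (?L ` ?S)"
        using base[OF d] Z Some by (intro fs.span_add) (auto intro: fs.span_scale fs.span_zero)
      ultimately show ?thesis using Some by simp
    qed
  qed
  then have "(\<Union>j<s. tan_vecs (Suc m) a b (q j)) \<subseteq> fs.span (?L ` ?S)"
    by (auto simp: tan_vecs_def)
  then have "rank_ge (?L ` ?S) r"
    using rank_ge_mono[OF assms(2)] by blast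
  then show ?thesis
    by (rule rank_ge_linear_image[OF flinear_shear_op])
qed

text \<open>Shears change the last coordinate only and so accumulate: any linear form in the other
  \<open>x\<close>-coordinates can be added to it. A suitable form moves given points to the
  divisor.\<close>

lemma rank_shear:
  fixes s :: nat
  assumes "rank_ge (\<Union>j<s. tan_vecs (Suc m) a b (q j)) r" "l \<le> Suc m"
  shows "rank_ge (\<Union>j<s. tan_vecs (Suc m) a b
    ((q j)(Suc (Suc m) := q j (Suc (Suc m)) + (\<Sum>i<l. c i * q j (Suc i))))) r"
  using assms(2)
proof (induction l)
  case 0
  then show ?case using assms(1) by simp
next
  case (Suc l)
  let ?q = "\<lambda>j. (q j)(Suc (Suc m) := q j (Suc (Suc m)) + (\<Sum>i<l. c i * q j (Suc i)))"
  have "shear m l (c l) (?q j) =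
      (q j)(Suc (Suc m) := q j (Suc (Suc m)) + (\<Sum>i<Suc l. c i * q j (Suc i)))" for j
    using Suc.prems by (auto simp: shear_def fun_eq_iff)
  moreover have "l \<le> m" "l \<le> Suc m" using Suc.prems by auto
  ultimately show ?case
    using rank_shear1[OF _ Suc.IH, of l "c l"] by (simp only:)
qed

section \<open>Degeneration to a hyperplane\<close>

lemma polyfn_isCont:
  assumes "F \<in> polyfn" "\<And>k. isCont (\<lambda>e. h e k) z"
  shows "isCont (\<lambda>e. F (h e)) z"
  using assms(1) by induction (auto intro: continuous_intros assms(2))

lemma isCont_tvec:
  assumes "isCont f z"
  shows "isCont (\<lambda>e. tvec n a b d (P(k := f e)) x) z"
proof (rule polyfn_isCont[OF polyfn_tvec])
  show "isCont (\<lambda>e. (P(k := f e)) l) z" for l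
    using assms by (cases "l = k") auto
qed

lemma isCont_shift_up:
  assumes "\<And>y. isCont (\<lambda>e. G e y) z"
  shows "isCont (\<lambda>e. shift_up m (G e) x) z"
proof -
  obtain \<alpha> j where x: "x = (\<alpha>, j)" by force
  show ?thesis
    using assms by (cases "\<alpha> (Suc m) > 0") (auto simp: x shift_up_def)
qed

lemma shift_up_add: "shift_up m (v + w) = shift_up m v + shift_up m w"
  and shift_up_scale: "shift_up m (fscale c w) = fscale c (shift_up m w)"
  by (auto simp: shift_up_def fun_eq_iff)

text \<open>The points with index below \<open>v\<close> stay fixed. As \<open>e \<rightarrow> 0\<close>, the last coordinate of the next
  \<open>d\<close> points is \<open>e ^ 2\<close> and that of the last \<open>u\<close> points is \<open>e ^ 4\<close>, while the coefficients of the
  monomials divisible by the last variable are scaled by \<open>1 / e ^ 3\<close>. This is Horace's method for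
  the last \<open>u\<close> points, and its differential version for the \<open>d\<close> points before them.\<close>

definition trace_index :: "nat \<Rightarrow> nat \<Rightarrow> nat \<Rightarrow> nat \<Rightarrow> (nat \<times> nat option) set" where
  "trace_index m v d u = {v..<v + d} \<times> {None} \<union> {v + d..<v + d + u} \<times> dirs m"

definition residual_index :: "nat \<Rightarrow> nat \<Rightarrow> nat \<Rightarrow> nat \<Rightarrow> (nat \<times> nat option) set" where
  "residual_index m v d u =
     {..<v} \<times> dirs (Suc m) \<union> {v..<v + d} \<times> dirs m \<union> {v + d..<v + d + u} \<times> {None}"

definition to_hyperplane :: "nat \<Rightarrow> nat \<Rightarrow> nat \<Rightarrow> (nat \<Rightarrow> complex) \<Rightarrow> nat \<Rightarrow> complex" where
  "to_hyperplane m v j P = (if j < v then P else P(Suc (Suc m) := 0))"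

definition rescale :: "nat \<Rightarrow> complex \<Rightarrow> ((nat \<Rightarrow> nat) \<times> nat \<Rightarrow> complex) \<Rightarrow> (nat \<Rightarrow> nat) \<times> nat \<Rightarrow> complex" where
  "rescale m c w = (\<lambda>x. (if fst x (Suc m) = 0 then 1 else c) * w x)"

lemma flinear_rescale: "flinear (rescale m c)"
  by (rule flinearI) (auto simp: rescale_def algebra_simps)

lemma rescale_add: "rescale m c (v + w) = rescale m c v + rescale m c w"
  and rescale_scale: "rescale m c (fscale k w) = fscale k (rescale m c w)"
  and rescale_shift_up: "rescale m c (shift_up m w) = fscale c (shift_up m w)"
  by (auto simp: rescale_def shift_up_def fun_eq_iff algebra_simps)

lemma rescale_tvec: "rescale m c (tvec m a b d P) = tvec m a b d P"
  by (cases d) (auto simp: rescale_def vpt_def vpd_def fun_eq_iff exponents_last_zero[of _ m])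

text \<open>After rescaling, a last coordinate \<open>f\<close> multiplies the residual part by
  \<open>f / e ^ 3\<close>. For \<open>f = e ^ 4\<close> this tends to 0 and the trace survives; for
  \<open>f = e ^ 2\<close> it blows up and the residual survives after multiplication by
  \<open>e\<close>. The combinations \<open>W1\<close> and \<open>W2\<close> of tangent vectors
  converge to the prescribed trace and residual vectors.\<close>

lemma degeneration:
  assumes nz: "\<And>j. j < v \<Longrightarrow> q j (Suc (Suc m)) \<noteq> 0"
    and r1: "rank_ge (tan_family m (Suc c) b (trace_index m v d u) q) r1"
    and r2: "rank_ge (tan_family (Suc m) c b (residual_index m v d u) (\<lambda>j. to_hyperplane m v j (q j))) r2"
  shows "sec_rank (Suc m) (Suc c) b (v + d + u) (r1 + r2)"
proof -
  let ?Z = "Suc (Suc m)"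
  let ?s = "v + d + u"
  let ?K1 = "trace_index m v d u" and ?K2 = "residual_index m v d u"
  define f where "f e j = (if j < v then q j ?Z else if j < v + d then e ^ 2 else e ^ 4)" for e :: complex and j
  define Q where "Q e j = (q j)(?Z := f e j)" for e j
  define X where "X e = rescale m (1 / e ^ 3) ` (\<Union>j<?s. tan_vecs (Suc m) (Suc c) b (Q e j))" for e
  \<comment> \<open>With last coordinate \<open>e ^ 2\<close>, the point and its normal derivative
    have dominant residual parts along the same vector. Subtracting \<open>e ^ 2\<close> times the
    derivative cancels it and leaves the trace of the point in the limit.\<close>
  define W1 where "W1 = (\<lambda>(j, k) e. if j < v + d
      then tvec m (Suc c) b None (q j) + fscale (- e) (shift_up m (tvec (Suc m) c b (Some ?Z) (Q e j)))
      else tvec m (Suc c) b k (q j) + fscale e (shift_up m (tvec (Suc m) c b k (Q e j))))"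
  \<comment> \<open>Points off the divisor contribute their whole tangent space to the residual.
    There the normal derivative contains a multiple of the point, by the product rule, which is
    subtracted.\<close>
  define W2 where "W2 = (\<lambda>(j, k) e. if j < v then
        if k = Some ?Z
        then shift_up m (tvec (Suc m) c b k (Q e j)) + fscale (- (e ^ 3 / q j ?Z ^ 2)) (tvec m (Suc c) b None (q j))
        else shift_up m (tvec (Suc m) c b k (Q e j)) + fscale (e ^ 3 / q j ?Z) (tvec m (Suc c) b k (q j))
      else if k = None
        then shift_up m (tvec (Suc m) c b None (Q e j)) + fscale (f e j) (shift_up m (tvec (Suc m) c b (Some ?Z) (Q e j)))
        else shift_up m (tvec (Suc m) c b k (Q e j)) + fscale e (tvec m (Suc c) b k (q j)))"
  define W where "W = case_sum W1 W2"
  have fin: "finite (?K1 <+> ?K2)"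
    by (simp add: trace_index_def residual_index_def)
  have cf: "isCont (\<lambda>e. f e j) 0" for j
    unfolding f_def by (cases "j < v"; cases "j < v + d") (auto intro!: continuous_intros)
  have ct: "isCont (\<lambda>e. tvec n a b k (Q e j) x) 0" for n a k j x
    unfolding Q_def by (rule isCont_tvec[OF cf])
  have cs: "isCont (\<lambda>e. shift_up m (tvec n a b k (Q e j)) x) 0" for n a k j x
    by (rule isCont_shift_up[OF ct])
  have c1: "isCont (\<lambda>e. W1 x e y) 0" for x y
    by (cases x; cases "fst x < v + d")
      (auto simp: W1_def simp del: tvec_simps intro!: continuous_intros cs)
  have c2: "isCont (\<lambda>e. W2 x e y) 0" for x y
    by (cases x; cases "fst x < v"; cases "snd x = Some ?Z"; cases "snd x = None")
      (auto simp: W2_def divide_inverse simp del: tvec_simps intro!: continuous_intros cs cf)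
  have cW: "isCont (\<lambda>e. W k e y) 0" for k y
    by (cases k) (auto simp: W_def c1 c2)
  have Q0: "Q 0 j = to_hyperplane m v j (q j)" for j
    by (auto simp: Q_def f_def to_hyperplane_def)
  have W10: "W1 (j, k) 0 = tvec m (Suc c) b k (q j)" if "(j, k) \<in> ?K1" for j k
    using that by (auto simp: W1_def trace_index_def fun_eq_iff)
  have W20: "W2 (j, k) 0 = shift_up m (tvec (Suc m) c b k (to_hyperplane m v j (q j)))" for j k
    by (auto simp: W2_def fun_eq_iff Q0 f_def)
  have lim: "(\<lambda>k. W k 0) ` (?K1 <+> ?K2) = tan_family m (Suc c) b ?K1 q \<union>
      shift_up m ` tan_family (Suc m) c b ?K2 (\<lambda>j. to_hyperplane m v j (q j))"
  proof -
    have "(\<lambda>k. W k 0) ` (?K1 <+> ?K2) = (\<lambda>k. W1 k 0) ` ?K1 \<union> (\<lambda>k. W2 k 0) ` ?K2"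
      unfolding Plus_def by (auto simp: W_def image_Un image_image)
    moreover have "(\<lambda>k. W1 k 0) ` ?K1 = tan_family m (Suc c) b ?K1 q"
      unfolding tan_family_def by (rule image_cong) (auto simp: W10 simp del: tvec_simps)
    moreover have "(\<lambda>k. W2 k 0) ` ?K2 = shift_up m ` tan_family (Suc m) c b ?K2 (\<lambda>j. to_hyperplane m v j (q j))"
      unfolding tan_family_def image_image by (rule image_cong) (auto simp: W20 simp del: tvec_simps)
    ultimately show ?thesis by simp
  qed
  \<comment> \<open>\<open>shift_down\<close> kills the trace vectors and undoes
    \<open>shift_up\<close>, so the two ranks add.\<close>
  have rank_lim: "rank_ge ((\<lambda>k. W k 0) ` (?K1 <+> ?K2)) (r1 + r2)"
    unfolding lim
  proof (rule rank_ge_split[OF flinear_shift_down[of m] _ r1])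
    show "shift_down m x = 0" if "x \<in> tan_family m (Suc c) b ?K1 q" for x
      using that by (auto simp: tan_family_def simp del: tvec_simps)
    show "rank_ge (shift_down m ` shift_up m ` tan_family (Suc m) c b ?K2 (\<lambda>j. to_hyperplane m v j (q j))) r2"
      using r2 by (simp add: image_image)
  qed
  have span: "W k e \<in> fs.span (X e)" if k: "k \<in> ?K1 <+> ?K2" and e: "e \<noteq> 0" for k e
  proof -
    define T where "T k j = rescale m (1 / e ^ 3) (tvec (Suc m) (Suc c) b k (Q e j))" for k j
    have TX: "T k j \<in> fs.span (X e)" if "j < ?s" "k \<in> dirs (Suc m)" for k j
      using that by (intro fs.span_base) (auto simp: T_def X_def tan_vecs_def simp del: tvec_simps)
    have Qq: "tvec m (Suc c) b k (Q e j) = tvec m (Suc c) b k (q j)" for k j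
      by (rule tvec_cong) (auto simp: Q_def)
    have Tk: "T k j = tvec m (Suc c) b k (q j) + fscale (f e j / e ^ 3) (shift_up m (tvec (Suc m) c b k (Q e j)))"
      if "k \<in> dirs m" for k j
      unfolding T_def tvec_split[OF that] rescale_add rescale_scale rescale_shift_up rescale_tvec Qq
      by (simp add: fun_eq_iff Q_def del: tvec_simps)
    have TZ: "T (Some ?Z) j = fscale (1 / e ^ 3) (shift_up m (tvec (Suc m) c b None (Q e j))
        + fscale (f e j) (shift_up m (tvec (Suc m) c b (Some ?Z) (Q e j))))" for j
      unfolding T_def tvec_simps vpd_last rescale_shift_up
      by (simp add: Q_def shift_up_add shift_up_scale)
    have N: "None \<in> dirs n" "Some ?Z \<in> dirs (Suc m)" "k \<in> dirs m \<Longrightarrow> k \<in> dirs (Suc m)" for n k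
      by (auto simp: dirs_def)
    have mem: "fscale x (T k j) + fscale y (T l j) \<in> fs.span (X e)"
      if "j < ?s" "k \<in> dirs (Suc m)" "l \<in> dirs (Suc m)" for x y k l j
      by (intro fs.span_add fs.span_scale TX that)
    consider (1) j k' where "k = Inl (j, k')" "(j, k') \<in> ?K1" | (2) j k' where "k = Inr (j, k')" "(j, k') \<in> ?K2"
      using k by (auto elim!: PlusE)
    then show ?thesis
    proof cases
      case (1 j k')
      then consider (a) "v \<le> j" "j < v + d" "k' = None" | (b) "v + d \<le> j" "j < ?s" "k' \<in> dirs m"
        by (auto simp: trace_index_def)
      then show ?thesis
      proof cases
        case a
        have "W k e = fscale 1 (T None j) + fscale (- (e ^ 2)) (T (Some ?Z) j)"
          unfolding Tk[OF N(1)] TZ using a e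
          by (simp add: 1 W_def W1_def f_def fun_eq_iff field_simps power2_eq_square power3_eq_cube)
        moreover have "j < ?s" using a by simp
        ultimately show ?thesis using mem[OF _ N(1,2)] by (simp only:)
      next
        case b
        have "W k e = fscale 1 (T k' j) + fscale 0 (T None j)"
          unfolding Tk[OF b(3)] using b e
          by (simp add: 1 W_def W1_def f_def fun_eq_iff field_simps eval_nat_numeral del: tvec_simps)
        moreover have "j < ?s" using b by simp
        ultimately show ?thesis using mem[OF _ N(3)[OF b(3)] N(1)] by (simp only:)
      qed
    next
      case (2 j k')
      then consider (a) "j < v" "k' = Some ?Z" | (b) "j < v" "k' \<noteq> Some ?Z" "k' \<in> dirs m"
        | (c) "v \<le> j" "j < ?s" "k' = None" | (d) "v \<le> j" "j < v + d" "k' \<noteq> None" "k' \<in> dirs m"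
        by (fastforce simp: residual_index_def dirs_def le_Suc_eq)
      then show ?thesis
      proof cases
        case a
        have "W k e = fscale (e ^ 3 / q j ?Z) (T (Some ?Z) j) + fscale (- (e ^ 3 / q j ?Z ^ 2)) (T None j)"
          unfolding Tk[OF N(1)] TZ using a e nz[of j]
          by (simp add: 2 W_def W2_def f_def fun_eq_iff field_simps power2_eq_square)
        moreover have "j < ?s" using a by simp
        ultimately show ?thesis using mem[OF _ N(2,1)] by (simp only:)
      next
        case b
        have "W k e = fscale (e ^ 3 / q j ?Z) (T k' j) + fscale 0 (T None j)"
          unfolding Tk[OF b(3)] using b e nz[of j]
          by (simp add: 2 W_def W2_def f_def fun_eq_iff field_simps del: tvec_simps)
        moreover have "j < ?s" using b by simp
        ultimately show ?thesis using mem[OF _ N(3)[OF b(3)] N(1)] by (simp only:)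
      next
        case c
        have "W k e = fscale (e ^ 3) (T (Some ?Z) j) + fscale 0 (T None j)"
          unfolding TZ using c e
          by (simp add: 2 W_def W2_def fun_eq_iff field_simps)
        moreover have "j < ?s" using c by simp
        ultimately show ?thesis using mem[OF _ N(2,1)] by (simp only:)
      next
        case d
        obtain l where l: "k' = Some l" using d(3) by blast
        have "W k e = fscale e (T k' j) + fscale 0 (T None j)"
          unfolding Tk[OF d(4)] using d(1,2) e
          by (simp add: l 2 W_def W2_def f_def fun_eq_iff field_simps power2_eq_square power3_eq_cube del: tvec_simps)
        moreover have "j < ?s" using d by simp
        ultimately show ?thesis using mem[OF _ N(3)[OF d(4)] N(1)] by (simp only:)
      qed
    qed
  qed
  obtain e where e: "rank_ge (X e) (r1 + r2)"
    using rank_limit[where w = W and X = X, OF fin cW rank_lim span] by blast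
  have "rank_ge (\<Union>j<?s. tan_vecs (Suc m) (Suc c) b (Q e j)) (r1 + r2)"
    using rank_ge_linear_image[OF flinear_rescale e[unfolded X_def]] .
  then show ?thesis unfolding sec_rank_def by blast
qed

section \<open>Ranks of trace and residual\<close>

lemma trace_rank:
  assumes "sec_rank m a b u r"
  shows "\<exists>q. rank_ge (tan_family m a b (trace_index m v d u) q)
    (min (card (exponents m a) * Suc b) (r + d))"
proof -
  obtain q0 where q0: "rank_ge (\<Union>j<u. tan_vecs m a b (q0 j)) r"
    using assms by (auto simp: sec_rank_def)
  let ?S = "\<Union>j<u. tan_vecs m a b (q0 j)"
  have "rank_ge (?S \<union> range (vpt m a b)) (card (exponents m a) * Suc b)"
    by (rule rank_ge_subset[OF rank_all_points]) auto
  from rank_ge_extend[OF q0 this, of d] obtain w where w: "\<forall>j<d. w j \<in> range (vpt m a b)"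
    "rank_ge (?S \<union> w ` {..<d}) (min (card (exponents m a) * Suc b) (r + d))"
    by auto
  have "\<forall>j\<in>{..<d}. \<exists>P. w j = vpt m a b P" using w(1) by auto
  from bchoice[OF this] obtain P where P: "\<And>j. j < d \<Longrightarrow> w j = vpt m a b (P j)" by auto
  define q where "q j = (if j < v + d then P (j - v) else q0 (j - (v + d)))" for j
  have "?S \<union> w ` {..<d} \<subseteq> tan_family m a b (trace_index m v d u) q"
  proof
    fix x assume "x \<in> ?S \<union> w ` {..<d}"
    then consider (1) j k where "j < u" "k \<in> dirs m" "x = tvec m a b k (q0 j)" | (2) j where "j < d" "x = w j"
      by (auto simp: tan_vecs_def)
    then show "x \<in> tan_family m a b (trace_index m v d u) q"
    proof cases
      case 1
      then show ?thesis unfolding tan_family_def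
        by (intro image_eqI[of _ _ "(v + d + j, k)"]) (auto simp: trace_index_def q_def)
    next
      case 2
      then show ?thesis unfolding tan_family_def
        by (intro image_eqI[of _ _ "(v + j, None)"]) (auto simp: trace_index_def q_def P)
    qed
  qed
  then show ?thesis using rank_ge_subset[OF w(2)] by blast
qed

text \<open>At most \<open>m + 1\<close> general points have linearly independent coordinate vectors
  \<open>x 0, ..., x m\<close>, so a linear form in these takes prescribed values at all of them.
  The shear by this form puts them on the divisor.\<close>

lemma points_to_hyperplane:
  assumes r: "sec_rank (Suc m) a b (v + d) r" and d: "d \<le> Suc m"
  shows "\<exists>q. (\<forall>j\<in>{v..<v + d}. q j (Suc (Suc m)) = 0) \<and> rank_ge (\<Union>j<v + d. tan_vecs (Suc m) a b (q j)) r"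
proof -
  let ?Z = "Suc (Suc m)" and ?J = "{v..<v + d}"
  define y where "y j q i = (if i \<le> m then q (j, Suc i) else 0)" for j i :: nat and q :: "nat \<times> nat \<Rightarrow> complex"
  \<comment> \<open>Test configuration: the point \<open>j\<close> of \<open>?J\<close> sits at the
    unit vector number \<open>j - v\<close>, which is available because
    \<open>d \<le> Suc m\<close>.\<close>
  define q0 :: "nat \<times> nat \<Rightarrow> complex" where "q0 = (\<lambda>(j, k). if k = Suc (j - v) then 1 else 0)"
  have "indep_family ?J (\<lambda>j. y j q0)"
    unfolding indep_family_def
  proof (intro allI impI ballI)
    fix c j assume *: "(\<Sum>j\<in>?J. fscale (c j) (y j q0)) = 0" and j: "j \<in> ?J"
    have "(\<Sum>k\<in>?J. c k * y k q0 (j - v)) = 0"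
      using fun_cong[OF *, of "j - v"] by (simp add: sum_fun_apply)
    also have "(\<Sum>k\<in>?J. c k * y k q0 (j - v)) = (\<Sum>k\<in>?J. if k = j then c k else 0)"
      using j d by (intro sum.cong) (auto simp: y_def q0_def)
    finally show "c j = 0" using j by simp
  qed
  then have "generic (\<lambda>q. indep_family ?J (\<lambda>j. y j q))"
  proof (rule indep_family_generic[where w = y, rotated 2])
    show "(\<lambda>q. y j q i) \<in> polyfn" for j i
      by (cases "i \<le> m") (auto simp: y_def intro: polyfn_intros)
  qed simp
  from generic_ex[OF generic_conj[OF this sec_rank_generic[OF r]]]
  obtain q where q: "indep_family ?J (\<lambda>j. y j q)" "rank_ge (\<Union>j<v + d. tan_vecs (Suc m) a b (pt q j)) r"
    by blast
  let ?B = "(\<lambda>j. y j q) ` ?J"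
  have B: "fs.independent ?B" and inj: "inj_on (\<lambda>j. y j q) ?J"
    using q(1) by (auto simp: indep_family_iff)
  \<comment> \<open>\<open>g\<close> takes minus the last coordinate as its value at each point of
    \<open>?J\<close>; its values at the unit vectors are the coefficients of the shear.\<close>
  obtain g :: "(nat \<Rightarrow> complex) \<Rightarrow> unit \<Rightarrow> complex" where g: "flinear g"
    "\<And>x. x \<in> ?B \<Longrightarrow> g x = (\<lambda>_. - q (the_inv_into ?J (\<lambda>j. y j q) x, ?Z))"
    using fs.linear_independent_extend[OF B, of "\<lambda>x _. - q (the_inv_into ?J (\<lambda>j. y j q) x, ?Z)"] by metis
  define c where "c i = g (unit_vec i) ()" for i
  have yj: "y j q = (\<Sum>i<Suc m. fscale (q (j, Suc i)) (unit_vec i))" for j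
    by (auto simp: fun_eq_iff sum_fun_apply y_def unit_vec_def if_distrib cong: if_cong simp del: sum.lessThan_Suc)
  have c: "(\<Sum>i<Suc m. c i * pt q j (Suc i)) = - pt q j ?Z" if "j \<in> ?J" for j
  proof -
    have "g (y j q) () = - q (j, ?Z)"
      using g(2)[of "y j q"] that the_inv_into_f_f[OF inj that] by simp
    then show ?thesis
      unfolding yj flinear_family[OF g(1)] sum_fun_apply by (simp add: c_def pt_def mult.commute)
  qed
  show ?thesis
    by (rule exI, rule conjI, rule_tac [2] rank_shear[OF q(2) order_refl, of c]) (use c in simp)
qed

text \<open>Dropping the normal derivative at \<open>d\<close> points costs at most
  \<open>d\<close>. The \<open>u\<close> points on the divisor then add one each, up to the rank
  reached with all points of the divisor. A second restriction bounds that rank from below: its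
  trace is everything, and its residual contains the tangent spaces at the \<open>v\<close> outer
  points in degree \<open>c\<close>.\<close>

lemma residual_rank:
  assumes r1: "sec_rank (Suc m) (Suc c) b (v + d) r1" and r2: "sec_rank (Suc m) c b v r2"
    and d: "d \<le> Suc m"
  shows "\<exists>q. rank_ge (tan_family (Suc m) (Suc c) b (residual_index m v d u) (\<lambda>j. to_hyperplane m v j (q j)))
    (min (card (exponents m (Suc c)) * Suc b + r2) (r1 - d + u))"
proof -
  let ?Z = "Suc (Suc m)"
  let ?n = "Suc m" and ?a = "Suc c"
  let ?h = "\<lambda>q j. to_hyperplane m v j (pt q j)"
  obtain q1 where q1: "\<And>j. j \<in> {v..<v + d} \<Longrightarrow> q1 j ?Z = 0"
    "rank_ge (\<Union>j<v + d. tan_vecs ?n ?a b (q1 j)) r1"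
    using points_to_hyperplane[OF r1 d] by blast
  have h_poly: "(\<lambda>q. ?h q j k) \<in> polyfn" for j k
    by (cases "j < v"; cases "k = ?Z") (auto simp: to_hyperplane_def pt_def intro: polyfn_intros)
  have "tan_family ?n ?a b ({..<v + d} \<times> dirs ?n) (?h (\<lambda>(j, k). q1 j k)) =
      (\<Union>j<v + d. tan_vecs ?n ?a b (q1 j))"
    unfolding tan_family_Union[symmetric]
    by (intro SUP_cong) (auto simp: to_hyperplane_def q1(1) fun_upd_idem)
  then have "rank_ge (tan_family ?n ?a b ({..<v + d} \<times> dirs ?n) (?h (\<lambda>(j, k). q1 j k))) r1"
    using q1(2) by simp
  then have g1: "generic (\<lambda>q. rank_ge (tan_family ?n ?a b ({..<v + d} \<times> dirs ?n) (?h q)) r1)"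
    by (rule tan_family_generic[where h = ?h and ?q0.0 = "\<lambda>(j, k). q1 j k", rotated 2])
      (auto intro: h_poly)
  have g2: "generic (\<lambda>q. \<forall>j\<in>{..<v}. pt q j ?Z \<noteq> 0)"
    by (intro generic_ball generic_nonzero[where q = "\<lambda>_. 1"]) (auto simp: pt_def intro: polyfn_intros)
  note g3 = sec_rank_generic[OF r2]
  have "\<exists>q. rank_ge (tan_family ?n ?a b ({..<v + d} \<times> dirs ?n) (?h q)) r1 \<and>
      (\<forall>j\<in>{..<v}. pt q j ?Z \<noteq> 0) \<and> rank_ge (\<Union>j<v. tan_vecs ?n c b (pt q j)) r2"
    by (rule generic_ex) (rule generic_conj[OF g1 generic_conj[OF g2 g3]])
  then obtain q where q: "rank_ge (tan_family ?n ?a b ({..<v + d} \<times> dirs ?n) (?h q)) r1"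
    "\<forall>j\<in>{..<v}. pt q j ?Z \<noteq> 0" "rank_ge (\<Union>j<v. tan_vecs ?n c b (pt q j)) r2"
    by (elim exE conjE)
  define W where "W = tan_family ?n ?a b ({..<v} \<times> dirs ?n \<union> {v..<v + d} \<times> dirs m) (?h q)"
  define E where "E = tan_family ?n ?a b ({v..<v + d} \<times> {Some ?Z}) (?h q)"
  let ?D = "(\<lambda>P. vpt ?n ?a b (P(?Z := 0))) ` UNIV"
  have "dirs ?n = dirs m \<union> {Some ?Z}"
    by (auto simp: dirs_def atMost_Suc)
  then have "tan_family ?n ?a b ({..<v + d} \<times> dirs ?n) (?h q) \<subseteq> W \<union> E"
    unfolding W_def E_def tan_family_def image_Un[symmetric] by (intro image_mono) auto
  then have "rank_ge (W \<union> E) r1" by (rule rank_ge_subset[OF q(1)])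
  moreover have "finite W" "finite E" by (auto simp: W_def E_def tan_family_def)
  ultimately have rW: "rank_ge W (r1 - card E)"
    by (intro rank_ge_Un_diff)
  have "card E \<le> card ({v..<v + d} \<times> {Some ?Z})"
    unfolding E_def tan_family_def by (rule card_image_le) simp
  then have rW: "rank_ge W (r1 - d)"
    using rank_ge_le[OF rW] by simp
  have D: "?D = range (vpt m ?a b)"
  proof -
    have "vpt ?n ?a b (P(?Z := 0)) = vpt m ?a b P" for P
      using tvec_split[of None m c b "P(?Z := 0)"] tvec_cong[of m "P(?Z := 0)" P ?a b None]
      by (simp add: dirs_def fun_eq_iff)
    then show ?thesis by simp
  qed
  have "rank_ge (?D \<union> W) (card (exponents m ?a) * Suc b + r2)"
  proof (rule rank_ge_split[OF flinear_shift_down[of m]])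
    show "shift_down m x = 0" if "x \<in> ?D" for x
      using that shift_down_tvec[of m ?a b None] unfolding D by auto
    show "rank_ge ?D (card (exponents m ?a) * Suc b)"
      unfolding D by (rule rank_all_points)
    \<comment> \<open>In a direction of \<open>dirs m\<close> the residual of a tangent vector is
      the last coordinate times the tangent vector of degree \<open>c\<close>. At the
      \<open>v\<close> points this coordinate is nonzero and can be divided out; the normal
      derivative follows by the product rule.\<close>
    show "rank_ge (shift_down m ` W) r2"
    proof (rule rank_ge_mono[OF q(3)], rule subsetI)
      fix x assume "x \<in> (\<Union>j<v. tan_vecs ?n c b (pt q j))"
      then obtain j k where jk: "j < v" "k \<in> dirs ?n" "x = tvec ?n c b k (pt q j)"
        by (auto simp: tan_vecs_def)
      let ?z = "pt q j ?Z"
      have base: "shift_down m (tvec ?n ?a b l (pt q j)) \<in> fs.span (shift_down m ` W)" if "l \<in> dirs ?n" for l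
        using that jk(1) unfolding W_def tan_family_def
        by (intro fs.span_base imageI image_eqI[of _ _ "(j, l)"]) (auto simp: to_hyperplane_def)
      have low: "tvec ?n c b l (pt q j) \<in> fs.span (shift_down m ` W)" if l: "l \<in> dirs m" for l
      proof -
        have "l \<in> dirs ?n" using l by (auto simp: dirs_def)
        from base[OF this] have "fscale ?z (tvec ?n c b l (pt q j)) \<in> fs.span (shift_down m ` W)"
          unfolding tvec_split[OF l] using fs.linear_add[OF flinear_shift_down] fs.linear_scale[OF flinear_shift_down]
          by (simp del: tvec_simps)
        from fs.span_scale[OF this, of "1 / ?z"] show ?thesis
          using q(2) jk(1) by (simp add: fscale_def)
      qed
      show "x \<in> fs.span (shift_down m ` W)"
      proof (cases "k = Some ?Z")
        case True
        have "shift_down m (tvec ?n ?a b k (pt q j)) = vpt ?n c b (pt q j) + fscale ?z (tvec ?n c b k (pt q j))"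
          by (simp add: True vpd_last)
        then have "vpt ?n c b (pt q j) + fscale ?z (tvec ?n c b k (pt q j)) \<in> fs.span (shift_down m ` W)"
          using base[OF jk(2)] by simp
        moreover have "vpt ?n c b (pt q j) \<in> fs.span (shift_down m ` W)"
          using low[of None] by (simp add: dirs_def)
        ultimately have "fscale ?z (tvec ?n c b k (pt q j)) \<in> fs.span (shift_down m ` W)"
          using fs.span_diff by fastforce
        from fs.span_scale[OF this, of "1 / ?z"] show ?thesis
          using q(2) jk(1) by (simp add: fscale_def jk(3))
      next
        case False
        then have "k \<in> dirs m" using jk(2) by (auto simp: dirs_def le_Suc_eq)
        then show ?thesis unfolding jk(3) by (rule low)
      qed
    qed
  qed
  then have "rank_ge (W \<union> ?D) (card (exponents m ?a) * Suc b + r2)"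
    by (simp add: Un_commute)
  from rank_ge_extend[OF rW this, of u] obtain w where w: "\<forall>j<u. w j \<in> ?D"
    "rank_ge (W \<union> w ` {..<u}) (min (card (exponents m ?a) * Suc b + r2) (r1 - d + u))"
    by auto
  have "\<forall>j\<in>{..<u}. \<exists>P. w j = vpt ?n ?a b (P(?Z := 0))" using w(1) by auto
  from bchoice[OF this] obtain P where P: "\<And>j. j < u \<Longrightarrow> w j = vpt ?n ?a b ((P j)(?Z := 0))" by auto
  define q' where "q' j = (if j < v + d then pt q j else P (j - (v + d)))" for j
  have "W \<union> w ` {..<u} \<subseteq> tan_family ?n ?a b (residual_index m v d u) (\<lambda>j. to_hyperplane m v j (q' j))"
  proof
    fix x assume "x \<in> W \<union> w ` {..<u}"
    then consider (W) "x \<in> W" | (2) j where "j < u" "x = w j" by auto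
    then show "x \<in> tan_family ?n ?a b (residual_index m v d u) (\<lambda>j. to_hyperplane m v j (q' j))"
    proof cases
      case W
      then obtain \<kappa> where \<kappa>: "\<kappa> \<in> {..<v} \<times> dirs ?n \<union> {v..<v + d} \<times> dirs m"
        "x = (case \<kappa> of (j, k) \<Rightarrow> tvec ?n ?a b k (?h q j))"
        unfolding W_def tan_family_def by (elim imageE)
      obtain j k where "\<kappa> = (j, k)" by force
      with \<kappa> show ?thesis unfolding tan_family_def
        by (intro image_eqI[of _ _ "(j, k)"]) (auto simp: residual_index_def q'_def)
    next
      case 2
      then show ?thesis unfolding tan_family_def
        by (intro image_eqI[of _ _ "(v + d + j, None)"]) (auto simp: residual_index_def q'_def P to_hyperplane_def)
    qed
  qed
  then show ?thesis using rank_ge_subset[OF w(2)] by blast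
qed

text \<open>The conditions on trace and residual each hold for general points, hence for one common
  configuration with its first \<open>v\<close> points off the divisor. The \<open>d\<close> points
  add \<open>d\<close> to the trace and take \<open>d\<close> from the residual.\<close>

lemma horace:
  assumes "sec_rank m (Suc (Suc c)) b u r0" "sec_rank (Suc m) (Suc c) b (v + d) r1"
    "sec_rank (Suc m) c b v r2" "d \<le> Suc m"
  shows "sec_rank (Suc m) (Suc (Suc c)) b (v + d + u)
    (min (card (exponents m (Suc (Suc c))) * Suc b) (r0 + d) +
     min (card (exponents m (Suc c)) * Suc b + r2) (r1 - d + u))" (is "sec_rank _ _ _ _ (?R1 + ?R2)")
proof -
  let ?Z = "Suc (Suc m)"
  obtain q1 where q1: "rank_ge (tan_family m (Suc (Suc c)) b (trace_index m v d u) (pt (\<lambda>(j, k). q1 j k))) ?R1"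
    using trace_rank[OF assms(1), of v d] by auto
  obtain q2 where q2: "rank_ge (tan_family (Suc m) (Suc c) b (residual_index m v d u)
      (\<lambda>j. to_hyperplane m v j (pt (\<lambda>(j, k). q2 j k) j))) ?R2"
    using residual_rank[OF assms(2-4), of u] by auto
  have h_poly: "(\<lambda>q. to_hyperplane m v j (pt q j) k) \<in> polyfn" for j k
    by (cases "j < v"; cases "k = ?Z") (auto simp: to_hyperplane_def pt_def intro: polyfn_intros)
  have g1: "generic (\<lambda>q. rank_ge (tan_family m (Suc (Suc c)) b (trace_index m v d u) (pt q)) ?R1)"
    by (rule tan_family_generic[where h = pt and ?q0.0 = "\<lambda>(j, k). q1 j k", rotated 2])
      (use q1 in \<open>auto simp: trace_index_def pt_def intro: polyfn_intros\<close>)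
  have g2: "generic (\<lambda>q. rank_ge (tan_family (Suc m) (Suc c) b (residual_index m v d u)
      (\<lambda>j. to_hyperplane m v j (pt q j))) ?R2)"
    by (rule tan_family_generic[where h = "\<lambda>q j. to_hyperplane m v j (pt q j)"
          and ?q0.0 = "\<lambda>(j, k). q2 j k", rotated 2])
      (use q2 h_poly in \<open>auto simp: residual_index_def\<close>)
  have g3: "generic (\<lambda>q. \<forall>j\<in>{..<v}. pt q j ?Z \<noteq> 0)"
    by (intro generic_ball generic_nonzero[where q = "\<lambda>_. 1"]) (auto simp: pt_def intro: polyfn_intros)
  from generic_ex[OF generic_conj[OF g1 generic_conj[OF g2 g3]]] obtain q
    where "rank_ge (tan_family m (Suc (Suc c)) b (trace_index m v d u) (pt q)) ?R1"
      "rank_ge (tan_family (Suc m) (Suc c) b (residual_index m v d u) (\<lambda>j. to_hyperplane m v j (pt q j))) ?R2"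
      "\<forall>j\<in>{..<v}. pt q j ?Z \<noteq> 0"
    by (elim exE conjE)
  then show ?thesis by (intro degeneration) auto
qed

section \<open>Small degrees\<close>

abbreviation (input) sdim :: "nat \<Rightarrow> nat \<Rightarrow> nat \<Rightarrow> nat" where
  "sdim n a b \<equiv> card (exponents n a) * Suc b"

text \<open>The points of \<open>B\<close> are double zeros, so a nonzero polynomial of degree less
  than \<open>r\<close> would have too many zeros, counted with multiplicity.\<close>

lemma hermite_uniqueness:
  fixes c :: "nat \<Rightarrow> complex"
  assumes fin: "finite A" and BA: "B \<subseteq> A" and inj: "inj_on t A" and r: "r \<le> card A + card B"
    and z: "\<And>i. i \<in> A \<Longrightarrow> (\<Sum>j<r. c j * t i ^ j) = 0"
    and z': "\<And>i. i \<in> B \<Longrightarrow> (\<Sum>j<r. c j * (of_nat j * t i ^ (j - 1))) = 0"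
  shows "\<forall>j<r. c j = 0"
proof -
  define f where "f = (\<Sum>j<r. monom (c j) j)"
  have coeff: "coeff f j = c j" if "j < r" for j
    using that by (simp add: f_def coeff_sum)
  have f: "poly f x = (\<Sum>j<r. c j * x ^ j)" for x
    by (simp add: f_def poly_sum poly_monom)
  have f': "poly (pderiv f) x = (\<Sum>j<r. c j * (of_nat j * x ^ (j - 1)))" for x
    by (simp add: f_def higher_pderiv_sum[of 1, simplified] poly_sum pderiv_monom poly_monom mult_ac)
  have "f = 0"
  proof (rule ccontr)
    assume nz: "f \<noteq> 0"
    have "r \<noteq> 0"
    proof
      assume "r = 0"
      then show False using nz by (simp add: f_def)
    qed
    have deg: "degree f < r"
      unfolding f_def
      by (rule degree_sum_less) (use \<open>r \<noteq> 0\<close> in \<open>auto intro: le_less_trans[OF degree_monom_le]\<close>)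
    have 1: "order (t i) f \<ge> 1" if "i \<in> A" for i
      using z[OF that] nz order_root[of f "t i"] by (simp add: f)
    have 2: "order (t i) f \<ge> 2" if "i \<in> B" for i
    proof -
      have r1: "poly f (t i) = 0" using z that BA by (auto simp: f)
      have "poly (pderiv f) (t i) = 0" using z'[OF that] by (simp add: f')
      moreover have "pderiv f \<noteq> 0"
      proof
        assume "pderiv f = 0"
        then obtain h where "f = [:h:]" using pderiv_iszero by blast
        with r1 nz show False by simp
      qed
      ultimately have "order (t i) (pderiv f) \<noteq> 0"
        using order_root by blast
      then show ?thesis
        using order_pderiv[of f "t i"] nz r1 order_root[of f "t i"] by simp
    qed
    have finB: "finite B" using BA fin finite_subset by blast
    have "card A + card B = (\<Sum>i\<in>A. 1 + (if i \<in> B then 1 else 0))"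
      using fin BA by (simp add: sum_Suc sum.If_cases Int_absorb1)
    also have "\<dots> \<le> (\<Sum>i\<in>A. order (t i) f)"
      by (rule sum_mono) (use 1 2 in fastforce)
    also have "\<dots> = (\<Sum>x\<in>t ` A. order x f)"
      by (simp add: sum.reindex[OF inj])
    also have "\<dots> \<le> (\<Sum>x | poly f x = 0. order x f)"
      using z nz by (intro sum_mono2 poly_roots_finite) (auto simp: f)
    also have "\<dots> \<le> degree f" by (rule sum_order_le_degree[OF nz])
    finally show False using deg r by simp
  qed
  then show ?thesis using coeff by simp
qed

text \<open>The bound is attained by points with constant \<open>x\<close>, which lie on a rational normal curve of
  degree \<open>b\<close>.\<close>

lemma sec_rank_curve: "sec_rank n a b s (min (Suc b) (2 * s))"
proof -
  let ?r = "min (Suc b) (2 * s)"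
  define q where "q j = (\<lambda>k. case k of 0 \<Rightarrow> of_nat j | Suc i \<Rightarrow> if i = 0 then 1 else (0::complex))" for j :: nat
  let ?\<alpha> = "(\<lambda>_. 0)(0 := a) :: nat \<Rightarrow> nat"
  let ?S = "\<Union>j<s. tan_vecs n a b (q j)"
  have mem: "?\<alpha> \<in> exponents n a" by (auto simp: exponents_def)
  have x1: "xmono n ?\<alpha> (q j) = 1" for j
    unfolding xmono_def by (rule prod.neutral) (auto simp: q_def)
  have "rank_ge ?S (card ({?\<alpha>} \<times> {..<?r}))"
  proof (rule rank_ge_annihilator)
    fix c assume *: "\<And>w. w \<in> ?S \<Longrightarrow> (\<Sum>i\<in>{?\<alpha>} \<times> {..<?r}. c i * w i) = 0"
    have S: "tvec n a b d (q i) \<in> ?S" if "i < s" "d \<in> dirs n" for i d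
      using that by (auto simp: tan_vecs_def)
    have sum: "(\<Sum>i\<in>{?\<alpha>} \<times> {..<?r}. c i * w i) = (\<Sum>j<?r. c (?\<alpha>, j) * w (?\<alpha>, j))" for w
      by (simp add: sum.cartesian_product')
    have "\<forall>j<?r. c (?\<alpha>, j) = 0"
    proof (rule hermite_uniqueness[where A = "{..<s}" and B = "{..<s}" and t = of_nat])
      fix i assume i: "i \<in> {..<s}"
      show "(\<Sum>j<?r. c (?\<alpha>, j) * of_nat i ^ j) = 0"
        using *[OF S[of i None]] i mem x1 unfolding sum
        by (simp add: dirs_def vpt_def) (simp add: q_def)
      show "(\<Sum>j<?r. c (?\<alpha>, j) * (of_nat j * of_nat i ^ (j - 1))) = 0"
        using *[OF S[of i "Some 0"]] i mem x1 unfolding sum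
        by (simp add: dirs_def vpd_def) (simp add: q_def)
    qed (auto simp: inj_on_def)
    then show "\<forall>i\<in>{?\<alpha>} \<times> {..<?r}. c i = 0" by auto
  qed simp
  then show ?thesis unfolding sec_rank_def by (auto simp: card_cartesian_product)
qed

lemma unit_exponent: "l \<le> n \<Longrightarrow> (\<lambda>_. 0)(l := 1) \<in> exponents n 1"
  by (auto simp: exponents_def)

text \<open>At the coordinate point number \<open>h j\<close> of the first factor the tangent space
  splits into blocks: every block receives the evaluation at the parameter \<open>j\<close>, and the
  block \<open>h j\<close> also the derivative there. Each block is a Hermite interpolation
  problem.\<close>

lemma sec_rank_degree_1_count:
  fixes h :: "nat \<Rightarrow> nat"
  assumes h: "\<And>j. j < s \<Longrightarrow> h j \<le> n"
  shows "sec_rank n 1 b s (\<Sum>l\<le>n. min (Suc b) (s + card {j. j < s \<and> h j = l}))"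
proof -
  define r where "r l = min (Suc b) (s + card {j. j < s \<and> h j = l})" for l
  define q where "q j = (\<lambda>k. case k of 0 \<Rightarrow> of_nat j | Suc i \<Rightarrow> if i = h j then 1 else (0::complex))" for j :: nat
  define e :: "nat \<Rightarrow> nat \<Rightarrow> nat" where "e l = (\<lambda>_. 0)(l := 1)" for l
  let ?S = "\<Union>j<s. tan_vecs n 1 b (q j)"
  define J where "J = (SIGMA l:{..n}. {..<r l})"
  define I where "I = (\<lambda>(l, j). (e l, j)) ` J"
  have mem: "e l \<in> exponents n 1" if "l \<le> n" for l
    using unit_exponent[OF that] by (simp add: e_def)
  have e_inj: "e l = e l' \<longleftrightarrow> l = l'" for l l'
    by (auto simp: e_def fun_eq_iff split: if_splits)
  then have inj: "inj_on (\<lambda>(l, j). (e l, j :: nat)) J"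
    by (auto simp: inj_on_def)
  have finJ: "finite J" by (simp add: J_def)
  have xm: "xmono n (e l) (q j) = (if l = h j then 1 else 0)" if "l \<le> n" for l j
    using that by (simp add: e_def xmono_upd q_def)
  have xm0: "xmono n (\<lambda>_. 0) P = 1" for P by (simp add: xmono_def)
  have el: "e l' l = (if l' = l then 1 else 0)" for l l'
    by (simp add: e_def)
  have ed: "(e l)(l := 0) = (\<lambda>_. 0)" for l by (auto simp: e_def)
  have sum: "(\<Sum>i\<in>I. c i * w i) = (\<Sum>l\<le>n. \<Sum>j<r l. c (e l, j) * w (e l, j))" for c w :: "_ \<Rightarrow> complex"
    unfolding I_def by (subst sum.reindex[OF inj]) (simp add: J_def sum.Sigma case_prod_unfold)
  have "rank_ge ?S (card I)"
  proof (rule rank_ge_annihilator)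
    fix c assume *: "\<And>w. w \<in> ?S \<Longrightarrow> (\<Sum>i\<in>I. c i * w i) = 0"
    have S: "tvec n 1 b d (q i) \<in> ?S" if "i < s" "d \<in> dirs n" for i d
      using that by (auto simp: tan_vecs_def)
    have "\<forall>j<r l. c (e l, j) = 0" if l: "l \<le> n" for l
    proof (rule hermite_uniqueness[where A = "{..<s}" and B = "{j. j < s \<and> h j = l}" and t = of_nat])
      fix i assume i: "i \<in> {..<s}"
      have "0 = (\<Sum>l'\<le>n. \<Sum>j<r l'. c (e l', j) * vpd n 1 b (Suc l) (q i) (e l', j))"
        using *[OF S[of i "Some (Suc l)"]] i l unfolding sum by (simp add: dirs_def)
      also have "\<dots> = (\<Sum>l'\<le>n. if l' = l then (\<Sum>j<r l. c (e l, j) * of_nat i ^ j) else 0)"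
      proof (rule sum.cong)
        fix l' assume "l' \<in> {..n}"
        then show "(\<Sum>j<r l'. c (e l', j) * vpd n 1 b (Suc l) (q i) (e l', j)) =
          (if l' = l then (\<Sum>j<r l. c (e l, j) * of_nat i ^ j) else 0)"
          using mem[of l'] by (auto simp: vpd_def r_def ed el xm0 q_def intro!: sum.cong)
      qed simp
      finally show "(\<Sum>j<r l. c (e l, j) * of_nat i ^ j) = 0" using l by simp
    next
      fix i assume i: "i \<in> {j. j < s \<and> h j = l}"
      have "0 = (\<Sum>l'\<le>n. \<Sum>j<r l'. c (e l', j) * vpd n 1 b 0 (q i) (e l', j))"
        using *[OF S[of i "Some 0"]] i unfolding sum by (simp add: dirs_def)
      also have "\<dots> = (\<Sum>l'\<le>n. if l' = l then (\<Sum>j<r l. c (e l, j) * (of_nat j * of_nat i ^ (j - 1))) else 0)"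
      proof (rule sum.cong)
        fix l' assume "l' \<in> {..n}"
        then show "(\<Sum>j<r l'. c (e l', j) * vpd n 1 b 0 (q i) (e l', j)) =
          (if l' = l then (\<Sum>j<r l. c (e l, j) * (of_nat j * of_nat i ^ (j - 1))) else 0)"
          using mem[of l'] xm[of l' i] i by (auto simp: vpd_def r_def q_def intro!: sum.cong)
      qed simp
      finally show "(\<Sum>j<r l. c (e l, j) * (of_nat j * of_nat i ^ (j - 1))) = 0" using l by simp
    qed (auto simp: inj_on_def r_def)
    then show "\<forall>i\<in>I. c i = 0" by (auto simp: I_def J_def)
  qed (simp add: I_def finJ)
  moreover have "card I = card J"
    unfolding I_def by (rule card_image[OF inj])
  moreover have "card J = (\<Sum>l\<le>n. r l)"
    by (simp add: J_def)
  ultimately have "rank_ge ?S (\<Sum>l\<le>n. r l)" by simp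
  then show ?thesis unfolding sec_rank_def r_def by blast
qed

lemma sec_rank_degree_1: "sec_rank n 1 b s (min (sdim n 1 b) ((n + 2) * s))"
proof (cases "s \<ge> Suc b")
  case True
  then have "(\<Sum>l\<le>n. min (Suc b) (s + card {j. j < s \<and> 0 = l})) = sdim n 1 b"
    by (simp add: card_exponents)
  then show ?thesis
    using sec_rank_degree_1_count[of s "\<lambda>_. 0" n b] by (auto intro: sec_rank_le)
next
  case False
  \<comment> \<open>Besides the \<open>s\<close> evaluations a block has room for \<open>D\<close>
    derivatives.\<close>
  define D where "D = Suc b - s"
  have D: "D > 0" "Suc b = s + D" using False by (auto simp: D_def)
  \<comment> \<open>Consecutive groups of \<open>D\<close> points share a block and the overflow
    goes to the last one. Either no block receives more than \<open>D\<close> derivatives and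
    nothing is lost, or every block receives at least \<open>D\<close> and is filled.\<close>
  define h where "h j = min n (j div D)" for j
  let ?m = "\<lambda>l. card {j. j < s \<and> h j = l}"
  have rank: "sec_rank n 1 b s (\<Sum>l\<le>n. min (Suc b) (s + ?m l))"
    by (rule sec_rank_degree_1_count) (simp add: h_def)
  have div_range: "{j. j div D = l} = {l * D..<Suc l * D}" for l
  proof -
    have "j div D = l \<longleftrightarrow> l * D \<le> j \<and> j < Suc l * D" for j
    proof
      assume "j div D = l"
      then show "l * D \<le> j \<and> j < Suc l * D"
        using div_times_less_eq_dividend[of j D] dividend_less_div_times[OF D(1), of j] by simp
    next
      assume "l * D \<le> j \<and> j < Suc l * D"
      then show "j div D = l" by (intro div_nat_eqI) (simp_all add: mult.commute)
    qed
    then show ?thesis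
      by (intro set_eqI) (simp only: mem_Collect_eq atLeastLessThan_iff)
  qed
  show ?thesis
  proof (cases "s \<le> Suc n * D")
    case True
    have "j div D \<le> n" if "j < s" for j
    proof -
      have "j div D < Suc n"
        by (rule less_mult_imp_div_less) (rule less_le_trans[OF that True])
      then show ?thesis by simp
    qed
    then have h: "h j = j div D" if "j < s" for j using that by (simp add: h_def)
    have le: "?m l \<le> D" for l
    proof -
      have "{j. j < s \<and> h j = l} \<subseteq> {j. j div D = l}" using h by auto
      moreover have "finite {j. j div D = l}" unfolding div_range by simp
      ultimately have "?m l \<le> card {j. j div D = l}" by (intro card_mono)
      then show ?thesis unfolding div_range by simp
    qed
    have "(\<Sum>l\<le>n. min (Suc b) (s + ?m l)) = (\<Sum>l\<le>n. s + ?m l)"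
      by (intro sum.cong min_absorb2 refl) (use le D(2) in simp)
    also have "\<dots> = Suc n * s + (\<Sum>l\<le>n. ?m l)" by (simp add: sum.distrib)
    also have "(\<Sum>l\<le>n. ?m l) = card (\<Union>l\<in>{..n}. {j. j < s \<and> h j = l})"
      by (rule card_UN_disjoint[symmetric]) auto
    also have "(\<Union>l\<in>{..n}. {j. j < s \<and> h j = l}) = {..<s}"
      by (auto simp: h_def)
    finally have "(\<Sum>l\<le>n. min (Suc b) (s + ?m l)) = (n + 2) * s" by simp
    then show ?thesis using rank by (auto intro: sec_rank_le)
  next
    case False
    have "?m l \<ge> D" if l: "l \<le> n" for l
    proof -
      have "Suc l * D \<le> Suc n * D" using l by (intro mult_le_mono1) simp
      then have lt: "j < s" if "j < Suc l * D" for j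
        using that False by (meson less_trans not_le order_less_le_trans)
      have "{l * D..<Suc l * D} \<subseteq> {j. j < s \<and> h j = l}"
      proof
        fix j assume j: "j \<in> {l * D..<Suc l * D}"
        then have "j div D = l" using div_range[of l] by blast
        with j l lt[of j] show "j \<in> {j. j < s \<and> h j = l}"
          by (simp add: h_def del: mult_Suc)
      qed
      then have "card {l * D..<Suc l * D} \<le> ?m l" by (rule card_mono[rotated]) simp
      then show ?thesis by simp
    qed
    then have "(\<Sum>l\<le>n. min (Suc b) (s + ?m l)) = (\<Sum>l\<le>n. Suc b)"
      using D(2) by (intro sum.cong min_absorb1 refl) (simp add: add_left_mono)
    then have "(\<Sum>l\<le>n. min (Suc b) (s + ?m l)) = sdim n 1 b" by (simp add: card_exponents)
    then show ?thesis using rank by (auto intro: sec_rank_le)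
  qed
qed

section \<open>Varying the number of points and the degree in the second factor\<close>

lemma euler:
  "(\<Sum>i\<le>n. fscale (P (Suc i)) (vpd n a b (Suc i) P)) = fscale (of_nat a) (vpt n a b P)"
proof
  fix x :: "(nat \<Rightarrow> nat) \<times> nat"
  obtain \<alpha> j where x: "x = (\<alpha>, j)" by force
  show "(\<Sum>i\<le>n. fscale (P (Suc i)) (vpd n a b (Suc i) P)) x = fscale (of_nat a) (vpt n a b P) x"
  proof (cases "\<alpha> \<in> exponents n a \<and> j \<le> b")
    case True
    have "P (Suc i) * (of_nat (\<alpha> i) * xmono n (\<alpha>(i := \<alpha> i - 1)) P) = of_nat (\<alpha> i) * xmono n \<alpha> P"
      if "i \<le> n" for i
      using that xmono_remove[OF that, of \<alpha> P] by (cases "\<alpha> i") (auto simp: xmono_upd)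
    then have "(\<Sum>i\<le>n. P (Suc i) * (of_nat (\<alpha> i) * xmono n (\<alpha>(i := \<alpha> i - 1)) P * P 0 ^ j))
        = (\<Sum>i\<le>n. of_nat (\<alpha> i)) * (xmono n \<alpha> P * P 0 ^ j)"
      unfolding sum_distrib_right by (intro sum.cong) (auto simp: mult.assoc[symmetric])
    moreover have "(\<Sum>i\<le>n. of_nat (\<alpha> i)) = (of_nat a :: complex)"
      using True by (simp add: exponents_def flip: of_nat_sum)
    ultimately show ?thesis
      using True by (simp add: x sum_fun_apply vpd_def vpt_def)
  qed (auto simp: x sum_fun_apply vpd_def vpt_def)
qed

lemma vpt_in_span_vpd: "vpt n (Suc c) b P \<in> fs.span ((\<lambda>k. vpd n (Suc c) b k P) ` {..Suc n})"
proof -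
  have "(\<Sum>i\<le>n. fscale (P (Suc i)) (vpd n (Suc c) b (Suc i) P)) \<in> fs.span ((\<lambda>k. vpd n (Suc c) b k P) ` {..Suc n})"
    by (intro fs.span_sum fs.span_scale fs.span_base) auto
  from fs.span_scale[OF this, of "1 / of_nat (Suc c)"] show ?thesis
    unfolding euler by (simp add: fscale_def del: of_nat_Suc)
qed

text \<open>By Euler's formula the \<open>n + 3\<close> vectors listed at one point span at most
  \<open>n + 2\<close> dimensions.\<close>

lemma sec_rank_drop_point:
  assumes "sec_rank n (Suc c) b (Suc s) r"
  shows "sec_rank n (Suc c) b s (r - (n + 2))"
proof -
  obtain q where q: "rank_ge (\<Union>j<Suc s. tan_vecs n (Suc c) b (q j)) r"
    using assms by (auto simp: sec_rank_def)
  let ?S = "\<Union>j<s. tan_vecs n (Suc c) b (q j)"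
  let ?X = "(\<lambda>k. vpd n (Suc c) b k (q s)) ` {..Suc n}"
  have "tan_vecs n (Suc c) b (q s) \<subseteq> fs.span ?X"
    using vpt_in_span_vpd[of n c b "q s"] by (auto simp: tan_vecs_def dirs_def intro: fs.span_base)
  moreover have "?S \<subseteq> fs.span (?S \<union> ?X)" "fs.span ?X \<subseteq> fs.span (?S \<union> ?X)"
    by (auto intro: fs.span_base fs.span_mono[THEN subsetD, rotated])
  ultimately have "(\<Union>j<Suc s. tan_vecs n (Suc c) b (q j)) \<subseteq> fs.span (?S \<union> ?X)"
    unfolding lessThan_Suc by auto
  then have "rank_ge (?S \<union> ?X) r" using q rank_ge_mono by blast
  then have "rank_ge ?S (r - card ?X)"
    by (rule rank_ge_Un_diff[rotated 2]) (auto simp: tan_vecs_def)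
  moreover have "card ?X \<le> n + 2" using card_image_le[of "{..Suc n}"] by auto
  ultimately have "rank_ge ?S (r - (n + 2))" by (auto intro: rank_ge_le)
  then show ?thesis unfolding sec_rank_def by blast
qed

lemma sec_rank_fewer_points:
  assumes "sec_rank n (Suc c) b s ((n + 2) * s)" "s' \<le> s"
  shows "sec_rank n (Suc c) b s' ((n + 2) * s')"
  using assms(2,1)
proof (induction s rule: dec_induct)
  case (step k)
  then have "sec_rank n (Suc c) b k ((n + 2) * k)"
    using sec_rank_drop_point[of n c b k "(n + 2) * Suc k"] by simp
  then show ?case by (rule step.IH)
qed

text \<open>Independence survives the removal of points and spanning survives their addition. Hence
  an independent number \<open>s0\<close> and a spanning number \<open>s1\<close> settle everything,
  provided that no number lies strictly between them.\<close>

lemma sec_rank_all: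
  assumes "sec_rank n (Suc c) b s0 (min (sdim n (Suc c) b) ((n + 2) * s0))"
    "sec_rank n (Suc c) b s1 (min (sdim n (Suc c) b) ((n + 2) * s1))"
    "(n + 2) * s0 \<le> sdim n (Suc c) b" "sdim n (Suc c) b \<le> (n + 2) * s1" "s1 \<le> Suc s0"
  shows "sec_rank n (Suc c) b s (min (sdim n (Suc c) b) ((n + 2) * s))"
proof (cases "s \<le> s0")
  case True
  have "sec_rank n (Suc c) b s0 ((n + 2) * s0)" using assms(1,3) by (simp add: min_absorb2)
  from sec_rank_fewer_points[OF this True] show ?thesis by (rule sec_rank_le) simp
next
  case False
  have "sec_rank n (Suc c) b s1 (sdim n (Suc c) b)" using assms(2,4) by (simp add: min_absorb1)
  from sec_rank_more_points[OF this, of s] show ?thesis using False assms(5)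
    by (auto intro: sec_rank_le)
qed

text \<open>Discarding the coordinates with \<open>j > b\<close> turns the tangent vectors for
  \<open>b'\<close> into those for \<open>b\<close>, and a projection does not raise the
  rank.\<close>

lemma sec_rank_b_mono:
  assumes "sec_rank n a b s r" "b \<le> b'"
  shows "sec_rank n a b' s r"
proof -
  obtain q where q: "rank_ge (\<Union>j<s. tan_vecs n a b (q j)) r"
    using assms by (auto simp: sec_rank_def)
  define f :: "((nat \<Rightarrow> nat) \<times> nat \<Rightarrow> complex) \<Rightarrow> _" where "f w = (\<lambda>(\<alpha>, j). if j \<le> b then w (\<alpha>, j) else 0)" for w
  have lin: "flinear f" by (rule flinearI) (auto simp: f_def split: prod.split)
  have f: "f (tvec n a b' d P) = tvec n a b d P" for d P
    using assms(2) by (cases d) (auto simp: f_def vpt_def vpd_def fun_eq_iff)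
  have "f ` (\<Union>j<s. tan_vecs n a b' (q j)) = (\<Union>j<s. tan_vecs n a b (q j))"
    unfolding image_UN tan_vecs_def image_image f ..
  with q have "rank_ge (f ` (\<Union>j<s. tan_vecs n a b' (q j))) r"
    by (simp only:)
  then have "rank_ge (\<Union>j<s. tan_vecs n a b' (q j)) r"
    by (rule rank_ge_linear_image[OF lin])
  then show ?thesis unfolding sec_rank_def by blast
qed

text \<open>The space for \<open>Suc b\<close> has one more coordinate for each element of
  \<open>exponents n a\<close>. Removing these from a spanning set costs at most that many
  dimensions, so the rest still spans.\<close>

lemma sec_rank_b_spanning:
  assumes "sec_rank n a (Suc b) s (sdim n a (Suc b))"
  shows "sec_rank n a b s (sdim n a b)"
proof -
  let ?S = "\<lambda>b q. \<Union>j<s. tan_vecs n a b (q j)"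
  obtain q where q: "rank_ge (?S (Suc b) q) (sdim n a (Suc b))"
    using assms by (auto simp: sec_rank_def)
  let ?E = "(\<lambda>\<alpha>. unit_vec (\<alpha>, Suc b)) ` exponents n a"
  have "tvec n a (Suc b) d P \<in> fs.span (?S b q \<union> ?E)" if "tvec n a b d P \<in> ?S b q" for d P
  proof -
    have "tvec n a (Suc b) d P = tvec n a b d P +
        (\<Sum>\<alpha>\<in>exponents n a. fscale (tvec n a (Suc b) d P (\<alpha>, Suc b)) (unit_vec (\<alpha>, Suc b)))"
    proof
      fix x :: "(nat \<Rightarrow> nat) \<times> nat"
      obtain \<alpha> j where x: "x = (\<alpha>, j)" by force
      have "(\<Sum>\<beta>\<in>exponents n a. tvec n a (Suc b) d P (\<beta>, Suc b) * unit_vec (\<beta>, Suc b) x)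
          = (\<Sum>\<beta>\<in>exponents n a. if \<beta> = \<alpha> then (if j = Suc b then tvec n a (Suc b) d P (\<beta>, Suc b) else 0) else 0)"
        by (rule sum.cong) (auto simp: x unit_vec_def)
      then show "tvec n a (Suc b) d P x = (tvec n a b d P +
        (\<Sum>\<alpha>\<in>exponents n a. fscale (tvec n a (Suc b) d P (\<alpha>, Suc b)) (unit_vec (\<alpha>, Suc b)))) x"
        by (cases d) (auto simp: x sum_fun_apply vpt_def vpd_def le_Suc_eq)
    qed
    also have "\<dots> \<in> fs.span (?S b q \<union> ?E)"
      using that by (intro fs.span_add fs.span_sum fs.span_scale fs.span_base) auto
    finally show ?thesis .
  qed
  then have "?S (Suc b) q \<subseteq> fs.span (?S b q \<union> ?E)"
    unfolding tan_vecs_def by blast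
  then have "rank_ge (?S b q \<union> ?E) (sdim n a (Suc b))" using rank_ge_mono[OF q] by blast
  then have "rank_ge (?S b q) (sdim n a (Suc b) - card ?E)"
    by (rule rank_ge_Un_diff[rotated 2]) (auto simp: tan_vecs_def)
  moreover have "card ?E \<le> card (exponents n a)" by (rule card_image_le) simp
  ultimately have "rank_ge (?S b q) (sdim n a b)" by (auto intro: rank_ge_le)
  then show ?thesis unfolding sec_rank_def by blast
qed

section \<open>Non-defectivity: numerical induction\<close>

lemma card_exponents_rec:
  "card (exponents (Suc m) (Suc c)) = card (exponents m (Suc c)) + card (exponents (Suc m) c)"
  by (simp add: card_exponents)

lemma card_exponents_absorb: "Suc c * card (exponents m (Suc c)) = (m + Suc c) * card (exponents m c)"
  using Suc_times_binomial_eq[of "m + c" c] by (simp add: card_exponents mult.commute)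

lemma card_exponents_mono: "card (exponents m a) \<le> card (exponents m (a + c))"
proof (induction c)
  case (Suc c)
  have "card (exponents m (a + c)) \<le> card (exponents m (Suc (a + c)))"
  proof (cases m)
    case 0
    then show ?thesis by (simp add: exponents_0)
  qed (simp add: card_exponents_rec)
  with Suc show ?case by simp
qed simp

lemma card_exponents_2: "2 * card (exponents m 2) = (m + 1) * (m + 2)"
  using card_exponents_absorb[of 1 m] card_exponents_absorb[of 0 m]
  by (simp add: numeral_2_eq_2 exponents_degree_0 algebra_simps)

lemma card_exponents_3: "6 * card (exponents m 3) = (m + 1) * (m + 2) * (m + 3)"
proof -
  have "6 * card (exponents m 3) = 2 * (3 * card (exponents m (Suc 2)))"
    by (simp add: eval_nat_numeral)
  also have "3 * card (exponents m (Suc 2)) = (m + 3) * card (exponents m 2)"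
    using card_exponents_absorb[of 2 m] by (simp add: eval_nat_numeral)
  also have "2 * ((m + 3) * card (exponents m 2)) = (m + 3) * (2 * card (exponents m 2))"
    by simp
  finally show ?thesis unfolding card_exponents_2 by (simp add: algebra_simps)
qed

lemma card_exponents_4: "24 * card (exponents m 4) = (m + 1) * (m + 2) * (m + 3) * (m + 4)"
proof -
  have "24 * card (exponents m 4) = 6 * (4 * card (exponents m (Suc 3)))"
    by (simp add: eval_nat_numeral)
  also have "4 * card (exponents m (Suc 3)) = (m + 4) * card (exponents m 3)"
    using card_exponents_absorb[of 3 m] by (simp add: eval_nat_numeral)
  also have "6 * ((m + 4) * card (exponents m 3)) = (m + 4) * (6 * card (exponents m 3))"
    by simp
  finally show ?thesis unfolding card_exponents_3 by (simp add: algebra_simps)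
qed

lemma near_le:
  fixes k x y :: nat
  assumes "k * x \<le> N" "N \<le> k * y + r" "r < k"
  shows "x \<le> y"
proof (rule ccontr)
  assume "\<not> x \<le> y"
  then have "k * (y + 1) \<le> k * x" by (intro mult_le_mono2) simp
  with assms show False by simp
qed

abbreviation (input) nondef :: "nat \<Rightarrow> nat \<Rightarrow> nat \<Rightarrow> nat \<Rightarrow> bool" where
  "nondef n a b s \<equiv> sec_rank n a b s (min (sdim n a b) ((n + 2) * s))"

lemma horace_le:
  assumes "sec_rank m (Suc (Suc c)) b u r0" "sec_rank (Suc m) (Suc c) b (v + d) r1"
    "sec_rank (Suc m) c b v r2" "d \<le> Suc m"
    "r \<le> min (sdim m (Suc (Suc c)) b) (r0 + d) + min (sdim m (Suc c) b + r2) (r1 - d + u)"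
  shows "sec_rank (Suc m) (Suc (Suc c)) b (v + d + u) r"
  by (rule sec_rank_le[OF horace[OF assms(1-4)] assms(5)])

text \<open>Restriction with \<open>d = 0\<close>: \<open>h\<close> points stay off the divisor and
  \<open>h * (m + 1)\<close> go to it. The trace is the perfect case of smaller dimension, degree 1
  is known, and in degree 0 the \<open>h\<close> points account for all \<open>b + 1 = 2 * h\<close>
  coefficients of a binary form. Every inequality becomes an equality.\<close>

lemma nondef_degree_2_perfect:
  assumes "Suc b = 2 * h"
  shows "sec_rank n 2 b (h * (n + 1)) (sdim n 2 b)" "sdim n 2 b = (n + 2) * (h * (n + 1))"
proof -
  show dim: "sdim n 2 b = (n + 2) * (h * (n + 1))" for n
    using card_exponents_2[of n] assms by (simp add: algebra_simps)
  show "sec_rank n 2 b (h * (n + 1)) (sdim n 2 b)"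
  proof (induction n)
    case 0
    show ?case using sec_rank_curve[of 0 2 b h] assms by (simp add: exponents_0)
  next
    case (Suc m)
    have d1: "card (exponents m (Suc 0)) = m + 1" "card (exponents (Suc m) (Suc 0)) = m + 2"
      by (simp_all add: card_exponents)
    have r0: "sec_rank m (Suc (Suc 0)) b (h * (m + 1)) (sdim m 2 b)"
      using Suc by (simp add: numeral_2_eq_2)
    have "(m + 3) * h \<le> min (sdim (Suc m) (Suc 0) b) ((Suc m + 2) * h)"
      unfolding d1 assms by (simp add: algebra_simps)
    then have r1: "sec_rank (Suc m) (Suc 0) b (h + 0) ((m + 3) * h)"
      using sec_rank_le[OF sec_rank_degree_1[of "Suc m" b h, unfolded One_nat_def]] by simp
    have r2: "sec_rank (Suc m) 0 b h (2 * h)"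
      using sec_rank_curve[of "Suc m" 0 b h] assms by simp
    have "sec_rank (Suc m) (Suc (Suc 0)) b (h + 0 + h * (m + 1)) (sdim (Suc m) 2 b)"
    proof (rule horace_le[OF r0 r1 r2])
      have "sdim (Suc m) 2 b = sdim m 2 b + (2 * h) * (m + 2)"
        unfolding dim by (simp add: algebra_simps)
      moreover have "sdim m (Suc 0) b + 2 * h = (2 * h) * (m + 2)"
        unfolding d1 assms by (simp add: algebra_simps)
      moreover have "(m + 3) * h - 0 + h * (m + 1) = (2 * h) * (m + 2)"
        by (simp add: algebra_simps)
      ultimately show "sdim (Suc m) 2 b \<le> min (sdim m (Suc (Suc 0)) b) (sdim m 2 b + 0) +
          min (sdim m (Suc 0) b + 2 * h) ((m + 3) * h - 0 + h * (m + 1))"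
        by (simp add: numeral_2_eq_2)
    qed simp
    then show ?case by (simp add: numeral_2_eq_2)
  qed
qed

lemma nondef_degree_2:
  assumes "Suc b = 2 * h"
  shows "nondef n 2 b s"
proof -
  note p = nondef_degree_2_perfect[OF assms, of n]
  have "sec_rank n (Suc 1) b (h * (n + 1)) (min (sdim n (Suc 1) b) ((n + 2) * (h * (n + 1))))"
    using p by (simp add: numeral_2_eq_2)
  from sec_rank_all[OF this this, of s] show ?thesis
    using p(2) by (simp add: numeral_2_eq_2)
qed

text \<open>For the odd number \<open>b - 1\<close> the perfect number of points is
  \<open>k * (n + 1)\<close>, and independence passes from \<open>b - 1\<close> to
  \<open>b\<close>.\<close>

lemma degree_2_few_points:
  assumes "b = 2 * k" "s \<le> k * (n + 1)"
  shows "sec_rank n 2 b s ((n + 2) * s)"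
proof (cases k)
  case 0
  then show ?thesis using assms by (simp add: sec_rank_def)
next
  case (Suc k')
  then have b: "Suc (b - 1) = 2 * k" using assms by simp
  have "(n + 2) * s \<le> (n + 2) * (k * (n + 1))" using assms(2) by (rule mult_le_mono2)
  then have "sec_rank n 2 (b - 1) s ((n + 2) * s)"
    using nondef_degree_2[OF b, of n s] nondef_degree_2_perfect(2)[OF b, of n]
    by (auto intro: sec_rank_le)
  then show ?thesis by (rule sec_rank_b_mono) simp
qed

text \<open>For the odd number \<open>b + 1\<close> the perfect number is
  \<open>(k + 1) * (n + 1)\<close>, and spanning passes from \<open>b + 1\<close> down to
  \<open>b\<close>.\<close>

lemma degree_2_many_points:
  assumes "b = 2 * k" "(k + 1) * (n + 1) \<le> s"
  shows "sec_rank n 2 b s (sdim n 2 b)"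
proof -
  have b: "Suc (Suc b) = 2 * (k + 1)" using assms by simp
  have "(n + 2) * ((k + 1) * (n + 1)) \<le> (n + 2) * s" using assms(2) by (rule mult_le_mono2)
  then have "sec_rank n 2 (Suc b) s (sdim n 2 (Suc b))"
    using nondef_degree_2[OF b, of n s] nondef_degree_2_perfect(2)[OF b, of n]
    by (auto intro: sec_rank_le)
  then show ?thesis by (rule sec_rank_b_spanning)
qed

text \<open>With \<open>d\<close> the remainder of the trace dimension the trace is filled exactly.
  Of the two inequalities, \<open>d \<le> u\<close> serves the case in which \<open>v + d\<close>
  tangent spaces already fill the residual, and the other one the case in which the bound through
  degree \<open>c\<close> applies with \<open>v\<close> independent tangent spaces.\<close>

lemma horace_step:
  assumes N1: "sdim m (Suc (Suc c)) b = (m + 2) * u + d" and d: "d \<le> Suc m" "d \<le> u"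
    and X: "u + (m + 2) * d \<le> sdim m (Suc c) b"
    and r0: "nondef m (Suc (Suc c)) b u" and r1: "nondef (Suc m) (Suc c) b (v + d)"
    and r2: "nondef (Suc m) c b v"
  shows "nondef (Suc m) (Suc (Suc c)) b (v + d + u)"
proof (rule horace_le[OF _ r1 r2 d(1)])
  show "sec_rank m (Suc (Suc c)) b u ((m + 2) * u)"
    by (rule sec_rank_le[OF r0], unfold N1) simp
  have a1: "sdim (Suc m) (Suc (Suc c)) b = sdim m (Suc (Suc c)) b + sdim (Suc m) (Suc c) b"
    and a2: "sdim (Suc m) (Suc c) b = sdim m (Suc c) b + sdim (Suc m) c b"
    by (simp_all add: card_exponents_rec distrib_right)
  have e1: "(Suc m + 2) * (v + d + u) = (m + 3) * v + (m + 3) * d + (m + 3) * u"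
    and e2: "(Suc m + 2) * (v + d) = (m + 3) * v + (m + 3) * d"
    and e3: "(m + 3) * d = (m + 2) * d + d" and e4: "(m + 3) * u = (m + 2) * u + u"
    and e5: "(Suc m + 2) * v = (m + 3) * v"
    by (simp_all add: algebra_simps)
  show "min (sdim (Suc m) (Suc (Suc c)) b) ((Suc m + 2) * (v + d + u))
    \<le> min (sdim m (Suc (Suc c)) b) ((m + 2) * u + d) +
      min (sdim m (Suc c) b + min (sdim (Suc m) c b) ((Suc m + 2) * v))
       (min (sdim (Suc m) (Suc c) b) ((Suc m + 2) * (v + d)) - d + u)"
    using d X N1 unfolding e1 e2 e5 unfolding e3 e4 a1 a2 by linarith
qed

text \<open>By \<open>sec_rank_all\<close> only the quotient of the dimension by
  \<open>n + 2\<close>, rounded down and rounded up, has to be treated, and both roundings satisfy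
  the two inequalities.\<close>

lemma nondef_near:
  assumes "\<And>s. sdim n (Suc c) b \<le> (n + 2) * s + (n + 1) \<Longrightarrow> (n + 2) * s \<le> sdim n (Suc c) b + (n + 1) \<Longrightarrow>
    nondef n (Suc c) b s"
  shows "nondef n (Suc c) b s"
proof -
  let ?N = "sdim n (Suc c) b"
  define s0 where "s0 = ?N div (n + 2)"
  define s1 where "s1 = (?N + (n + 1)) div (n + 2)"
  have s0: "(n + 2) * s0 \<le> ?N" "?N \<le> (n + 2) * s0 + (n + 1)"
    using div_mult_mod_eq[of ?N "n + 2"] mod_less_divisor[of "n + 2" ?N]
    unfolding s0_def mult.commute[of "n + 2"] by linarith+
  have s1: "(n + 2) * s1 \<le> ?N + (n + 1)" "?N \<le> (n + 2) * s1"
    using div_mult_mod_eq[of "?N + (n + 1)" "n + 2"] mod_less_divisor[of "n + 2" "?N + (n + 1)"]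
    unfolding s1_def mult.commute[of "n + 2"] by linarith+
  have "?N + (n + 1) \<le> (n + 2) * Suc s0 + n"
    using s0(2) by simp
  then have "s1 \<le> Suc s0" by (rule near_le[OF s1(1)]) simp
  moreover have "nondef n (Suc c) b s0" by (rule assms) (use s0 in linarith)+
  moreover have "nondef n (Suc c) b s1" by (rule assms) (use s1 in linarith)+
  ultimately show ?thesis using sec_rank_all s0(1) s1(2) by blast
qed

lemma trace_numbers:
  assumes b: "b \<ge> 3" and N1: "sdim m (c + 3) b = (m + 2) * u + d" and d: "d \<le> Suc m"
  shows "d \<le> u" "u + (m + 2) * d \<le> sdim m (c + 2) b"
proof -
  let ?N1 = "sdim m (c + 3) b" and ?X = "sdim m (c + 2) b"
  \<comment> \<open>The hypothesis \<open>b \<ge> 3\<close> enters as \<open>Suc b \<ge> 4\<close>;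
    the bound is four times the number of quadratic monomials.\<close>
  have low: "2 * (m + 1) * (m + 2) \<le> sdim m (2 + e) b" for e
  proof -
    have "2 * (m + 1) * (m + 2) = card (exponents m 2) * 4" using card_exponents_2[of m] by simp
    also have "\<dots> \<le> card (exponents m (2 + e)) * Suc b"
      by (rule mult_le_mono[OF card_exponents_mono]) (use b in simp)
    finally show ?thesis .
  qed
  show "d \<le> u"
  proof (rule ccontr)
    assume "\<not> d \<le> u"
    then have "u \<le> m" using d by simp
    then have "(m + 2) * u \<le> (m + 2) * m" by (rule mult_le_mono2)
    then have "?N1 < 2 * (m + 1) * (m + 2)" using N1 d by (simp add: algebra_simps)
    then show False using low[of "c + 1"] by (simp add: eval_nat_numeral)
  qed
  \<comment> \<open>The absorption identity of binomial coefficients expresses the dimension in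
    degree \<open>c + 3\<close> through that in degree \<open>c + 2\<close>, for which the quadratic
    lower bound is at hand.\<close>
  have abs: "(c + 3) * ?N1 = (m + c + 3) * ?X"
    using arg_cong[OF card_exponents_absorb[of "c + 2" m], of "\<lambda>x. x * Suc b"]
    by (simp add: eval_nat_numeral algebra_simps)
  have X: "2 * (m + 1) * (m + 2) \<le> ?X" using low[of c] by (simp add: add.commute)
  have "(c + 3) * ((m + 1) * (m + 1) * (m + 3)) \<le> ((c + 2) * (m + 1) + 1) * (2 * (m + 1) * (m + 2))"
    by (simp add: algebra_simps)
  also have "\<dots> \<le> ((c + 2) * (m + 1) + 1) * ?X" using X by (rule mult_le_mono2)
  finally have "(c + 3) * ((m + 1) * (m + 1) * (m + 3)) + (m + c + 3) * ?X \<le> (c + 3) * ((m + 2) * ?X)"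
    by (simp add: algebra_simps)
  then have "(c + 3) * ((m + 1) * (m + 1) * (m + 3) + ?N1) \<le> (c + 3) * ((m + 2) * ?X)"
    unfolding distrib_left abs .
  then have 1: "(m + 1) * (m + 1) * (m + 3) + ?N1 \<le> (m + 2) * ?X"
    by (rule mult_le_cancel1[THEN iffD1, THEN mp]) simp
  have "(m + 2) * (u + (m + 2) * d) + d = ?N1 + (m + 1) * (m + 3) * d + d"
    unfolding N1 by (simp add: algebra_simps)
  also have "\<dots> \<le> ?N1 + (m + 1) * (m + 3) * (m + 1) + d"
    using d by (intro add_mono mult_le_mono2) auto
  finally have "(m + 2) * (u + (m + 2) * d) \<le> (m + 2) * ?X"
    using 1 by (simp add: algebra_simps)
  then show "u + (m + 2) * d \<le> ?X"
    by (rule mult_le_cancel1[THEN iffD1, THEN mp]) simp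
qed

text \<open>The disjunction in the hypothesis leaves a way out: where a residual falls into a range
  that is not covered, \<open>s\<close> itself may be treated directly. Only numbers
  \<open>s\<close> within rounding of the perfect quotient are asked for.\<close>

lemma nondef_induction_step:
  assumes b: "b \<ge> 3" and r0: "\<And>u. nondef m (c + 3) b u"
    and r: "\<And>u v d s. sdim m (c + 3) b = (m + 2) * u + d \<Longrightarrow> d \<le> Suc m \<Longrightarrow> s = v + d + u \<Longrightarrow>
      sdim (Suc m) (c + 3) b \<le> (m + 3) * s + (m + 2) \<Longrightarrow> (m + 3) * s \<le> sdim (Suc m) (c + 3) b + (m + 2) \<Longrightarrow>
      nondef (Suc m) (c + 2) b (v + d) \<and> nondef (Suc m) (c + 1) b v \<or> nondef (Suc m) (c + 3) b s"
  shows "nondef (Suc m) (c + 3) b s"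
proof -
  let ?N1 = "sdim m (c + 3) b"
  define u where "u = ?N1 div (m + 2)"
  define d where "d = ?N1 mod (m + 2)"
  have N1: "?N1 = (m + 2) * u + d" unfolding u_def d_def by (metis mult_div_mod_eq)
  have d: "d \<le> Suc m" using mod_less_divisor[of "m + 2" ?N1] unfolding d_def by simp
  note tn = trace_numbers[OF b N1 d]
  have N: "sdim (Suc m) (c + 3) b = ?N1 + sdim (Suc m) (c + 2) b"
    and N2: "sdim (Suc m) (c + 2) b = sdim m (c + 2) b + sdim (Suc m) (c + 1) b"
    using card_exponents_rec[of m "c + 2"] card_exponents_rec[of m "c + 1"]
    by (simp_all add: distrib_right eval_nat_numeral)
  have "nondef (Suc m) (Suc (c + 2)) b s"
  proof (rule nondef_near)
    fix s assume "sdim (Suc m) (Suc (c + 2)) b \<le> (Suc m + 2) * s + (Suc m + 1)"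
      "(Suc m + 2) * s \<le> sdim (Suc m) (Suc (c + 2)) b + (Suc m + 1)"
    then have s: "sdim (Suc m) (c + 3) b \<le> (m + 3) * s + (m + 2)"
      "(m + 3) * s \<le> sdim (Suc m) (c + 3) b + (m + 2)"
      by (simp_all add: eval_nat_numeral)
    \<comment> \<open>Ensures that the points sent to the divisor do not outnumber \<open>s\<close>,
      so that \<open>s - u - d\<close> is a genuine difference.\<close>
    have "(m + 3) * (u + d) \<le> sdim (Suc m) (c + 3) b"
      using tn(2) N N2 N1 by (simp add: algebra_simps)
    from near_le[OF this s(1)] have "u + d \<le> s" by simp
    then have sv: "s = (s - u - d) + d + u" by simp
    from r[OF N1 d sv s] show "nondef (Suc m) (Suc (c + 2)) b s"
    proof
      assume "nondef (Suc m) (c + 2) b (s - u - d + d) \<and> nondef (Suc m) (c + 1) b (s - u - d)"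
      then have "nondef (Suc m) (Suc (Suc (c + 1))) b (s - u - d + d + u)"
        using horace_step[of m "c + 1" b u d "s - u - d"] N1 d tn r0[of u]
        by (simp add: eval_nat_numeral)
      then show ?thesis using sv by simp
    qed (simp add: eval_nat_numeral)
  qed
  then show ?thesis by (simp add: eval_nat_numeral)
qed

text \<open>For even \<open>b\<close>, degree \<open>a = 2\<close> is defective, so the induction must keep the number of
  points on the degree 2 residual outside the defective range.\<close>

lemma cubic_numbers:
  assumes N1: "sdim m 3 (2 * K + 4) = (m + 2) * u + d" and d: "d \<le> Suc m"
    and s: "(m + 3) * s \<le> sdim (Suc m) 3 (2 * K + 4) + (m + 2)"
    and gt: "u + (K + 2) * (m + 2) < s"
  shows "(m + 1) * (K + 1) \<le> 3"
proof -
  let ?B = "2 * K + 5"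
  have B: "Suc (2 * K + 4) = ?B" by simp
  have e1: "6 * sdim m 3 (2 * K + 4) = (m + 2) * (?B * (m + 1) * (m + 3))"
    using card_exponents_3[of m] unfolding B by (simp add: algebra_simps)
  have e2: "6 * sdim (Suc m) 3 (2 * K + 4) = (m + 3) * (?B * (m + 2) * (m + 4))"
    using card_exponents_3[of "Suc m"] unfolding B by (simp add: algebra_simps)
  have "(m + 3) * (6 * s) \<le> (m + 3) * (?B * (m + 2) * (m + 4)) + 6 * (m + 2)"
    using s e2 by (simp add: algebra_simps)
  also have "\<dots> < (m + 3) * (?B * (m + 2) * (m + 4) + 6)"
    by (simp add: distrib_left)
  finally have 1: "6 * s < ?B * (m + 2) * (m + 4) + 6"
    by (rule mult_less_cancel1[THEN iffD1, THEN conjunct2])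
  have "(m + 2) * (?B * (m + 1) * (m + 3)) = (m + 2) * (6 * u) + 6 * d"
    using e1 N1 by (simp add: algebra_simps)
  also have "\<dots> < (m + 2) * (6 * u + 6)"
    using d by (simp add: distrib_left)
  finally have 2: "?B * (m + 1) * (m + 3) < 6 * u + 6"
    by (rule mult_less_cancel1[THEN iffD1, THEN conjunct2])
  show ?thesis using 1 2 gt by (simp add: algebra_simps)
qed

text \<open>In degree 4 the second residual, with its \<open>v\<close> points, is the one of degree
  2. The inequality limits the \<open>m\<close> and \<open>K\<close> for which \<open>v\<close> can
  fall short of \<open>(K + 3) * (m + 2)\<close>, from where on degree 2 is spanning; a factor
  \<open>m + 1\<close> is left to be cancelled.\<close>

lemma quartic_numbers:
  assumes N1: "sdim m 4 (2 * K + 4) = (m + 2) * u + d" and d: "d \<le> Suc m"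
    and s: "sdim (Suc m) 4 (2 * K + 4) \<le> (m + 3) * s + (m + 2)"
    and lt: "s < u + d + (K + 3) * (m + 2)"
  shows "6 * K * ((m + 1) * (m + 1)) + 2 * K * (m + 1) + 15 * ((m + 1) * (m + 1)) < 31 * (m + 1)"
proof -
  let ?B = "2 * K + 5"
  have B: "Suc (2 * K + 4) = ?B" by simp
  have e1: "24 * sdim m 4 (2 * K + 4) = (m + 2) * (?B * (m + 1) * (m + 3) * (m + 4))"
    using card_exponents_4[of m] unfolding B by (simp add: algebra_simps)
  have e2: "24 * sdim (Suc m) 4 (2 * K + 4) = (m + 3) * (?B * (m + 2) * (m + 4) * (m + 5))"
    using card_exponents_4[of "Suc m"] unfolding B by (simp add: algebra_simps)
  have "(m + 3) * (?B * (m + 2) * (m + 4) * (m + 5)) \<le> (m + 3) * (24 * s) + 24 * (m + 2)"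
    unfolding e2[symmetric] using s by simp
  also have "\<dots> < (m + 3) * (24 * s + 24)"
    by (simp add: distrib_left)
  finally have 1: "?B * (m + 2) * (m + 4) * (m + 5) < 24 * s + 24"
    by (rule mult_less_cancel1[THEN iffD1, THEN conjunct2])
  have "(m + 2) * (24 * (u + d)) = (m + 2) * (?B * (m + 1) * (m + 3) * (m + 4)) + 24 * (m + 1) * d"
    unfolding e1[symmetric] N1 by (simp add: algebra_simps)
  also have "\<dots> \<le> (m + 2) * (?B * (m + 1) * (m + 3) * (m + 4)) + 24 * (m + 1) * (m + 1)"
    using d by (intro add_mono mult_le_mono2) auto
  also have "\<dots> < (m + 2) * (?B * (m + 1) * (m + 3) * (m + 4) + 24 * m + 13)"
    by (simp add: algebra_simps)
  finally have 2: "24 * (u + d) < ?B * (m + 1) * (m + 3) * (m + 4) + 24 * m + 13"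
    by (rule mult_less_cancel1[THEN iffD1, THEN conjunct2])
  show ?thesis using 1 2 lt by (simp add: algebra_simps)
qed

text \<open>In the following cases rounding pushes the induction into the defective range for
  degree 2; there the trace on the hyperplane is overfull or underfull by one or two.\<close>

lemma cubic_sporadic:
  "nondef 1 3 4 7" "nondef 2 3 4 13" "nondef 1 3 6 10"
proof -
  \<comment> \<open>The choice \<open>u = 2\<close>, \<open>d = 1\<close> by division would leave 5
    points in degree 2, strictly between the known ranges up to 4 and from 6 on. With 3 points on
    the divisor one trace condition is wasted, which is affordable as 21 vectors have to fill 20
    dimensions.\<close>
  have "sec_rank (Suc 0) (Suc (Suc 1)) 4 (4 + 0 + 3) 20"
  proof (rule horace_le)
    show "sec_rank 0 (Suc (Suc 1)) 4 3 5"
      using sec_rank_curve[of 0 "Suc (Suc 1)" 4 3] by simp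
    show "sec_rank (Suc 0) (Suc 1) 4 (4 + 0) 12"
      using degree_2_few_points[of 4 2 4 1] by (simp add: numeral_2_eq_2)
    show "sec_rank (Suc 0) 1 4 4 10"
      using sec_rank_degree_1[of "Suc 0" 4 4] by (simp add: card_exponents)
  qed (simp_all add: card_exponents eval_nat_numeral)
  then show *: "nondef 1 3 4 7"
    by (simp add: card_exponents eval_nat_numeral)
  \<comment> \<open>The division \<open>20 = 3 * 6 + 2\<close> would leave 7 points in degree 2,
    strictly between 6 and 9. The trace with 7 points is the case just settled.\<close>
  have "sec_rank (Suc 1) (Suc (Suc 1)) 4 (6 + 0 + 7) 50"
  proof (rule horace_le)
    show "sec_rank 1 (Suc (Suc 1)) 4 7 20"
      using * by (simp add: card_exponents eval_nat_numeral)
    show "sec_rank (Suc 1) (Suc 1) 4 (6 + 0) 24"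
      using degree_2_few_points[of 4 2 6 2] by (simp add: numeral_2_eq_2)
    show "sec_rank (Suc 1) 1 4 6 15"
      using sec_rank_degree_1[of 2 4 6] by (simp add: card_exponents numeral_2_eq_2)
  qed (simp_all add: card_exponents eval_nat_numeral)
  then show "nondef 2 3 4 13"
    by (simp add: card_exponents eval_nat_numeral)
  have "sec_rank (Suc 0) (Suc (Suc 1)) 6 (6 + 0 + 4) 28"
  proof (rule horace_le)
    show "sec_rank 0 (Suc (Suc 1)) 6 4 7"
      using sec_rank_curve[of 0 "Suc (Suc 1)" 6 4] by simp
    show "sec_rank (Suc 0) (Suc 1) 6 (6 + 0) 18"
      using degree_2_few_points[of 6 3 6 1] by (simp add: numeral_2_eq_2)
    show "sec_rank (Suc 0) 1 6 6 14"
      using sec_rank_degree_1[of "Suc 0" 6 6] by (simp add: card_exponents)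
  qed (simp_all add: card_exponents eval_nat_numeral)
  then show "nondef 1 3 6 10"
    by (simp add: card_exponents eval_nat_numeral)
qed

text \<open>The remainder 1 of the trace is ignored. With \<open>d = 0\<close> the number
  \<open>v\<close> rises from 5 to 6 and from 7 to 8, where degree 2 is spanning. The trace stays
  one short of full, harmlessly, since only 24 of 25 and 33 of 35 dimensions are asked for.\<close>

lemma quartic_sporadic:
  "nondef 1 3 4 6 \<Longrightarrow> nondef 1 4 4 8" "nondef 1 3 6 8 \<Longrightarrow> nondef 1 4 6 11"
proof -
  assume *: "nondef 1 3 4 6"
  have "sec_rank (Suc 0) (Suc (Suc 2)) 4 (6 + 0 + 2) 24"
  proof (rule horace_le)
    show "sec_rank 0 (Suc (Suc 2)) 4 2 4"
      using sec_rank_curve[of 0 "Suc (Suc 2)" 4 2] by simp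
    show "sec_rank (Suc 0) (Suc 2) 4 (6 + 0) 18"
      using * by (simp add: card_exponents eval_nat_numeral)
    show "sec_rank (Suc 0) 2 4 6 15"
      using degree_2_many_points[of 4 2 1 6] by (simp add: card_exponents eval_nat_numeral)
  qed (simp_all add: card_exponents eval_nat_numeral)
  then show "nondef 1 4 4 8"
    by (simp add: card_exponents eval_nat_numeral)
next
  assume *: "nondef 1 3 6 8"
  have "sec_rank (Suc 0) (Suc (Suc 2)) 6 (8 + 0 + 3) 33"
  proof (rule horace_le)
    show "sec_rank 0 (Suc (Suc 2)) 6 3 6"
      using sec_rank_curve[of 0 "Suc (Suc 2)" 6 3] by simp
    show "sec_rank (Suc 0) (Suc 2) 6 (8 + 0) 24"
      using * by (simp add: card_exponents eval_nat_numeral)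
    show "sec_rank (Suc 0) 2 6 8 21"
      using degree_2_many_points[of 6 3 1 8] by (simp add: card_exponents eval_nat_numeral)
  qed (simp_all add: card_exponents eval_nat_numeral)
  then show "nondef 1 4 6 11"
    by (simp add: card_exponents eval_nat_numeral)
qed

text \<open>Up to \<open>(K + 2) * (m + 2)\<close> points in degree 2 are independent. Beyond this
  only five pairs of \<open>m\<close> and \<open>K\<close> survive: three of them lead to the
  sporadic numbers of points, and two are excluded by rounding.\<close>

lemma cubic_step:
  assumes N1: "sdim m 3 (2 * K + 4) = (m + 2) * u + d" and d: "d \<le> Suc m" and svdu: "s = v + d + u"
    and s: "sdim (Suc m) 3 (2 * K + 4) \<le> (m + 3) * s + (m + 2)"
      "(m + 3) * s \<le> sdim (Suc m) 3 (2 * K + 4) + (m + 2)"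
  shows "nondef (Suc m) 2 (2 * K + 4) (v + d) \<or> nondef (Suc m) 3 (2 * K + 4) s"
proof (cases "v + d \<le> (K + 2) * (m + 2)")
  case True
  have "sec_rank (Suc m) 2 (2 * K + 4) (v + d) ((Suc m + 2) * (v + d))"
    by (rule degree_2_few_points[of _ "K + 2"]) (use True in auto)
  then have "nondef (Suc m) 2 (2 * K + 4) (v + d)" by (rule sec_rank_le) simp
  then show ?thesis ..
next
  case False
  then have gt: "u + (K + 2) * (m + 2) < s" using svdu by simp
  from cubic_numbers[OF N1 d s(2) gt] have small: "(m + 1) * (K + 1) \<le> 3" .
  have "m + 1 \<le> 3" "K + 1 \<le> 3"
    by (rule le_trans[OF _ small]; simp)+
  then have "m = 0 \<or> m = 1 \<or> m = 2" "K = 0 \<or> K = 1 \<or> K = 2" by linarith+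
  then consider "m = 0" "K = 0" | "m = 0" "K = 1" | "m = 0" "K = 2" | "m = 1" "K = 0" | "m = 2" "K = 0"
    using small by auto
  then show ?thesis
  proof cases
    case 1
    then have "5 = 2 * u + d" "d \<le> 1" "20 \<le> 3 * s + 2" "3 * s \<le> 22" "u + 4 < s"
      using N1 d s gt by (simp_all add: card_exponents eval_nat_numeral)
    then have "s = 7" by linarith
    then show ?thesis using cubic_sporadic(1) 1 by simp
  next
    case 2
    then have "7 = 2 * u + d" "d \<le> 1" "28 \<le> 3 * s + 2" "3 * s \<le> 30" "u + 6 < s"
      using N1 d s gt by (simp_all add: card_exponents eval_nat_numeral)
    then have "s = 10" by linarith
    then show ?thesis using cubic_sporadic(3) 2 by simp
  next
    case 3
    then have "9 = 2 * u + d" "d \<le> 1" "3 * s \<le> 38" "u + 8 < s"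
      using N1 d s gt by (simp_all add: card_exponents eval_nat_numeral)
    then show ?thesis by linarith
  next
    case 4
    then have "20 = 3 * u + d" "d \<le> 2" "50 \<le> 4 * s + 3" "4 * s \<le> 53" "u + 6 < s"
      using N1 d s gt by (simp_all add: card_exponents eval_nat_numeral)
    then have "s = 13" by linarith
    then show ?thesis using cubic_sporadic(2) 4 by (simp add: numeral_2_eq_2)
  next
    case 5
    then have "50 = 4 * u + d" "d \<le> 3" "5 * s \<le> 104" "u + 8 < s"
      using N1 d s gt by (simp_all add: card_exponents eval_nat_numeral)
    then have False by presburger
    then show ?thesis ..
  qed
qed

text \<open>Three pairs of \<open>m\<close> and \<open>K\<close> survive: two lead to the sporadic
  numbers 8 and 11, which rest on the cubic case, and the third is excluded by rounding.\<close>

lemma quartic_step: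
  assumes N1: "sdim m 4 (2 * K + 4) = (m + 2) * u + d" and d: "d \<le> Suc m" and svdu: "s = v + d + u"
    and s: "sdim (Suc m) 4 (2 * K + 4) \<le> (m + 3) * s + (m + 2)"
      "(m + 3) * s \<le> sdim (Suc m) 4 (2 * K + 4) + (m + 2)"
    and IH: "\<And>s. nondef (Suc m) 3 (2 * K + 4) s"
  shows "nondef (Suc m) 2 (2 * K + 4) v \<or> nondef (Suc m) 4 (2 * K + 4) s"
proof (cases "(K + 3) * (m + 2) \<le> v")
  case True
  have "sec_rank (Suc m) 2 (2 * K + 4) v (sdim (Suc m) 2 (2 * K + 4))"
    by (rule degree_2_many_points[of _ "K + 2"]) (use True in \<open>simp_all add: algebra_simps\<close>)
  then have "nondef (Suc m) 2 (2 * K + 4) v" by (rule sec_rank_le) simp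
  then show ?thesis ..
next
  case False
  then have lt: "s < u + d + (K + 3) * (m + 2)" using svdu by simp
  have "(6 * K * (m + 1) + 2 * K + 15 * (m + 1)) * (m + 1) < 31 * (m + 1)"
    using quartic_numbers[OF N1 d s(1) lt] by (simp add: algebra_simps)
  then have small: "6 * K * (m + 1) + 2 * K + 15 * (m + 1) < 31"
    by (rule mult_less_cancel2[THEN iffD1, THEN conjunct2])
  then have "m \<le> 1" by simp
  have dims: "card (exponents 0 4) = 1" "card (exponents (Suc 0) 4) = 5"
    "card (exponents (Suc (Suc 0)) 4) = 15" "card (exponents 2 4) = 15"
    by (simp_all add: card_exponents eval_nat_numeral)
  from \<open>m \<le> 1\<close> consider "m = 0" "K = 0" | "m = 0" "K = 1" | "m = 1" "K = 0"
    using small by (cases "m = 0") (auto simp: less_2_cases_iff)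
  then show ?thesis
  proof cases
    case 1
    then have "5 = 2 * u + d" "d \<le> 1" "25 \<le> 3 * s + 2" "s < u + d + 6"
      using N1 d s lt by (simp_all add: dims)
    then have "s = 8" by linarith
    then show ?thesis using quartic_sporadic(1) IH[of 6] 1 by simp
  next
    case 2
    then have "7 = 2 * u + d" "d \<le> 1" "35 \<le> 3 * s + 2" "s < u + d + 8"
      using N1 d s lt by (simp_all add: dims)
    then have "s = 11" by linarith
    then show ?thesis using quartic_sporadic(2) IH[of 8] 2 by simp
  next
    case 3
    then have "25 = 3 * u + d" "d \<le> 2" "75 \<le> 4 * s + 3" "s < u + d + 9"
      using N1 d s lt by (simp_all add: dims)
    then show ?thesis by linarith
  qed
qed

text \<open>The residuals have degrees \<open>a - 1\<close> and \<open>a - 2\<close>, so even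
  \<open>b\<close> interferes for \<open>a = 3\<close> through the first and for
  \<open>a = 4\<close> through the second; from \<open>a = 5\<close> on both are at least cubic. The
  base \<open>n = 0\<close> is a rational normal curve.\<close>

theorem nondefective_tangents:
  assumes "b \<ge> 3" "a \<ge> 1" "a = 2 \<Longrightarrow> odd b"
  shows "nondef n a b s"
  using assms(2,3)
proof (induction n arbitrary: a s)
  case 0
  show ?case using sec_rank_curve[of 0 a b s] by (simp add: exponents_0 mult_2)
next
  case (Suc m)
  note outer = Suc.IH
  from Suc.prems show ?case
  proof (induction a arbitrary: s rule: less_induct)
    case (less a)
    consider "a = 1" | "a = 2" | c where "a = c + 3"
      using less.prems(1) le_Suc_ex[of 3 a] by (metis One_nat_def Suc_1 add.commute le_antisym not_less_eq_eq numeral_3_eq_3)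
    then show ?case
    proof cases
      case 1
      show ?thesis unfolding 1 by (rule sec_rank_degree_1)
    next
      case 2
      then have "even (Suc b)" using less.prems by simp
      then obtain h where "Suc b = 2 * h" by (elim evenE)
      from nondef_degree_2[OF this] show ?thesis unfolding 2 .
    next
      case (3 c)
      have K: "\<exists>K. b = 2 * K + 4" if "even b"
      proof -
        obtain k where "b = 2 * k" using \<open>even b\<close> by (elim evenE)
        then show ?thesis using assms(1) by (intro exI[of _ "k - 2"]) simp
      qed
      show ?thesis
        unfolding 3
      proof (rule nondef_induction_step[OF assms(1)])
        show "nondef m (c + 3) b u" for u by (rule outer) auto
        fix u v d s
        assume A: "sdim m (c + 3) b = (m + 2) * u + d" "d \<le> Suc m" "s = v + d + u"
          "sdim (Suc m) (c + 3) b \<le> (m + 3) * s + (m + 2)" "(m + 3) * s \<le> sdim (Suc m) (c + 3) b + (m + 2)"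
        have IH: "nondef (Suc m) a' b s" if "a' = c + 1 \<or> a' = c + 2" "a' = 2 \<Longrightarrow> odd b" for a' s
          by (rule less.IH) (use 3 that in auto)
        show "nondef (Suc m) (c + 2) b (v + d) \<and> nondef (Suc m) (c + 1) b v \<or> nondef (Suc m) (c + 3) b s"
        proof (cases "odd b \<or> c \<ge> 2")
          case True
          then show ?thesis using IH[of "c + 1"] IH[of "c + 2"] by auto
        next
          case False
          then obtain K where b: "b = 2 * K + 4" using K by blast
          from False consider "c = 0" | "c = 1" by linarith
          then show ?thesis
          proof cases
            case 1
            have "nondef (Suc m) 1 b v" by (rule IH) (use 1 in auto)
            moreover have "nondef (Suc m) 2 b (v + d) \<or> nondef (Suc m) 3 b s"
              using cubic_step[of m K u d s v] A unfolding b 1 by simp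
            ultimately show ?thesis unfolding 1 by (simp only: add_0) auto
          next
            case 2
            have IH3: "nondef (Suc m) 3 b s" for s by (rule IH) (use 2 in auto)
            have "nondef (Suc m) 2 b v \<or> nondef (Suc m) 4 b s"
              using quartic_step[of m K u d s v] A IH3 unfolding b 2 by simp
            then show ?thesis using IH3[of "v + d"] unfolding 2 by (simp add: eval_nat_numeral) 
          qed
        qed
      qed
    qed
  qed
qed

section \<open>Krull dimension of projective varieties\<close>

lemma poly_eval_power: "poly_eval (f ^ m) v = poly_eval f v ^ m"
proof (induction m)
  case 0
  show ?case using poly_eval_single[of 0 1 v] by (simp add: mono_eval_def)
qed (simp add: poly_eval_mult)

lemma poly_eval_sum: "poly_eval (\<Sum>k\<in>K. f k) v = (\<Sum>k\<in>K. poly_eval (f k) v)"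
  by (induction K rule: infinite_finite_induct) (auto simp: poly_eval_add)

lemma poly_eval_prod: "poly_eval (\<Prod>k\<in>K. f k) v = (\<Prod>k\<in>K. poly_eval (f k) v)"
proof (induction K rule: infinite_finite_induct)
  case empty
  show ?case using poly_eval_power[of 1 0] by simp
next
  case (infinite K)
  then show ?case using poly_eval_power[of 1 0] by simp
qed (auto simp: poly_eval_mult)

definition forms :: "'i set \<Rightarrow> nat \<Rightarrow> 'i cpoly set" where
  "forms I d = {f. poly_vars f \<subseteq> I \<and> homogeneous d f}"

lemma forms_hom_polys: "f \<in> forms I d \<Longrightarrow> f \<in> hom_polys I"
  by (auto simp: forms_def hom_polys_def)

lemma hom_polys_forms: "f \<in> hom_polys I \<Longrightarrow> \<exists>d. f \<in> forms I d"
  by (auto simp: forms_def hom_polys_def)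

lemma forms_0: "0 \<in> forms I d"
  by (auto simp: forms_def poly_vars_def homogeneous_def)

lemma forms_add: "f \<in> forms I d \<Longrightarrow> g \<in> forms I d \<Longrightarrow> f + g \<in> forms I d"
  using keys_add[of f g] unfolding forms_def poly_vars_def homogeneous_def mem_Collect_eq by blast

lemma forms_mult:
  assumes "f \<in> forms I d" "g \<in> forms I e"
  shows "f * g \<in> forms I (d + e)"
proof -
  have *: "\<exists>a\<in>Poly_Mapping.keys f. \<exists>b\<in>Poly_Mapping.keys g. m = a + b"
    if "m \<in> Poly_Mapping.keys (f * g)" for m
    using that keys_mult[of f g] by blast
  have "homogeneous (d + e) (f * g)"
    using assms * unfolding homogeneous_def forms_def by (simp, metis mono_degree_add)
  moreover have "poly_vars (f * g) \<subseteq> poly_vars f \<union> poly_vars g"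
    unfolding poly_vars_def using * keys_add by fast
  ultimately show ?thesis using assms by (auto simp: forms_def)
qed

lemma forms_const: "Poly_Mapping.single 0 c \<in> forms I 0"
  by (auto simp: forms_def poly_vars_def homogeneous_def mono_degree_def)

lemma forms_1: "1 \<in> forms I 0"
  using forms_const[of 1 I] by simp

lemma forms_power: "f \<in> forms I d \<Longrightarrow> f ^ m \<in> forms I (m * d)"
  by (induction m) (auto intro: forms_1 forms_mult simp: add.commute)

lemma forms_sum: "(\<And>k. k \<in> K \<Longrightarrow> f k \<in> forms I d) \<Longrightarrow> (\<Sum>k\<in>K. f k) \<in> forms I d"
  by (induction K rule: infinite_finite_induct) (auto intro: forms_0 forms_add)

lemma forms_prod: "finite K \<Longrightarrow> (\<And>k. k \<in> K \<Longrightarrow> f k \<in> forms I (d k)) \<Longrightarrow> (\<Prod>k\<in>K. f k) \<in> forms I (\<Sum>k\<in>K. d k)"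
  by (induction K rule: finite_induct) (auto intro: forms_1 forms_mult)

lemma forms_scale: "f \<in> forms I d \<Longrightarrow> Poly_Mapping.single 0 c * f \<in> forms I d"
  using forms_mult[OF forms_const, of f I d c] by simp

lemma poly_eval_const: "poly_eval (Poly_Mapping.single 0 c * f) v = c * poly_eval f v"
  by (simp add: poly_eval_mult poly_eval_single mono_eval_def)

definition linear_form :: "'i set \<Rightarrow> ('i \<Rightarrow> complex) \<Rightarrow> 'i cpoly" where
  "linear_form I l = (\<Sum>i\<in>I. Poly_Mapping.single (Poly_Mapping.single i 1) (l i))"

lemma linear_form_forms: "linear_form I l \<in> forms I 1"
  unfolding linear_form_def
  by (rule forms_sum) (auto simp: forms_def poly_vars_def homogeneous_def mono_degree_def split: if_splits)

lemma poly_eval_linear_form: "poly_eval (linear_form I l) v = (\<Sum>i\<in>I. l i * v i)"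
  by (simp add: linear_form_def poly_eval_sum poly_eval_single mono_eval_def)

lemma polyfn_poly_eval: "(\<lambda>v. poly_eval f v) \<in> polyfn"
  unfolding poly_eval_def mono_eval_def by (intro polyfn_intros)

section \<open>Hilbert functions of cones\<close>

definition form_fun :: "('i \<Rightarrow> complex) set \<Rightarrow> 'i cpoly \<Rightarrow> ('i \<Rightarrow> complex) \<Rightarrow> complex" where
  "form_fun A f = (\<lambda>v. if v \<in> A then poly_eval f v else 0)"

text \<open>The piece of degree \<open>d\<close> of the homogeneous coordinate ring of
  \<open>A\<close>, realised as functions extended by 0; its rank is the Hilbert function.\<close>

definition form_funs :: "'i set \<Rightarrow> ('i \<Rightarrow> complex) set \<Rightarrow> nat \<Rightarrow> (('i \<Rightarrow> complex) \<Rightarrow> complex) set" where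
  "form_funs I A d = form_fun A ` forms I d"

lemma span_form_funs: "fs.span (form_funs I A d) = form_funs I A d"
proof -
  have "fs.subspace (form_funs I A d)"
    unfolding fs.subspace_def
  proof (intro conjI ballI allI)
    show "0 \<in> form_funs I A d"
      unfolding form_funs_def by (rule image_eqI[OF _ forms_0]) (auto simp: form_fun_def)
  next
    fix x y assume "x \<in> form_funs I A d" "y \<in> form_funs I A d"
    then obtain f g where "f \<in> forms I d" "g \<in> forms I d" "x = form_fun A f" "y = form_fun A g"
      by (auto simp: form_funs_def)
    then show "x + y \<in> form_funs I A d"
      unfolding form_funs_def
      by (intro image_eqI[OF _ forms_add[of f I d g]]) (auto simp: form_fun_def poly_eval_add)
  next
    fix c x assume "x \<in> form_funs I A d"
    then obtain f where "f \<in> forms I d" "x = form_fun A f"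
      by (auto simp: form_funs_def)
    then show "fscale c x \<in> form_funs I A d"
      unfolding form_funs_def
      by (intro image_eqI[OF _ forms_scale[of f I d c]]) (auto simp: form_fun_def poly_eval_const)
  qed
  then show ?thesis by (simp only: fs.span_eq_iff)
qed

lemma rank_ge_injective_image:
  assumes "flinear f" "\<And>x. x \<in> fs.span S \<Longrightarrow> f x = 0 \<Longrightarrow> x = 0" "rank_ge S r"
  shows "rank_ge (f ` S) r"
proof -
  obtain w where w: "indep_family {..<r} w" "\<forall>i<r. w i \<in> fs.span S"
    using assms(3) by (auto simp: rank_ge_def)
  have "indep_family {..<r} (\<lambda>i. f (w i))"
    unfolding indep_family_def
  proof (intro allI impI)
    fix c assume "(\<Sum>k<r. fscale (c k) (f (w k))) = 0"
    then have "f (\<Sum>k<r. fscale (c k) (w k)) = 0"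
      using flinear_family[OF assms(1), of c w] by simp
    moreover have "(\<Sum>k<r. fscale (c k) (w k)) \<in> fs.span S"
      using w(2) by (intro fs.span_sum fs.span_scale) auto
    ultimately have "(\<Sum>k<r. fscale (c k) (w k)) = 0" using assms(2) by blast
    then show "\<forall>k\<in>{..<r}. c k = 0" using indep_familyD[OF w(1)] by blast
  qed
  moreover have "f (w i) \<in> fs.span (f ` S)" if "i < r" for i
    using w(2) that unfolding fs.linear_span_image[OF assms(1)] by blast
  ultimately show ?thesis unfolding rank_ge_def by blast
qed

lemma form_fun_eq_0: "form_fun A f = 0 \<longleftrightarrow> (\<forall>v\<in>A. poly_eval f v = 0)"
  by (auto simp: form_fun_def fun_eq_iff)

text \<open>Multiplication by \<open>g\<close> embeds the functions of degree \<open>d\<close> on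
  \<open>A\<close> into those of degree \<open>d + e\<close> that vanish on \<open>A'\<close>, and
  restriction from \<open>A\<close> to \<open>A'\<close> is onto.\<close>

lemma rank_form_funs_step:
  assumes sub: "A' \<subseteq> A" and g: "g \<in> forms I e" "\<And>v. v \<in> A' \<Longrightarrow> poly_eval g v = 0"
    and cancel: "\<And>f d. f \<in> forms I d \<Longrightarrow> (\<forall>v\<in>A. poly_eval g v * poly_eval f v = 0) \<Longrightarrow> \<forall>v\<in>A. poly_eval f v = 0"
    and r1: "rank_ge (form_funs I A' (d + e)) r1" and r2: "rank_ge (form_funs I A d) r2"
  shows "rank_ge (form_funs I A (d + e)) (r1 + r2)"
proof -
  define res :: "(('a \<Rightarrow> complex) \<Rightarrow> complex) \<Rightarrow> ('a \<Rightarrow> complex) \<Rightarrow> complex" where "res w = (\<lambda>v. if v \<in> A' then w v else 0)" for w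
  define mul :: "(('a \<Rightarrow> complex) \<Rightarrow> complex) \<Rightarrow> ('a \<Rightarrow> complex) \<Rightarrow> complex" where "mul w = (\<lambda>v. poly_eval g v * w v)" for w
  have res: "flinear res" by (rule flinearI) (auto simp: res_def)
  have mul: "flinear mul" by (rule flinearI) (auto simp: mul_def algebra_simps)
  have "rank_ge (mul ` form_funs I A d) r2"
  proof (rule rank_ge_injective_image[OF mul _ r2])
    fix x assume "x \<in> fs.span (form_funs I A d)" "mul x = 0"
    then obtain f where f: "f \<in> forms I d" "x = form_fun A f"
      unfolding span_form_funs by (auto simp: form_funs_def)
    have "\<forall>v\<in>A. poly_eval g v * poly_eval f v = 0"
      using \<open>mul x = 0\<close> by (auto simp: f(2) mul_def form_fun_def fun_eq_iff split: if_splits)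
    then show "x = 0" using cancel[OF f(1)] f(2) form_fun_eq_0 by blast
  qed
  moreover have "res x = 0" if "x \<in> mul ` form_funs I A d" for x
    using that g(2) by (auto simp: res_def mul_def)
  moreover have "res ` form_funs I A (d + e) = form_funs I A' (d + e)"
    unfolding form_funs_def image_image
    by (rule image_cong) (use sub in \<open>auto simp: res_def form_fun_def fun_eq_iff\<close>)
  ultimately have "rank_ge (mul ` form_funs I A d \<union> form_funs I A (d + e)) (r2 + r1)"
    using rank_ge_split[OF res, of "mul ` form_funs I A d" r2 "form_funs I A (d + e)" r1] r1 by simp
  moreover have "mul ` form_funs I A d \<subseteq> form_funs I A (d + e)"
  proof
    fix x assume "x \<in> mul ` form_funs I A d"
    then obtain f where f: "f \<in> forms I d" "x = mul (form_fun A f)" by (auto simp: form_funs_def)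
    then show "x \<in> form_funs I A (d + e)"
      unfolding form_funs_def add.commute[of d e]
      by (intro image_eqI[OF _ forms_mult[OF g(1) f(1)]]) (auto simp: mul_def form_fun_def poly_eval_mult)
  qed
  ultimately show ?thesis by (simp add: Un_absorb1 add.commute)
qed

lemma rank_form_funs_mono:
  assumes "A' \<subseteq> A" "rank_ge (form_funs I A' d) r"
  shows "rank_ge (form_funs I A d) r"
proof -
  define res :: "(('a \<Rightarrow> complex) \<Rightarrow> complex) \<Rightarrow> ('a \<Rightarrow> complex) \<Rightarrow> complex" where "res w = (\<lambda>v. if v \<in> A' then w v else 0)" for w
  have res: "flinear res" by (rule flinearI) (auto simp: res_def)
  have "res ` form_funs I A d = form_funs I A' d"
    unfolding form_funs_def image_image
    by (rule image_cong) (use assms(1) in \<open>auto simp: res_def form_fun_def fun_eq_iff\<close>)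
  with assms(2) have "rank_ge (res ` form_funs I A d) r" by (simp only:)
  then show ?thesis by (rule rank_ge_linear_image[OF res])
qed

lemma proj_point_self: "v \<in> proj_point v"
  unfolding proj_point_def by (auto intro!: exI[of _ 1])

lemma zero_locus_singleton_rep:
  assumes "f \<in> hom_polys I" "proj_point v \<in> proj_space I"
  shows "proj_point v \<in> zero_locus I {f} \<longleftrightarrow> poly_eval f v = 0"
  using assms hom_polys_nonzero_rep[OF assms(1)] proj_point_self[of v]
  by (auto simp: zero_locus_def)

text \<open>The homogeneous coordinate ring of an irreducible set has no zero divisors: the zero
  loci of the two factors cover \<open>Z\<close>, so one of them contains it.\<close>

lemma irreducible_cancel:
  assumes irr: "irreducible_in (zariski I) Z"
    and f: "f \<in> forms I d" and g: "g \<in> forms I e"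
    and prod: "\<And>v. v \<in> \<Union>Z \<Longrightarrow> poly_eval g v * poly_eval f v = 0"
    and nz: "w \<in> \<Union>Z" "poly_eval g w \<noteq> 0"
  shows "\<forall>v\<in>\<Union>Z. poly_eval f v = 0"
proof -
  have Z: "Z \<subseteq> proj_space I" using irr by (simp add: irreducible_in_def topspace_zariski)
  note fh = forms_hom_polys[OF f] and gh = forms_hom_polys[OF g]
  have cl: "closedin (zariski I) (zero_locus I {f})" "closedin (zariski I) (zero_locus I {g})"
    using fh gh by (auto simp: closedin_zariski)
  have "Z \<subseteq> zero_locus I {g} \<union> zero_locus I {f}"
  proof
    fix p assume p: "p \<in> Z"
    then obtain v where v: "p = proj_point v" using Z by (auto simp: proj_space_def)
    have "proj_point v \<in> proj_space I" using Z p v by blast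
    moreover have "poly_eval g v = 0 \<or> poly_eval f v = 0"
      using prod[of v] p v proj_point_self by auto
    ultimately show "p \<in> zero_locus I {g} \<union> zero_locus I {f}"
      using zero_locus_singleton_rep fh gh v by blast
  qed
  then have "Z \<subseteq> zero_locus I {g} \<or> Z \<subseteq> zero_locus I {f}"
    using irr cl unfolding irreducible_in_def by blast
  moreover have "\<not> Z \<subseteq> zero_locus I {g}" using nz by (auto simp: zero_locus_def)
  ultimately show ?thesis by (auto simp: zero_locus_def)
qed

lemma separating_form:
  assumes "closedin (zariski I) Z" "p \<in> proj_space I" "p \<notin> Z"
  obtains f d v where "f \<in> forms I d" "d > 0" "\<forall>w\<in>\<Union>Z. poly_eval f w = 0" "v \<in> p" "poly_eval f v \<noteq> 0"
proof -
  obtain F where F: "F \<subseteq> hom_polys I" "Z = zero_locus I F"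
    using assms(1) by (auto simp: closedin_zariski)
  then obtain f v where f: "f \<in> F" "v \<in> p" "poly_eval f v \<noteq> 0"
    using assms(2,3) by (auto simp: zero_locus_def)
  obtain d where d: "f \<in> forms I d" using hom_polys_forms F(1) f(1) by blast
  obtain w where w: "p = proj_point w" "w \<in> coord_space I" "w \<noteq> (\<lambda>i. 0)"
    using assms(2) by (auto simp: proj_space_def)
  then obtain i where i: "w i \<noteq> 0" "i \<in> I" by (auto simp: coord_space_def fun_eq_iff)
  \<comment> \<open>A coordinate that does not vanish at the point. The separating equation may be a
    constant, as for the empty set; multiplication by \<open>l\<close> makes its degree
    positive.\<close>
  define l where "l = (Poly_Mapping.single (Poly_Mapping.single i 1) 1 :: 'a cpoly)"
  have l: "l \<in> forms I 1"
    using i(2) by (auto simp: l_def forms_def poly_vars_def homogeneous_def mono_degree_def)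
  have lw: "poly_eval l w \<noteq> 0" using i(1) by (simp add: l_def poly_eval_single mono_eval_def)
  have "poly_eval f w \<noteq> 0"
    using hom_polys_nonzero_rep[OF forms_hom_polys[OF d]] f(2,3) w(1) by blast
  then have nz: "poly_eval (f * l) w \<noteq> 0" using lw by (simp add: poly_eval_mult)
  have van: "\<forall>w\<in>\<Union>Z. poly_eval (f * l) w = 0"
    using F(2) f(1) by (auto simp: zero_locus_def poly_eval_mult)
  have wp: "w \<in> p" unfolding w(1) by (rule proj_point_self)
  show ?thesis by (rule that[OF forms_mult[OF d l] _ van wp nz]) simp
qed

definition chain :: "'i set \<Rightarrow> nat \<Rightarrow> (nat \<Rightarrow> ('i \<Rightarrow> complex) set set) \<Rightarrow> bool" where
  "chain I k Z \<longleftrightarrow> (\<forall>i\<le>k. closedin (zariski I) (Z i) \<and> irreducible_in (zariski I) (Z i)) \<and>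
    (\<forall>i<k. Z i \<subset> Z (Suc i))"

text \<open>Multiplication by a form of degree \<open>e\<close> that vanishes on \<open>Z k\<close> but not on \<open>Z (Suc k)\<close> shows that
  the Hilbert functions satisfy \<open>H (Suc k) (d + e) \<ge> H k (d + e) + H (Suc k) d\<close>, so the degree of
  growth increases along the chain.\<close>

lemma chain_hilbert_growth:
  assumes "chain I k Z"
  shows "\<exists>E>0. \<forall>E'>0. E dvd E' \<longrightarrow> (\<forall>q. rank_ge (form_funs I (\<Union>(Z k)) (E' * q)) ((q + k) choose k))"
  using assms
proof (induction k)
  case 0
  then have irr: "irreducible_in (zariski I) (Z 0)" by (simp add: chain_def)
  then obtain p where p: "p \<in> Z 0" "p \<in> proj_space I"
    by (auto simp: irreducible_in_def topspace_zariski)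
  have "closedin (zariski I) {}" by simp
  from separating_form[OF this p(2)] obtain f d v where f: "f \<in> forms I d" "d > 0" "v \<in> p" "poly_eval f v \<noteq> 0"
    by auto
  show ?case
  proof (intro exI[of _ d] conjI allI impI)
    fix E' q assume E': "E' > 0" "d dvd E'"
    then obtain e where e: "E' = d * e" by auto
    let ?g = "f ^ (e * q)"
    have g: "?g \<in> forms I (E' * q)" using forms_power[OF f(1), of "e * q"] by (simp add: e mult_ac)
    have "form_fun (\<Union>(Z 0)) ?g \<noteq> 0"
      using f(3,4) p(1) unfolding form_fun_eq_0 poly_eval_power by auto
    then have "rank_ge (form_funs I (\<Union>(Z 0)) (E' * q)) (card {form_fun (\<Union>(Z 0)) ?g})"
      using g by (intro rank_ge_independent) (auto simp: form_funs_def intro: fs.span_base)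
    then show "rank_ge (form_funs I (\<Union>(Z 0)) (E' * q)) ((q + 0) choose 0)" by simp
  qed (rule f(2))
next
  case (Suc k)
  then have "chain I k Z" by (auto simp: chain_def)
  with Suc.IH obtain E where E: "E > 0"
    "\<And>E' q. E' > 0 \<Longrightarrow> E dvd E' \<Longrightarrow> rank_ge (form_funs I (\<Union>(Z k)) (E' * q)) ((q + k) choose k)"
    by blast
  have irr: "irreducible_in (zariski I) (Z (Suc k))" and cl: "closedin (zariski I) (Z k)"
    and sub: "Z k \<subset> Z (Suc k)"
    using Suc.prems by (auto simp: chain_def)
  obtain p where p: "p \<in> Z (Suc k)" "p \<notin> Z k" using sub by blast
  then have pp: "p \<in> proj_space I" using irr by (auto simp: irreducible_in_def topspace_zariski)
  obtain g e v where g: "g \<in> forms I e" "e > 0" "\<forall>w\<in>\<Union>(Z k). poly_eval g w = 0" "v \<in> p" "poly_eval g v \<noteq> 0"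
    by (rule separating_form[OF cl pp p(2)])
  show ?case
  proof (intro exI[of _ "E * e"] conjI allI impI)
    \<comment> \<open>Multiples of \<open>E * e\<close> are admissible for the shorter chain and are
      degrees of powers of \<open>g\<close>; this is why the claim speaks of all multiples of some
      \<open>E\<close>.\<close>
    show "E * e > 0" using E(1) g(2) by simp
    fix E' q assume E': "E' > 0" "E * e dvd E'"
    then have dE: "E dvd E'" "e dvd E'" by (auto intro: dvd_mult_left dvd_mult_right)
    then obtain c where c: "E' = e * c" by auto
    then have "c > 0" using E'(1) by simp
    let ?g = "g ^ c"
    have g': "?g \<in> forms I E'" using forms_power[OF g(1), of c] by (simp add: c mult.commute)
    show "rank_ge (form_funs I (\<Union>(Z (Suc k))) (E' * q)) ((q + Suc k) choose Suc k)"
    proof (induction q)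
      case 0
      have "\<Union>(Z k) \<subseteq> \<Union>(Z (Suc k))" using sub by blast
      from rank_form_funs_mono[OF this E(2)[OF E'(1) dE(1), of 0]] show ?case by simp
    next
      case (Suc q)
      \<comment> \<open>The two binomial coefficients add up by Pascal's rule.\<close>
      have "rank_ge (form_funs I (\<Union>(Z (Suc k))) (E' * q + E')) (((Suc q + k) choose k) + ((q + Suc k) choose Suc k))"
      proof (rule rank_form_funs_step[OF _ g'])
        show "\<Union>(Z k) \<subseteq> \<Union>(Z (Suc k))" using sub by blast
        show "poly_eval ?g w = 0" if "w \<in> \<Union>(Z k)" for w
        proof -
          have "poly_eval g w = 0" using g(3) that by blast
          then show ?thesis using \<open>c > 0\<close> by (simp add: poly_eval_power)
        qed
        show "rank_ge (form_funs I (\<Union>(Z k)) (E' * q + E')) ((Suc q + k) choose k)"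
          using E(2)[OF E'(1) dE(1), of "Suc q"] by (simp add: add.commute)
        show "rank_ge (form_funs I (\<Union>(Z (Suc k))) (E' * q)) ((q + Suc k) choose Suc k)" by (rule Suc.IH)
        show "\<forall>v\<in>\<Union>(Z (Suc k)). poly_eval f v = 0"
          if "f \<in> forms I d" "\<forall>v\<in>\<Union>(Z (Suc k)). poly_eval ?g v * poly_eval f v = 0" for f d
        proof (rule irreducible_cancel[OF irr that(1) g'])
          show "v \<in> \<Union>(Z (Suc k))" using p(1) g(4) by blast
          show "poly_eval ?g v \<noteq> 0" using g(5) by (simp add: poly_eval_power)
        qed (use that(2) in blast)
      qed
      then show ?case by (simp add: add.commute)
    qed
  qed
qed

section \<open>Upper bounds for Hilbert functions by the number of parameters\<close>

definition bounded_exps :: "nat \<Rightarrow> nat \<Rightarrow> (nat \<Rightarrow> nat) set" where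
  "bounded_exps k D = {\<gamma>. (\<forall>i. (i \<in> {..<k} \<longrightarrow> \<gamma> i \<in> {..D}) \<and> (i \<notin> {..<k} \<longrightarrow> \<gamma> i = 0))}"

text \<open>Bounding each exponent separately gives the dimension bound \<open>Suc D ^ k\<close> at
  once, and the order of growth in \<open>D\<close> is all that counts.\<close>

definition bounded_polys :: "nat \<Rightarrow> nat \<Rightarrow> ((nat \<Rightarrow> complex) \<Rightarrow> complex) set" where
  "bounded_polys k D = fs.span ((\<lambda>\<gamma> u. \<Prod>i<k. u i ^ \<gamma> i) ` bounded_exps k D)"

lemma finite_bounded_exps [simp]: "finite (bounded_exps k D)"
  unfolding bounded_exps_def by (rule finite_set_of_finite_funs) auto

lemma card_bounded_exps: "card (bounded_exps k D) = Suc D ^ k"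
proof -
  have "bij_betw (\<lambda>\<gamma>. restrict \<gamma> {..<k}) (bounded_exps k D) (PiE {..<k} (\<lambda>_. {..D}))"
  proof (rule bij_betw_byWitness[where f' = "\<lambda>\<gamma> i. if i < k then \<gamma> i else 0"])
    show "\<forall>\<gamma>\<in>bounded_exps k D. (\<lambda>i. if i < k then restrict \<gamma> {..<k} i else 0) = \<gamma>"
      by (simp add: bounded_exps_def restrict_def fun_eq_iff)
    show "\<forall>\<gamma>\<in>{..<k} \<rightarrow>\<^sub>E {..D}. restrict (\<lambda>i. if i < k then \<gamma> i else 0) {..<k} = \<gamma>"
      by (simp add: PiE_def extensional_def restrict_def fun_eq_iff)
    show "(\<lambda>\<gamma>. restrict \<gamma> {..<k}) ` bounded_exps k D \<subseteq> {..<k} \<rightarrow>\<^sub>E {..D}"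
      by (force simp: bounded_exps_def)
    show "(\<lambda>\<gamma> i. if i < k then \<gamma> i else 0) ` ({..<k} \<rightarrow>\<^sub>E {..D}) \<subseteq> bounded_exps k D"
      by (force simp: bounded_exps_def)
  qed
  then have "card (bounded_exps k D) = card (PiE {..<k} (\<lambda>_. {..D}))" by (rule bij_betw_same_card)
  then show ?thesis by (simp add: card_PiE)
qed

lemma bounded_polys_mono: "D \<le> E \<Longrightarrow> bounded_polys k D \<subseteq> bounded_polys k E"
  unfolding bounded_polys_def by (intro fs.span_mono image_mono) (auto simp: bounded_exps_def)

lemma bounded_polys_const: "(\<lambda>_. c) \<in> bounded_polys k D"
proof -
  have "(\<lambda>u. \<Prod>i<k. u i ^ 0) \<in> bounded_polys k D"
    unfolding bounded_polys_def
    by (rule fs.span_base, rule image_eqI[where x = "\<lambda>_. 0"]) (auto simp: bounded_exps_def)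
  from fs.span_scale[OF this[unfolded bounded_polys_def], of c] show ?thesis
    by (simp add: bounded_polys_def fscale_def)
qed

lemma bounded_polys_coord:
  assumes "l < k"
  shows "(\<lambda>u. u l) \<in> bounded_polys k (Suc D)"
proof -
  have "(\<Prod>i<k. u i ^ (if i = l then 1 else 0)) = u l" for u :: "nat \<Rightarrow> complex"
    using assms prod.remove[of "{..<k}" l "\<lambda>i. u i ^ (if i = l then 1 else 0)"] by simp
  then have "(\<lambda>u :: nat \<Rightarrow> complex. u l) = (\<lambda>u. \<Prod>i<k. u i ^ (\<lambda>i. if i = l then 1 else 0) i)"
    by (intro ext) simp
  then show ?thesis
    unfolding bounded_polys_def
    by (intro fs.span_base image_eqI[where x = "\<lambda>i. if i = l then 1 else 0"])
      (use assms in \<open>auto simp: bounded_exps_def\<close>)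
qed

lemma bounded_polys_add:
  "f \<in> bounded_polys k D \<Longrightarrow> g \<in> bounded_polys k D \<Longrightarrow> (\<lambda>u. f u + g u) \<in> bounded_polys k D"
  using fs.span_add[of f _ g] by (simp add: bounded_polys_def plus_fun_def)

lemma bounded_polys_sum:
  "(\<And>j. j \<in> J \<Longrightarrow> f j \<in> bounded_polys k D) \<Longrightarrow> (\<lambda>u. \<Sum>j\<in>J. f j u) \<in> bounded_polys k D"
  by (induction J rule: infinite_finite_induct) (auto intro: bounded_polys_const bounded_polys_add)

lemma bounded_polys_mult:
  assumes "f \<in> bounded_polys k D" "g \<in> bounded_polys k E"
  shows "(\<lambda>u. f u * g u) \<in> bounded_polys k (D + E)"
proof -
  let ?m = "\<lambda>(\<gamma>::nat \<Rightarrow> nat) u. \<Prod>i<k. (u i :: complex) ^ \<gamma> i"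
  let ?T = "fs.span (?m ` bounded_exps k (D + E))"
  have mono: "(\<lambda>u. ?m \<gamma> u * ?m \<delta> u) \<in> ?T"
    if "\<gamma> \<in> bounded_exps k D" "\<delta> \<in> bounded_exps k E" for \<gamma> \<delta>
    using that by (intro fs.span_base image_eqI[where x = "\<lambda>i. \<gamma> i + \<delta> i"])
      (auto simp: bounded_exps_def power_add prod.distrib add_mono)
  have sub: "fs.subspace {f. (\<lambda>u. f u * h u) \<in> ?T}" for h :: "(nat \<Rightarrow> complex) \<Rightarrow> complex"
    unfolding fs.subspace_def
  proof (intro conjI ballI allI)
    show "0 \<in> {f. (\<lambda>u. f u * h u) \<in> ?T}" using fs.span_zero[of "?m ` bounded_exps k (D + E)"] by (simp add: zero_fun_def)
  next
    fix x y assume "x \<in> {f. (\<lambda>u. f u * h u) \<in> ?T}" "y \<in> {f. (\<lambda>u. f u * h u) \<in> ?T}"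
    then have "(\<lambda>u. x u * h u) + (\<lambda>u. y u * h u) \<in> ?T" by (auto intro: fs.span_add)
    then show "x + y \<in> {f. (\<lambda>u. f u * h u) \<in> ?T}" by (simp add: plus_fun_def distrib_right)
  next
    fix c x assume "x \<in> {f. (\<lambda>u. f u * h u) \<in> ?T}"
    then have "fscale c (\<lambda>u. x u * h u) \<in> ?T" by (auto intro: fs.span_scale)
    then show "fscale c x \<in> {f. (\<lambda>u. f u * h u) \<in> ?T}" by (simp add: fscale_def mult.assoc)
  qed
  have 1: "(\<lambda>u. f u * ?m \<delta> u) \<in> ?T" if "\<delta> \<in> bounded_exps k E" for \<delta>
  proof -
    have "?m ` bounded_exps k D \<subseteq> {f. (\<lambda>u. f u * ?m \<delta> u) \<in> ?T}" using mono[OF _ that] by auto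
    from fs.span_minimal[OF this sub] show ?thesis using assms(1) unfolding bounded_polys_def by blast
  qed
  then have "?m ` bounded_exps k E \<subseteq> {g. (\<lambda>u. g u * f u) \<in> ?T}" by (auto simp: mult.commute)
  from fs.span_minimal[OF this sub] have "(\<lambda>u. g u * f u) \<in> ?T" using assms(2) unfolding bounded_polys_def by blast
  then show ?thesis by (simp add: bounded_polys_def mult.commute)
qed

lemma bounded_polys_power: "f \<in> bounded_polys k D \<Longrightarrow> (\<lambda>u. f u ^ m) \<in> bounded_polys k (m * D)"
  by (induction m) (auto intro: bounded_polys_const bounded_polys_mult)

lemma bounded_polys_prod:
  "finite J \<Longrightarrow> (\<And>j. j \<in> J \<Longrightarrow> f j \<in> bounded_polys k (D j)) \<Longrightarrow> (\<lambda>u. \<Prod>j\<in>J. f j u) \<in> bounded_polys k (\<Sum>j\<in>J. D j)"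
  by (induction J rule: finite_induct) (auto intro: bounded_polys_const bounded_polys_mult)

lemma form_pullback_bounded:
  assumes f: "f \<in> forms I d" and \<phi>: "\<And>i. i \<in> I \<Longrightarrow> (\<lambda>u. \<phi> u i) \<in> bounded_polys k D"
  shows "(\<lambda>u. poly_eval f (\<phi> u)) \<in> bounded_polys k (d * D)"
  unfolding poly_eval_def
proof (rule bounded_polys_sum)
  fix m assume m: "m \<in> Poly_Mapping.keys f"
  then have deg: "(\<Sum>i\<in>Poly_Mapping.keys m. Poly_Mapping.lookup m i) = d" and I: "Poly_Mapping.keys m \<subseteq> I"
    using f by (auto simp: forms_def homogeneous_def mono_degree_def poly_vars_def)
  have "(\<lambda>u. mono_eval m (\<phi> u)) \<in> bounded_polys k (\<Sum>i\<in>Poly_Mapping.keys m. Poly_Mapping.lookup m i * D)"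
    unfolding mono_eval_def by (intro bounded_polys_prod bounded_polys_power) (use I \<phi> in auto)
  then have "(\<lambda>u. mono_eval m (\<phi> u)) \<in> bounded_polys k (d * D)"
    unfolding sum_distrib_right[symmetric] deg .
  from bounded_polys_mult[OF bounded_polys_const[of _ k 0] this]
  show "(\<lambda>u. Poly_Mapping.lookup f m * mono_eval m (\<phi> u)) \<in> bounded_polys k (d * D)" by simp
qed

text \<open>By density, pulling back along \<open>\<phi>\<close> is injective, and it lands in the
  polynomials in \<open>k\<close> parameters with exponents at most \<open>d * D\<close>.\<close>

lemma hilbert_upper_bound:
  assumes \<phi>: "\<And>i. i \<in> I \<Longrightarrow> (\<lambda>u. \<phi> u i) \<in> bounded_polys k D"
    and dense: "\<And>f. f \<in> forms I d \<Longrightarrow> (\<forall>u. poly_eval f (\<phi> u) = 0) \<Longrightarrow> \<forall>v\<in>A. poly_eval f v = 0"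
    and r: "rank_ge (form_funs I A d) r"
  shows "r \<le> Suc (d * D) ^ k"
proof -
  \<comment> \<open>\<open>\<phi> u\<close> need not lie in \<open>A\<close>, so the image is
    adjoined to the domain of the functions.\<close>
  let ?B = "A \<union> range \<phi>"
  define pull :: "(('a \<Rightarrow> complex) \<Rightarrow> complex) \<Rightarrow> (nat \<Rightarrow> complex) \<Rightarrow> complex" where "pull w = (\<lambda>u. w (\<phi> u))" for w
  have pull: "flinear pull" by (rule flinearI) (auto simp: pull_def)
  have "rank_ge (form_funs I ?B d) r" by (rule rank_form_funs_mono[OF _ r]) simp
  then have "rank_ge (pull ` form_funs I ?B d) r"
  proof (rule rank_ge_injective_image[OF pull, rotated])
    fix x assume "x \<in> fs.span (form_funs I ?B d)" "pull x = 0"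
    then obtain f where f: "f \<in> forms I d" "x = form_fun ?B f"
      unfolding span_form_funs by (auto simp: form_funs_def)
    have "pull x u = 0" for u using \<open>pull x = 0\<close> by simp
    then have 0: "\<forall>u. poly_eval f (\<phi> u) = 0"
      by (simp add: f(2) pull_def form_fun_def)
    with dense[OF f(1) 0] show "x = 0" unfolding f(2) form_fun_eq_0 by auto
  qed
  moreover have "pull ` form_funs I ?B d \<subseteq> bounded_polys k (d * D)"
  proof
    fix x assume "x \<in> pull ` form_funs I ?B d"
    then obtain f where f: "f \<in> forms I d" "x = pull (form_fun ?B f)" by (auto simp: form_funs_def)
    have "x = (\<lambda>u. poly_eval f (\<phi> u))" by (auto simp: f(2) pull_def form_fun_def)
    then show "x \<in> bounded_polys k (d * D)" using form_pullback_bounded[OF f(1) \<phi>] by simp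
  qed
  ultimately have "r \<le> card ((\<lambda>\<gamma> (u :: nat \<Rightarrow> complex). \<Prod>i<k. u i ^ \<gamma> i) ` bounded_exps k (d * D))"
    unfolding bounded_polys_def by (rule rank_ge_span_bound) simp
  also have "\<dots> \<le> card (bounded_exps k (d * D))" by (rule card_image_le) simp
  finally show ?thesis by (simp add: card_bounded_exps)
qed

lemma power_growth_contradiction:
  fixes C k j :: nat
  assumes "\<And>t. Suc t ^ j \<le> Suc (C * t) ^ k"
  shows "j \<le> k"
proof (rule ccontr)
  assume "\<not> j \<le> k"
  then have j: "Suc k \<le> j" by simp
  \<comment> \<open>Chosen so that the factor \<open>Suc C ^ k\<close> on the right becomes
    \<open>t\<close>, just below \<open>Suc t\<close>.\<close>
  define t where "t = Suc C ^ k"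
  have "Suc t * Suc t ^ k \<le> Suc t ^ j"
    unfolding power_Suc[symmetric] by (rule power_increasing[OF j]) simp
  also have "\<dots> \<le> Suc (C * t) ^ k" by (rule assms)
  also have "\<dots> \<le> (Suc C * Suc t) ^ k" by (rule power_mono) auto
  also have "\<dots> = t * Suc t ^ k" by (simp only: power_mult_distrib t_def[symmetric])
  finally have "Suc t * Suc t ^ k \<le> t * Suc t ^ k" .
  then have "Suc t \<le> t" by (rule mult_le_cancel2[THEN iffD1, THEN mp]) simp
  then show False by simp
qed

text \<open>A chain of length \<open>K\<close> forces growth of order at least \<open>K\<close>,
  while \<open>k\<close> parameters allow order \<open>k\<close> at most.\<close>

lemma chain_length_le:
  assumes \<phi>: "\<And>i. i \<in> I \<Longrightarrow> (\<lambda>u. \<phi> u i) \<in> bounded_polys k D"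
    and dense: "\<And>f d. f \<in> forms I d \<Longrightarrow> (\<forall>u. poly_eval f (\<phi> u) = 0) \<Longrightarrow> \<forall>v\<in>\<Union>C. poly_eval f v = 0"
    and Z: "chain I K Z" "Z K \<subseteq> C"
  shows "K \<le> k"
proof -
  obtain E where "E > 0"
    "\<forall>E'>0. E dvd E' \<longrightarrow> (\<forall>q. rank_ge (form_funs I (\<Union>(Z K)) (E' * q)) ((q + K) choose K))"
    using chain_hilbert_growth[OF Z(1)] by (elim exE conjE)
  then have E: "rank_ge (form_funs I (\<Union>(Z K)) (E * q)) ((q + K) choose K)" for q
    using dvd_refl by blast
  have "Suc t ^ K \<le> Suc (E * K * D * t) ^ k" for t
  proof -
    \<comment> \<open>At \<open>q = K * t\<close> the binomial coefficient is bounded below by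
      \<open>((K * t + K) / K) ^ K\<close>, a plain power.\<close>
    have "Suc t ^ K \<le> (K * t + K) choose K"
    proof (cases "K = 0")
      case False
      have "(real (K * t + K) / real K) ^ K \<le> real ((K * t + K) choose K)"
        by (rule binomial_ge_n_over_k_pow_k) simp
      moreover have "real (K * t + K) / real K = real (Suc t)"
        using False by (simp add: field_simps)
      ultimately have "real (Suc t ^ K) \<le> real ((K * t + K) choose K)" by simp
      then show ?thesis by (simp only: of_nat_le_iff)
    qed simp
    also have "\<dots> \<le> Suc (E * (K * t) * D) ^ k"
    proof (rule hilbert_upper_bound[where \<phi> = \<phi> and A = "\<Union>C"])
      show "rank_ge (form_funs I (\<Union>C) (E * (K * t))) ((K * t + K) choose K)"
        by (rule rank_form_funs_mono[OF _ E]) (use Z(2) in blast)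
    qed (use \<phi> in blast, rule dense)
    finally show ?thesis by (simp add: mult_ac)
  qed
  then show ?thesis by (rule power_growth_contradiction)
qed

section \<open>Closures of parametrised sets\<close>

definition param_image :: "((nat \<Rightarrow> complex) \<Rightarrow> 'i \<Rightarrow> complex) \<Rightarrow> ('i \<Rightarrow> complex) set set" where
  "param_image \<phi> = {proj_point (\<phi> u) | u. \<phi> u \<noteq> (\<lambda>_. 0)}"

lemma param_image_subset: "(\<And>u. \<phi> u \<in> coord_space I) \<Longrightarrow> param_image \<phi> \<subseteq> proj_space I"
  by (auto simp: param_image_def proj_space_def)

lemma closure_vanish:
  assumes S: "S \<subseteq> proj_space I" and f: "f \<in> forms I d" and 0: "\<And>v. proj_point v \<in> S \<Longrightarrow> poly_eval f v = 0"
  shows "\<forall>v\<in>\<Union>(zariski I closure_of S). poly_eval f v = 0"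
proof -
  have "S \<subseteq> zero_locus I {f}"
  proof
    fix p assume p: "p \<in> S"
    then obtain v where v: "p = proj_point v" using S by (auto simp: proj_space_def)
    then show "p \<in> zero_locus I {f}"
      using zero_locus_singleton_rep[OF forms_hom_polys[OF f], of v] 0[of v] p S by auto
  qed
  moreover have "closedin (zariski I) (zero_locus I {f})"
    using forms_hom_polys[OF f] by (auto simp: closedin_zariski)
  ultimately have "zariski I closure_of S \<subseteq> zero_locus I {f}" by (rule closure_of_minimal)
  then show ?thesis by (auto simp: zero_locus_def)
qed

lemma proj_point_eqD:
  assumes "proj_point v = proj_point w" "f \<in> forms I d" "poly_eval f w = 0"
  shows "poly_eval f v = 0"
  using assms hom_polys_nonzero_rep[OF forms_hom_polys[OF assms(2)], of v w] proj_point_self[of v] by auto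

text \<open>If neither \<open>A\<close> nor \<open>B\<close> contained the closure, a form vanishing
  on \<open>A\<close> and one vanishing on \<open>B\<close> would be nonzero at a common parameter,
  whose image then lies in neither set.\<close>

lemma irreducible_param_closure:
  assumes poly: "\<And>i. (\<lambda>u. \<phi> u i) \<in> polyfn" and coord: "\<And>u. \<phi> u \<in> coord_space I"
    and ne: "\<phi> u0 \<noteq> (\<lambda>_. 0)"
  shows "irreducible_in (zariski I) (zariski I closure_of (param_image \<phi>))"
  unfolding irreducible_in_def
proof (intro conjI allI impI)
  let ?Z = "zariski I closure_of (param_image \<phi>)"
  have sub: "param_image \<phi> \<subseteq> ?Z"
    using param_image_subset[OF coord] by (intro closure_of_subset) (simp add: topspace_zariski)
  moreover have "param_image \<phi> \<noteq> {}" using ne by (auto simp: param_image_def)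
  ultimately show "?Z \<noteq> {}" by blast
  show "?Z \<subseteq> topspace (zariski I)" by (rule closure_of_subset_topspace)
  fix A B assume A: "closedin (zariski I) A" and B: "closedin (zariski I) B" and AB: "?Z \<subseteq> A \<union> B"
  have key: "\<exists>f u. f \<in> hom_polys I \<and> (\<forall>v. proj_point v \<in> A \<longrightarrow> poly_eval f v = 0) \<and> poly_eval f (\<phi> u) \<noteq> 0"
    if A: "closedin (zariski I) A" and n: "\<not> ?Z \<subseteq> A" for A
  proof -
    have "\<not> param_image \<phi> \<subseteq> A" using n closure_of_minimal[OF _ A] by blast
    then obtain u where u: "\<phi> u \<noteq> (\<lambda>_. 0)" "proj_point (\<phi> u) \<notin> A" by (auto simp: param_image_def)
    then have "proj_point (\<phi> u) \<in> proj_space I" using coord by (auto simp: proj_space_def)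
    from separating_form[OF A this u(2)] obtain f d v where f: "f \<in> forms I d" "\<forall>w\<in>\<Union>A. poly_eval f w = 0"
      "v \<in> proj_point (\<phi> u)" "poly_eval f v \<noteq> 0" by metis
    then have "poly_eval f (\<phi> u) \<noteq> 0"
      using hom_polys_nonzero_rep[OF forms_hom_polys[OF f(1)]] by blast
    moreover have "poly_eval f v = 0" if "proj_point v \<in> A" for v
      using f(2) that proj_point_self[of v] by blast
    ultimately show ?thesis using forms_hom_polys[OF f(1)] by blast
  qed
  show "?Z \<subseteq> A \<or> ?Z \<subseteq> B"
  proof (rule ccontr)
    assume "\<not> ?thesis"
    then obtain f g u1 u2 where f: "f \<in> hom_polys I" "\<And>v. proj_point v \<in> A \<Longrightarrow> poly_eval f v = 0" "poly_eval f (\<phi> u1) \<noteq> 0"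
      and g: "g \<in> hom_polys I" "\<And>v. proj_point v \<in> B \<Longrightarrow> poly_eval g v = 0" "poly_eval g (\<phi> u2) \<noteq> 0"
      using key[OF A] key[OF B] by blast
    obtain i where i: "\<phi> u0 i \<noteq> 0" using ne by auto
    have gen: "generic (\<lambda>u. poly_eval h (\<phi> u) \<noteq> 0)" if "poly_eval h (\<phi> u) \<noteq> 0" for h u
    proof -
      have "(\<lambda>u. poly_eval h (\<phi> u)) \<in> polyfn" by (rule polyfn_comp[OF polyfn_poly_eval poly])
      from generic_nonzero[OF this that] show ?thesis .
    qed
    have "generic (\<lambda>u. \<phi> u i \<noteq> 0)"
      using generic_nonzero[of "\<lambda>u. \<phi> u i" u0] poly i by blast
    from generic_ex[OF generic_conj[OF gen[OF f(3)] generic_conj[OF gen[OF g(3)] this]]]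
    obtain u where u: "poly_eval f (\<phi> u) \<noteq> 0" "poly_eval g (\<phi> u) \<noteq> 0" "\<phi> u i \<noteq> 0"
      by (elim exE conjE)
    then have "proj_point (\<phi> u) \<in> param_image \<phi>" by (auto simp: param_image_def)
    then show False using sub AB f(2) g(2) u(1,2) by blast
  qed
qed

definition restr :: "nat \<Rightarrow> (nat \<Rightarrow> complex) \<Rightarrow> nat \<Rightarrow> complex" where
  "restr i u = (\<lambda>l. if l < i then u l else 0)"

lemma bounded_polys_restr:
  assumes "f \<in> bounded_polys r D" "i \<le> r"
  shows "(\<lambda>u. f (restr i u)) \<in> bounded_polys i D"
proof -
  define T where "T f = (\<lambda>u. f (restr i u))" for f :: "(nat \<Rightarrow> complex) \<Rightarrow> complex"
  have T: "flinear T" by (rule flinearI) (auto simp: T_def)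
  have "T (\<lambda>u. \<Prod>l<r. u l ^ \<gamma> l) \<in> bounded_polys i D" if \<gamma>: "\<gamma> \<in> bounded_exps r D" for \<gamma>
  proof (cases "\<exists>l. i \<le> l \<and> l < r \<and> \<gamma> l \<noteq> 0")
    case True
    then obtain l where "i \<le> l" "l < r" "\<gamma> l \<noteq> 0" by blast
    then have "(\<Prod>l<r. restr i u l ^ \<gamma> l) = 0" for u
      by (intro prod_zero bexI[of _ l]) (auto simp: restr_def)
    then have "T (\<lambda>u. \<Prod>l<r. u l ^ \<gamma> l) = (\<lambda>_. 0)"
      unfolding T_def by (intro ext)
    then show ?thesis using bounded_polys_const[of 0] by (simp only:)
  next
    case False
    have "(\<Prod>l<r. restr i u l ^ \<gamma> l) = (\<Prod>l<i. u l ^ \<gamma> l)" for u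
      by (rule prod.mono_neutral_cong_right) (use False assms(2) in \<open>auto simp: restr_def\<close>)
    moreover have "\<gamma> \<in> bounded_exps i D"
    proof -
      have "\<gamma> l = 0" if "\<not> l < i" for l
        using False that \<gamma> by (cases "l < r") (auto simp: bounded_exps_def)
      then show ?thesis using \<gamma> assms(2) by (auto simp: bounded_exps_def)
    qed
    ultimately show ?thesis by (auto simp: T_def bounded_polys_def intro!: fs.span_base)
  qed
  then have "T ` (\<lambda>\<gamma> u. \<Prod>l<r. u l ^ \<gamma> l) ` bounded_exps r D \<subseteq> bounded_polys i D" by auto
  from fs.span_minimal[OF this] have "T ` bounded_polys r D \<subseteq> bounded_polys i D"
    unfolding bounded_polys_def fs.linear_span_image[OF T, symmetric] by simp
  then show ?thesis using assms(1) by (auto simp: T_def)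
qed

text \<open>Forms restricted to the image of a parametrisation with injective derivative: powers of the
  linear forms dual to \<open>\<phi> 0, G 0, \<dots>, G (i - 1)\<close> are independent, as their terms of lowest order
  at the origin are.\<close>

lemma hilbert_lower_bound:
  assumes fin: "finite I" and coord: "\<And>u. \<phi> u \<in> coord_space I"
    and G: "\<And>l. l < r \<Longrightarrow> G l \<in> coord_space I"
    and der: "\<And>x i. ((\<lambda>t. \<phi> (\<lambda>l. t * x l) i) has_field_derivative (\<Sum>l<r. x l * G l i)) (at 0)"
    and ind: "indep_family {..r} (\<lambda>j. case j of 0 \<Rightarrow> \<phi> (\<lambda>_. 0) | Suc l \<Rightarrow> G l)"
    and i: "i \<le> r"
    and A: "\<And>u. \<phi> (restr i u) \<noteq> (\<lambda>_. 0) \<Longrightarrow> \<phi> (restr i u) \<in> A"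
  shows "rank_ge (form_funs I A (i * q)) (Suc q ^ i)"
proof -
  let ?w = "\<lambda>j. case j of 0 \<Rightarrow> \<phi> (\<lambda>_. 0) | Suc l \<Rightarrow> G l"
  let ?B = "?w ` {..r}"
  have inj: "inj_on ?w {..r}" and B: "fs.independent ?B"
    using ind by (auto simp: indep_family_iff)
  have "\<exists>l. \<forall>j'\<le>r. (\<Sum>\<kappa>\<in>I. l \<kappa> * ?w j' \<kappa>) = (if j' = j then 1 else 0)" if j: "j \<le> r" for j
  proof -
    obtain g :: "('a \<Rightarrow> complex) \<Rightarrow> unit \<Rightarrow> complex" where g: "flinear g"
      "\<And>x. x \<in> ?B \<Longrightarrow> g x = (\<lambda>_. if x = ?w j then 1 else 0)"
      using fs.linear_independent_extend[OF B, of "\<lambda>x _. if x = ?w j then 1 else 0"] by metis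
    have "(\<Sum>\<kappa>\<in>I. g (unit_vec \<kappa>) () * ?w j' \<kappa>) = (if j' = j then 1 else 0)" if j': "j' \<le> r" for j'
    proof -
      have "?w j' \<in> coord_space I" using coord G j' by (cases j') auto
      then have e: "?w j' = (\<Sum>\<kappa>\<in>I. fscale (?w j' \<kappa>) (unit_vec \<kappa>))"
        using fin by (auto simp: fun_eq_iff sum_fun_apply unit_vec_def coord_space_def if_distrib cong: if_cong)
      have "g (?w j') = (\<Sum>\<kappa>\<in>I. fscale (?w j' \<kappa>) (g (unit_vec \<kappa>)))"
        by (rule trans[OF arg_cong[OF e, of g] flinear_family[OF g(1)]])
      from fun_cong[OF this, of "()"] have "g (?w j') () = (\<Sum>\<kappa>\<in>I. ?w j' \<kappa> * g (unit_vec \<kappa>) ())"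
        by (simp only: sum_fun_apply fscale_apply)
      moreover have "g (?w j') () = (if j' = j then 1 else 0)"
        using g(2)[of "?w j'"] j j' inj_onD[OF inj, of j' j] by auto
      ultimately show ?thesis by (simp add: mult.commute)
    qed
    then show ?thesis by (intro exI[of _ "\<lambda>\<kappa>. g (unit_vec \<kappa>) ()"]) simp
  qed
  then have "\<forall>j\<in>{..r}. \<exists>l. \<forall>j'\<le>r. (\<Sum>\<kappa>\<in>I. l \<kappa> * ?w j' \<kappa>) = (if j' = j then 1 else 0)" by simp
  from bchoice[OF this] obtain l where l: "\<And>j j'. j \<le> r \<Longrightarrow> j' \<le> r \<Longrightarrow> (\<Sum>\<kappa>\<in>I. l j \<kappa> * ?w j' \<kappa>) = (if j' = j then 1 else 0)"
    by auto
  define L where "L j = linear_form I (l j)" for j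
  define \<psi> where "\<psi> j u = poly_eval (L j) (\<phi> u)" for j u
  have \<psi>: "\<psi> j u = (\<Sum>\<kappa>\<in>I. l j \<kappa> * \<phi> u \<kappa>)" for j u
    by (simp add: \<psi>_def L_def poly_eval_linear_form)
  have \<psi>0: "\<psi> j (\<lambda>_. 0) = (if j = 0 then 1 else 0)" if "j \<le> r" for j
    using l[OF that, of 0] by (simp add: \<psi>)
  have \<psi>d: "((\<lambda>t. \<psi> j (\<lambda>m. t * x m)) has_field_derivative (if j = 0 then 0 else x (j - 1))) (at 0)" if j: "j \<le> r" for j x
  proof -
    have "((\<lambda>t. \<psi> j (\<lambda>m. t * x m)) has_field_derivative (\<Sum>\<kappa>\<in>I. l j \<kappa> * (\<Sum>m<r. x m * G m \<kappa>))) (at 0)"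
      unfolding \<psi> by (intro DERIV_sum DERIV_cmult der)
    also have "(\<Sum>\<kappa>\<in>I. l j \<kappa> * (\<Sum>m<r. x m * G m \<kappa>)) = (\<Sum>m<r. x m * (\<Sum>\<kappa>\<in>I. l j \<kappa> * G m \<kappa>))"
      unfolding sum_distrib_left by (subst sum.swap) (simp add: mult_ac)
    also have "\<dots> = (\<Sum>m<r. if m = j - 1 then (if j = 0 then 0 else x m) else 0)"
    proof (rule sum.cong)
      fix m assume "m \<in> {..<r}"
      then show "x m * (\<Sum>\<kappa>\<in>I. l j \<kappa> * G m \<kappa>) = (if m = j - 1 then (if j = 0 then 0 else x m) else 0)"
        using l[OF j, of "Suc m"] by (cases j) auto
    qed simp
    also have "\<dots> = (if j = 0 then 0 else x (j - 1))" using j by auto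
    finally show ?thesis .
  qed
  define \<sigma> where "\<sigma> \<gamma> = (\<Sum>m<i. \<gamma> m)" for \<gamma> :: "nat \<Rightarrow> nat"
  let ?\<Gamma> = "bounded_exps i q"
  have \<sigma>: "\<sigma> \<gamma> \<le> i * q" if "\<gamma> \<in> ?\<Gamma>" for \<gamma>
    using sum_bounded_above[of "{..<i}" \<gamma> q] that by (auto simp: \<sigma>_def bounded_exps_def)
  \<comment> \<open>\<open>L 0\<close> has value 1 at the base point, so its power fills up the
    degree to \<open>i * q\<close> without affecting the term of lowest order, which is the monomial
    with exponents \<open>\<gamma>\<close>.\<close>
  define F where "F \<gamma> = L 0 ^ (i * q - \<sigma> \<gamma>) * (\<Prod>m<i. L (Suc m) ^ \<gamma> m)" for \<gamma>
  have F: "F \<gamma> \<in> forms I (i * q)" if "\<gamma> \<in> ?\<Gamma>" for \<gamma>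
  proof -
    have "F \<gamma> \<in> forms I ((i * q - \<sigma> \<gamma>) * 1 + (\<Sum>m<i. \<gamma> m * 1))"
      unfolding F_def L_def by (intro forms_mult forms_power forms_prod linear_form_forms) simp
    then show ?thesis using \<sigma>[OF that] by (simp add: \<sigma>_def)
  qed
  have F_eval: "poly_eval (F \<gamma>) (\<phi> u) = \<psi> 0 u ^ (i * q - \<sigma> \<gamma>) * (\<Prod>m<i. \<psi> (Suc m) u ^ \<gamma> m)" for \<gamma> u
    by (simp add: F_def \<psi>_def poly_eval_mult poly_eval_power poly_eval_prod)
  have "indep_family ?\<Gamma> (\<lambda>\<gamma>. form_fun A (F \<gamma>))"
    unfolding indep_family_def
  proof (intro allI impI)
    fix c assume c: "(\<Sum>\<gamma>\<in>?\<Gamma>. fscale (c \<gamma>) (form_fun A (F \<gamma>))) = 0"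
    have van: "(\<Sum>\<gamma>\<in>?\<Gamma>. c \<gamma> * poly_eval (F \<gamma>) v) = 0" if "v \<in> A" for v
      using fun_cong[OF c, of v] that by (simp add: sum_fun_apply form_fun_def)
    show "\<forall>\<gamma>\<in>?\<Gamma>. c \<gamma> = 0"
    proof (rule ccontr)
      assume "\<not> ?thesis"
      then obtain \<gamma>0 where "\<gamma>0 \<in> ?\<Gamma>" "c \<gamma>0 \<noteq> 0" by blast
      then have ex: "\<exists>k. \<exists>\<gamma>\<in>?\<Gamma>. c \<gamma> \<noteq> 0 \<and> \<sigma> \<gamma> = k" by blast
      define k where "k = (LEAST k. \<exists>\<gamma>\<in>?\<Gamma>. c \<gamma> \<noteq> 0 \<and> \<sigma> \<gamma> = k)"
      obtain \<gamma>1 where \<gamma>1: "\<gamma>1 \<in> ?\<Gamma>" "c \<gamma>1 \<noteq> 0" "\<sigma> \<gamma>1 = k"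
        using LeastI_ex[OF ex] unfolding k_def by blast
      have least: "k \<le> \<sigma> \<gamma>" if "\<gamma> \<in> ?\<Gamma>" "c \<gamma> \<noteq> 0" for \<gamma>
        unfolding k_def by (rule Least_le) (use that in blast)
      \<comment> \<open>The factor \<open>0 ^ (\<sigma> \<gamma> - k)\<close> is 1 for orders up to
        \<open>k\<close> and 0 above; below \<open>k\<close> the coefficient
        \<open>c \<gamma>\<close> is 0, so exactly the terms of lowest order remain.\<close>
      have "(\<Sum>\<gamma>\<in>?\<Gamma>. (c \<gamma> * 0 ^ (\<sigma> \<gamma> - k)) * (\<Prod>m<i. x m ^ \<gamma> m)) = 0" for x :: "nat \<Rightarrow> complex"
      proof -
        let ?u = "\<lambda>t m. t * restr i x m"
        have u: "restr i (?u t) = ?u t" for t by (auto simp: restr_def)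
        have lim0: "((\<lambda>t. \<psi> 0 (?u t)) \<longlongrightarrow> 1) (at 0)"
          using DERIV_isCont[OF \<psi>d[of 0 "restr i x"]] \<psi>0[of 0] by (simp add: isCont_def)
        have lim: "((\<lambda>t. \<psi> (Suc m) (?u t) / t) \<longlongrightarrow> x m) (at 0)" if "m < i" for m
          using \<psi>d[of "Suc m" "restr i x"] \<psi>0[of "Suc m"] that i
          by (simp add: DERIV_def restr_def)
        \<comment> \<open>The relation along the ray through \<open>x\<close>, divided by
          \<open>t ^ k\<close>. As \<open>t\<close> tends to 0, the terms of higher order vanish and
          those of order \<open>k\<close> become monomials in \<open>x\<close>.\<close>
        let ?Q = "\<lambda>t. \<Sum>\<gamma>\<in>?\<Gamma>. c \<gamma> * t ^ (\<sigma> \<gamma> - k) * (\<psi> 0 (?u t) ^ (i * q - \<sigma> \<gamma>) * (\<Prod>m<i. (\<psi> (Suc m) (?u t) / t) ^ \<gamma> m))"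
        have "(?Q \<longlongrightarrow> (\<Sum>\<gamma>\<in>?\<Gamma>. c \<gamma> * 0 ^ (\<sigma> \<gamma> - k) * (1 ^ (i * q - \<sigma> \<gamma>) * (\<Prod>m<i. x m ^ \<gamma> m)))) (at 0)"
          by (intro tendsto_intros lim0 lim) auto
        moreover have "eventually (\<lambda>t. ?Q t = 0) (at 0)"
        proof -
          have "eventually (\<lambda>t. \<psi> 0 (?u t) \<noteq> 0) (at 0)"
            by (rule tendsto_imp_eventually_ne[OF lim0]) simp
          then have "eventually (\<lambda>t. \<psi> 0 (?u t) \<noteq> 0 \<and> t \<noteq> 0) (at 0)"
            by (auto simp: eventually_at_filter elim: eventually_mono)
          then show ?thesis
          proof (rule eventually_mono)
            fix t :: complex assume t: "\<psi> 0 (?u t) \<noteq> 0 \<and> t \<noteq> 0"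
            then have "\<phi> (?u t) \<noteq> (\<lambda>_. 0)" by (auto simp: \<psi>)
            then have "\<phi> (?u t) \<in> A" using A[of "?u t"] unfolding u by simp
            from van[OF this] have "(\<Sum>\<gamma>\<in>?\<Gamma>. c \<gamma> * poly_eval (F \<gamma>) (\<phi> (?u t))) = 0" .
            also have "(\<Sum>\<gamma>\<in>?\<Gamma>. c \<gamma> * poly_eval (F \<gamma>) (\<phi> (?u t))) = (\<Sum>\<gamma>\<in>?\<Gamma>. t ^ k *
              (c \<gamma> * t ^ (\<sigma> \<gamma> - k) * (\<psi> 0 (?u t) ^ (i * q - \<sigma> \<gamma>) * (\<Prod>m<i. (\<psi> (Suc m) (?u t) / t) ^ \<gamma> m))))"
            proof (rule sum.cong)
              fix \<gamma> assume \<gamma>: "\<gamma> \<in> ?\<Gamma>"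
              show "c \<gamma> * poly_eval (F \<gamma>) (\<phi> (?u t)) = t ^ k *
              (c \<gamma> * t ^ (\<sigma> \<gamma> - k) * (\<psi> 0 (?u t) ^ (i * q - \<sigma> \<gamma>) * (\<Prod>m<i. (\<psi> (Suc m) (?u t) / t) ^ \<gamma> m)))"
              proof (cases "c \<gamma> = 0")
                case False
                let ?R = "\<Prod>m<i. (\<psi> (Suc m) (?u t) / t) ^ \<gamma> m"
                have "?R = (\<Prod>m<i. \<psi> (Suc m) (?u t) ^ \<gamma> m) / t ^ \<sigma> \<gamma>"
                  by (simp add: power_divide prod_dividef power_sum \<sigma>_def)
                then have "t ^ \<sigma> \<gamma> * ?R = (\<Prod>m<i. \<psi> (Suc m) (?u t) ^ \<gamma> m)"
                  using t by (simp only:) simp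
                moreover have "t ^ \<sigma> \<gamma> = t ^ k * t ^ (\<sigma> \<gamma> - k)"
                  using least[OF \<gamma> False] by (simp flip: power_add)
                ultimately have R: "(\<Prod>m<i. \<psi> (Suc m) (?u t) ^ \<gamma> m) = t ^ k * t ^ (\<sigma> \<gamma> - k) * ?R"
                  by (simp only:)
                show ?thesis unfolding F_eval R by (simp only: mult_ac)
              qed simp
            qed simp
            finally show "?Q t = 0" using t by (simp flip: sum_distrib_left)
          qed
        qed
        ultimately have "((\<lambda>t. 0) \<longlongrightarrow> (\<Sum>\<gamma>\<in>?\<Gamma>. c \<gamma> * 0 ^ (\<sigma> \<gamma> - k) * (1 ^ (i * q - \<sigma> \<gamma>) * (\<Prod>m<i. x m ^ \<gamma> m)))) (at (0::complex))"
          by (rule Lim_transform_eventually)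
        then have "(\<Sum>\<gamma>\<in>?\<Gamma>. c \<gamma> * 0 ^ (\<sigma> \<gamma> - k) * (1 ^ (i * q - \<sigma> \<gamma>) * (\<Prod>m<i. x m ^ \<gamma> m))) = 0"
          by (rule LIM_unique[OF _ tendsto_const])
        then show ?thesis by simp
      qed
      then have "\<forall>\<gamma>\<in>?\<Gamma>. c \<gamma> * 0 ^ (\<sigma> \<gamma> - k) = 0"
        by (rule monomials_independent[OF finite_bounded_exps, rotated]) (simp add: bounded_exps_def)
      then show False using \<gamma>1 by auto
    qed
  qed
  then have "rank_ge (form_funs I A (i * q)) (card ?\<Gamma>)"
    by (rule rank_geI[rotated]) (use F in \<open>auto simp: form_funs_def intro: fs.span_base\<close>)
  then show ?thesis by (simp add: card_bounded_exps)
qed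

text \<open>The members are closures of images of coordinate subspaces of the parameter space. The
  Hilbert function of the \<open>i\<close>-th grows with order at most \<open>i\<close>, by the
  number of parameters, and at least \<open>i\<close>, by injectivity of the derivative; so
  consecutive members differ.\<close>

lemma chain_exists:
  assumes fin: "finite I" and coord: "\<And>u. \<phi> u \<in> coord_space I"
    and poly: "\<And>i. (\<lambda>u. \<phi> u i) \<in> polyfn" and bd: "\<And>i. i \<in> I \<Longrightarrow> (\<lambda>u. \<phi> u i) \<in> bounded_polys r D"
    and G: "\<And>l. l < r \<Longrightarrow> G l \<in> coord_space I"
    and der: "\<And>x i. ((\<lambda>t. \<phi> (\<lambda>l. t * x l) i) has_field_derivative (\<Sum>l<r. x l * G l i)) (at 0)"
    and ind: "indep_family {..r} (\<lambda>j. case j of 0 \<Rightarrow> \<phi> (\<lambda>_. 0) | Suc l \<Rightarrow> G l)"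
  shows "\<exists>Z. chain I r Z \<and> Z r \<subseteq> zariski I closure_of (param_image \<phi>)"
proof -
  define \<phi>' where "\<phi>' i = (\<lambda>u. \<phi> (restr i u))" for i
  define Z where "Z i = zariski I closure_of (param_image (\<phi>' i))" for i
  have sub: "param_image (\<phi>' i) \<subseteq> proj_space I" for i
    by (rule param_image_subset) (simp add: \<phi>'_def coord)
  have restr_restr: "restr (Suc i) (restr i u) = restr i u" for i u
    by (auto simp: restr_def)
  have mono: "param_image (\<phi>' i) \<subseteq> param_image (\<phi>' (Suc i))" for i
    unfolding param_image_def \<phi>'_def using restr_restr by (smt (verit) Collect_mono)
  have n0: "\<phi> (\<lambda>_. 0) \<noteq> (\<lambda>_. 0)"
  proof
    assume "\<phi> (\<lambda>_. 0) = (\<lambda>_. 0)"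
    then have "(\<Sum>j\<le>r. fscale (if j = 0 then 1 else 0) (case j of 0 \<Rightarrow> \<phi> (\<lambda>_. 0) | Suc l \<Rightarrow> G l)) = 0"
      by (intro sum.neutral) (auto simp: fun_eq_iff)
    from indep_familyD[OF ind this, of 0] show False by simp
  qed
  have "restr i (\<lambda>_. 0) = (\<lambda>_. 0)" for i by (simp add: restr_def)
  then have n0': "\<phi>' i (\<lambda>_. 0) \<noteq> (\<lambda>_. 0)" for i using n0 by (simp add: \<phi>'_def)
  have poly': "(\<lambda>u. \<phi>' i u j) \<in> polyfn" for i j
    unfolding \<phi>'_def
  proof (rule polyfn_comp[OF poly])
    show "(\<lambda>u. restr i u l) \<in> polyfn" for l by (cases "l < i") (auto simp: restr_def intro: polyfn_intros)
  qed
  have cl: "closedin (zariski I) (Z i)" for i by (simp add: Z_def)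
  have irr: "irreducible_in (zariski I) (Z i)" for i
    unfolding Z_def by (rule irreducible_param_closure[OF poly' _ n0']) (simp add: \<phi>'_def coord)
  have lower: "rank_ge (form_funs I (\<Union>(Z i)) (i * q)) (Suc q ^ i)" if "i \<le> r" for i q
  proof (rule hilbert_lower_bound[OF fin coord G der ind that])
    fix u assume "\<phi> (restr i u) \<noteq> (\<lambda>_. 0)"
    then have "proj_point (\<phi> (restr i u)) \<in> param_image (\<phi>' i)" by (auto simp: param_image_def \<phi>'_def)
    then have "proj_point (\<phi> (restr i u)) \<in> Z i"
      unfolding Z_def using closure_of_subset[of "param_image (\<phi>' i)" "zariski I"] sub[of i]
      by (auto simp: topspace_zariski)
    then show "\<phi> (restr i u) \<in> \<Union>(Z i)" using proj_point_self by blast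
  qed
  have upper: "m \<le> Suc (d * D) ^ i" if i: "i \<le> r" and m: "rank_ge (form_funs I (\<Union>(Z i)) d) m" for i d m
  proof (rule hilbert_upper_bound[OF _ _ m, where \<phi> = "\<phi>' i"])
    show "(\<lambda>u. \<phi>' i u j) \<in> bounded_polys i D" if "j \<in> I" for j
      unfolding \<phi>'_def using bounded_polys_restr[OF bd[OF that] i] .
    fix f assume f: "f \<in> forms I d" and 0: "\<forall>u. poly_eval f (\<phi>' i u) = 0"
    show "\<forall>v\<in>\<Union>(Z i). poly_eval f v = 0"
      unfolding Z_def
    proof (rule closure_vanish[OF sub f])
      fix v assume "proj_point v \<in> param_image (\<phi>' i)"
      then obtain u where "proj_point v = proj_point (\<phi>' i u)" by (auto simp: param_image_def)
      from proj_point_eqD[OF this f] 0 show "poly_eval f v = 0" by blast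
    qed
  qed
  have "Z i \<noteq> Z (Suc i)" if i: "i < r" for i
  proof
    assume eq: "Z i = Z (Suc i)"
    have "Suc t ^ Suc i \<le> Suc (Suc i * D * t) ^ i" for t
    proof -
      have "rank_ge (form_funs I (\<Union>(Z i)) (Suc i * t)) (Suc t ^ Suc i)"
        unfolding eq by (rule lower) (use i in simp)
      from upper[OF less_imp_le[OF i] this] show ?thesis
        by (simp only: mult.assoc mult.commute[of t])
    qed
    then have "Suc i \<le> i" by (rule power_growth_contradiction)
    then show False by simp
  qed
  moreover have "Z i \<subseteq> Z (Suc i)" for i unfolding Z_def by (rule closure_of_mono[OF mono])
  ultimately have "chain I r Z" using cl irr by (auto simp: chain_def)
  moreover have "Z r \<subseteq> zariski I closure_of (param_image \<phi>)"
    unfolding Z_def by (rule closure_of_mono) (auto simp: param_image_def \<phi>'_def)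
  ultimately show ?thesis by blast
qed

section \<open>Chains and the dimension of closed subspaces\<close>

lemma irreducible_in_subtopology:
  assumes "closedin X S" "Z \<subseteq> S"
  shows "irreducible_in (subtopology X S) Z \<longleftrightarrow> irreducible_in X Z"
proof -
  have S: "S \<subseteq> topspace X" using assms(1) closedin_subset by blast
  have sub: "closedin (subtopology X S) A \<longleftrightarrow> closedin X A \<and> A \<subseteq> S" for A
    using closedin_closed_subtopology[OF assms(1)] .
  have "(\<forall>A B. closedin (subtopology X S) A \<longrightarrow> closedin (subtopology X S) B \<longrightarrow> Z \<subseteq> A \<union> B \<longrightarrow> Z \<subseteq> A \<or> Z \<subseteq> B)
    \<longleftrightarrow> (\<forall>A B. closedin X A \<longrightarrow> closedin X B \<longrightarrow> Z \<subseteq> A \<union> B \<longrightarrow> Z \<subseteq> A \<or> Z \<subseteq> B)" (is "?L \<longleftrightarrow> ?R")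
  proof
    assume L: ?L
    show ?R
    proof (intro allI impI)
      fix A B assume "closedin X A" "closedin X B" "Z \<subseteq> A \<union> B"
      then have "closedin (subtopology X S) (A \<inter> S)" "closedin (subtopology X S) (B \<inter> S)"
        "Z \<subseteq> A \<inter> S \<union> B \<inter> S"
        using assms by (auto simp: sub)
      then have "Z \<subseteq> A \<inter> S \<or> Z \<subseteq> B \<inter> S" using L by blast
      then show "Z \<subseteq> A \<or> Z \<subseteq> B" by blast
    qed
  next
    assume ?R
    then show ?L unfolding sub by blast
  qed
  then show ?thesis
    using assms(2) S unfolding irreducible_in_def by auto
qed

lemma chain_mono: "chain I k Z \<Longrightarrow> i \<le> j \<Longrightarrow> j \<le> k \<Longrightarrow> Z i \<subseteq> Z j"
proof (induction j)
  case (Suc j)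
  show ?case
  proof (cases "i = Suc j")
    case False
    then have "Z i \<subseteq> Z j" using Suc by simp
    moreover have "Z j \<subset> Z (Suc j)" using Suc.prems by (auto simp: chain_def)
    ultimately show ?thesis by blast
  qed simp
qed simp

lemma top_dim_chains:
  assumes S: "closedin (zariski I) S"
  shows "top_dim (subtopology (zariski I) S) = Sup {enat k | k. \<exists>Z. chain I k Z \<and> Z k \<subseteq> S}"
proof -
  have "(\<forall>i\<le>k. closedin (subtopology (zariski I) S) (Z i) \<and> irreducible_in (subtopology (zariski I) S) (Z i)) \<and>
      (\<forall>i<k. Z i \<subset> Z (Suc i)) \<longleftrightarrow> chain I k Z \<and> Z k \<subseteq> S" (is "?L \<longleftrightarrow> ?R") for k Z
  proof
    assume L: ?L
    have "closedin (zariski I) (Z i) \<and> Z i \<subseteq> S \<and> irreducible_in (zariski I) (Z i)" if "i \<le> k" for i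
    proof -
      have "closedin (subtopology (zariski I) S) (Z i)" "irreducible_in (subtopology (zariski I) S) (Z i)"
        using L that by simp_all
      then show ?thesis
        unfolding closedin_closed_subtopology[OF S] using irreducible_in_subtopology[OF S, of "Z i"] by simp
    qed
    then show ?R using L by (simp add: chain_def)
  next
    assume R: ?R
    have "closedin (subtopology (zariski I) S) (Z i) \<and> irreducible_in (subtopology (zariski I) S) (Z i)"
      if "i \<le> k" for i
    proof -
      have "Z i \<subseteq> S" using chain_mono[of I k Z i k] R that by blast
      then show ?thesis
        unfolding closedin_closed_subtopology[OF S] irreducible_in_subtopology[OF S \<open>Z i \<subseteq> S\<close>]
        using R that by (simp add: chain_def)
    qed
    then show ?L using R by (simp add: chain_def)
  qed
  then show ?thesis unfolding top_dim_def by simp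
qed

lemma top_dim_eqI:
  assumes "closedin (zariski I) S" "chain I m Z" "Z m \<subseteq> S"
    and "\<And>k Z. chain I k Z \<Longrightarrow> Z k \<subseteq> S \<Longrightarrow> k \<le> m"
  shows "top_dim (subtopology (zariski I) S) = enat m"
  unfolding top_dim_chains[OF assms(1)]
  by (rule antisym) (use assms in \<open>auto intro!: Sup_least Sup_upper\<close>)

section \<open>Dimension of the secant varieties\<close>

text \<open>Tangent vectors are indexed by the exponent of \<open>y 1\<close> alone, that of
  \<open>y 0\<close> being determined by \<open>b\<close>; this passes to the index type of the
  Segre-Veronese variety.\<close>

definition reindex :: "nat \<Rightarrow> ((nat \<Rightarrow> nat) \<times> nat \<Rightarrow> complex) \<Rightarrow> bidegree_index \<Rightarrow> complex" where
  "reindex b w = (\<lambda>(\<alpha>, \<beta>). if \<beta> \<in> exponents 1 b then w (\<alpha>, \<beta> 1) else 0)"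

definition bin_exp :: "nat \<Rightarrow> nat \<Rightarrow> nat \<Rightarrow> nat" where
  "bin_exp b j = (\<lambda>i. if i = 0 then b - j else if i = 1 then j else 0)"

definition xcoord :: "nat \<Rightarrow> (nat \<Rightarrow> complex) \<Rightarrow> nat \<Rightarrow> complex" where
  "xcoord n P = (\<lambda>i. if i \<le> n then P (Suc i) else 0)"

definition ycoord :: "(nat \<Rightarrow> complex) \<Rightarrow> nat \<Rightarrow> complex" where
  "ycoord P = (\<lambda>i. if i = 0 then 1 else if i = 1 then P 0 else 0)"

lemma bin_exp_exponents: "j \<le> b \<Longrightarrow> bin_exp b j \<in> exponents 1 b"
  by (auto simp: exponents_def bin_exp_def)

lemma exponents_1_le: "\<beta> \<in> exponents 1 b \<Longrightarrow> \<beta> 1 \<le> b"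
  by (auto simp: exponents_def)

lemma flinear_reindex: "flinear (reindex b)"
  by (rule flinearI) (auto simp: reindex_def)

lemma finite_sv_index [simp]: "finite (sv_index n a)"
  by (simp add: sv_index_def)

lemma card_sv_index: "card (sv_index (n, 1) (a, b)) = card (exponents n a) * Suc b"
  by (simp add: sv_index_def card_cartesian_product card_exponents)

lemma sv_N_eq: "sv_N (n, 1) (a, b) = card (exponents n a) * Suc b"
  by (simp add: sv_N_def card_exponents)

lemma reindex_tvec_coord: "reindex b (tvec n a b d P) \<in> coord_space (sv_index (n, 1) (a, b))"
  by (cases d) (auto simp: reindex_def vpt_def vpd_def coord_space_def sv_index_def)

lemma sv_map_vpt: "sv_map (n, 1) (a, b) (xcoord n P) (ycoord P) = reindex b (vpt n a b P)"
proof
  fix x :: bidegree_index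
  obtain \<alpha> \<beta> where x: "x = (\<alpha>, \<beta>)" by force
  have "(\<Prod>i\<le>n. xcoord n P i ^ \<alpha> i) = xmono n \<alpha> P"
    unfolding xmono_def by (intro prod.cong) (auto simp: xcoord_def)
  then show "sv_map (n, 1) (a, b) (xcoord n P) (ycoord P) x = reindex b (vpt n a b P) x"
    using exponents_1_le[of \<beta> b]
    by (auto simp: x sv_map_def sv_index_def reindex_def vpt_def ycoord_def)
qed

lemma reindex_inj_family:
  assumes "indep_family K w" "\<And>k \<alpha> j. k \<in> K \<Longrightarrow> b < j \<Longrightarrow> w k (\<alpha>, j) = 0"
  shows "indep_family K (\<lambda>k. reindex b (w k))"
  unfolding indep_family_def
proof (intro allI impI)
  fix c assume *: "(\<Sum>k\<in>K. fscale (c k) (reindex b (w k))) = 0"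
  have "(\<Sum>k\<in>K. fscale (c k) (w k)) = 0"
  proof
    fix x :: "(nat \<Rightarrow> nat) \<times> nat"
    obtain \<alpha> j where x: "x = (\<alpha>, j)" by force
    show "(\<Sum>k\<in>K. fscale (c k) (w k)) x = 0 x"
    proof (cases "j \<le> b")
      case True
      then have "reindex b v (\<alpha>, bin_exp b j) = v x" for v
        using bin_exp_exponents[OF True] by (simp add: reindex_def x bin_exp_def)
      then show ?thesis
        using fun_cong[OF *, of "(\<alpha>, bin_exp b j)"] by (simp add: sum_fun_apply)
    next
      case False
      then show ?thesis using assms(2) by (simp add: x sum_fun_apply)
    qed
  qed
  then show "\<forall>k\<in>K. c k = 0" using indep_familyD[OF assms(1)] by blast
qed

lemma xmono_bounded:
  assumes "\<And>k. (\<lambda>u. P u k) \<in> bounded_polys r 1" "\<alpha> \<in> exponents n a"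
  shows "(\<lambda>u. xmono n \<alpha> (P u)) \<in> bounded_polys r a"
proof -
  have "(\<lambda>u. xmono n \<alpha> (P u)) \<in> bounded_polys r (\<Sum>i\<le>n. \<alpha> i * 1)"
    unfolding xmono_def by (intro bounded_polys_prod bounded_polys_power assms) simp
  then show ?thesis using assms(2) by (simp add: exponents_def)
qed

lemma reindex_vpt_bounded:
  assumes "\<And>k. (\<lambda>u. P u k) \<in> bounded_polys r 1"
  shows "(\<lambda>u. reindex b (vpt n a b (P u)) x) \<in> bounded_polys r (a + b)"
proof -
  obtain \<alpha> \<beta> where x: "x = (\<alpha>, \<beta>)" by force
  show ?thesis
  proof (cases "\<beta> \<in> exponents 1 b \<and> \<alpha> \<in> exponents n a")
    case True
    have "(\<lambda>u. xmono n \<alpha> (P u) * P u 0 ^ \<beta> 1) \<in> bounded_polys r (a + \<beta> 1 * 1)"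
      by (intro bounded_polys_mult bounded_polys_power xmono_bounded assms) (use True in auto)
    moreover have "\<beta> 1 \<le> b" using True exponents_1_le by blast
    ultimately have "(\<lambda>u. xmono n \<alpha> (P u) * P u 0 ^ \<beta> 1) \<in> bounded_polys r (a + b)"
      using bounded_polys_mono[of "a + \<beta> 1 * 1" "a + b" r] by auto
    then show ?thesis using True \<open>\<beta> 1 \<le> b\<close> by (simp add: x reindex_def vpt_def)
  next
    case False
    then have "reindex b (vpt n a b (P u)) x = 0" for u by (auto simp: x reindex_def vpt_def)
    then show ?thesis by (simp add: bounded_polys_const)
  qed
qed

lemma reindex_vpt_polyfn:
  assumes "\<And>k. (\<lambda>u. P u k) \<in> polyfn"
  shows "(\<lambda>u. reindex b (vpt n a b (P u)) x) \<in> polyfn"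
proof -
  obtain \<alpha> \<beta> where x: "x = (\<alpha>, \<beta>)" by force
  show ?thesis
    using polyfn_comp[OF polyfn_tvec[of n a b None "(\<alpha>, \<beta> 1)"] assms]
    by (cases "\<beta> \<in> exponents 1 b") (auto simp: x reindex_def intro: polyfn_const)
qed

definition secant_points :: "nat \<times> nat \<Rightarrow> nat \<times> nat \<Rightarrow> nat \<Rightarrow> (bidegree_index \<Rightarrow> complex) set set" where
  "secant_points n a s = (\<Union>p\<in>{p. \<forall>j<s. p j \<in> segre_veronese n a}. proj_span s p)"

lemma sv_secant_eq: "sv_secant n a s = zariski (sv_index n a) closure_of secant_points n a s"
  by (simp add: sv_secant_def secant_variety_def secant_points_def)

lemma secant_points_rep:
  assumes "p \<in> secant_points n a s"
  obtains c x y where "p = proj_point (\<lambda>i. \<Sum>j<s. c j * sv_map n a (x j) (y j) i)"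
    "(\<lambda>i. \<Sum>j<s. c j * sv_map n a (x j) (y j) i) \<noteq> (\<lambda>i. 0)"
proof -
  obtain P w v where P: "\<And>j. j < s \<Longrightarrow> P j \<in> segre_veronese n a" and p: "p = proj_point w" "w \<noteq> (\<lambda>i. 0)"
    and v: "\<And>j. j < s \<Longrightarrow> v j \<in> P j" "w = (\<lambda>i. \<Sum>j<s. v j i)"
    using assms by (auto simp: secant_points_def proj_span_def)
  have "\<exists>c x y. v j = (\<lambda>i. c * sv_map n a x y i)" if "j < s" for j
    using P[OF that] v(1)[OF that] by (auto simp: segre_veronese_def proj_point_def)
  then have "\<forall>j\<in>{..<s}. \<exists>z. v j = (\<lambda>i. fst z * sv_map n a (fst (snd z)) (snd (snd z)) i)" by fastforce
  from bchoice[OF this] obtain z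
    where z: "\<And>j. j < s \<Longrightarrow> v j = (\<lambda>i. fst (z j) * sv_map n a (fst (snd (z j))) (snd (snd (z j))) i)" by auto
  have w: "w = (\<lambda>i. \<Sum>j<s. fst (z j) * sv_map n a (fst (snd (z j))) (snd (snd (z j))) i)"
    unfolding v(2) using z by (intro ext sum.cong) auto
  show ?thesis
    using that[of "\<lambda>j. fst (z j)" "\<lambda>j. fst (snd (z j))" "\<lambda>j. snd (snd (z j))"] p unfolding w by blast
qed

lemma sv_map_coord: "sv_map n a x y \<in> coord_space (sv_index n a)"
  by (auto simp: sv_map_def coord_space_def)

lemma secant_points_subset: "secant_points n a s \<subseteq> proj_space (sv_index n a)"
proof
  fix p assume "p \<in> secant_points n a s"
  then obtain c x y where p: "p = proj_point (\<lambda>i. \<Sum>j<s. c j * sv_map n a (x j) (y j) i)"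
    "(\<lambda>i. \<Sum>j<s. c j * sv_map n a (x j) (y j) i) \<noteq> (\<lambda>i. 0)"
    by (rule secant_points_rep)
  have "(\<lambda>i. \<Sum>j<s. c j * sv_map n a (x j) (y j) i) \<in> coord_space (sv_index n a)"
    using sv_map_coord[of n a] by (auto simp: coord_space_def)
  with p show "p \<in> proj_space (sv_index n a)" by (auto simp: proj_space_def)
qed

lemma closed_sv_secant: "closedin (zariski (sv_index n a)) (sv_secant n a s)"
  by (simp add: sv_secant_eq)

lemma sum_points_secant:
  assumes a: "a \<ge> 1" and nz: "(\<Sum>j<s. reindex b (vpt n a b (P j))) \<noteq> (\<lambda>_. 0)"
  shows "proj_point (\<Sum>j<s. reindex b (vpt n a b (P j))) \<in> secant_points (n, 1) (a, b) s"
proof -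
  \<comment> \<open>If all \<open>x\<close>-coordinates are 0, the vector of monomials is 0 as well,
    because \<open>a \<ge> 1\<close>. The zero vector lies in every projective point, so a
    coordinate point can stand in.\<close>
  define x where "x j = (if xcoord n (P j) = (\<lambda>i. 0) then (\<lambda>i. if i = 0 then 1 else 0) else xcoord n (P j))" for j
  define p where "p j = proj_point (sv_map (n, 1) (a, b) (x j) (ycoord (P j)))" for j
  have "p j \<in> segre_veronese (n, 1) (a, b)" for j
  proof -
    have "x j \<in> coord_space {..n}" "ycoord (P j) \<in> coord_space {..1}"
      by (auto simp: x_def xcoord_def ycoord_def coord_space_def)
    moreover have "x j \<noteq> (\<lambda>i. 0)"
      by (auto simp: x_def fun_eq_iff)
    moreover have "ycoord (P j) \<noteq> (\<lambda>i. 0)" by (auto simp: ycoord_def fun_eq_iff)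
    ultimately show ?thesis unfolding p_def segre_veronese_def by fastforce
  qed
  moreover have "reindex b (vpt n a b (P j)) \<in> p j" for j
  proof (cases "xcoord n (P j) = (\<lambda>i. 0)")
    case False
    then have "x j = xcoord n (P j)" by (simp add: x_def)
    then show ?thesis unfolding p_def by (simp only: sv_map_vpt proj_point_self)
  next
    case True
    have "xmono n \<alpha> (P j) = 0" if "\<alpha> \<in> exponents n a" for \<alpha>
    proof -
      have "(\<Sum>i\<le>n. \<alpha> i) \<noteq> 0" using that a by (auto simp: exponents_def)
      then obtain i where "i \<le> n" "\<alpha> i \<noteq> 0" by auto
      moreover have "P j (Suc i) = 0" if "i \<le> n" for i
        using fun_cong[OF True, of i] that by (simp add: xcoord_def)
      ultimately show ?thesis unfolding xmono_def by (intro prod_zero) auto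
    qed
    then have "reindex b (vpt n a b (P j)) = (\<lambda>i. 0 * sv_map (n, 1) (a, b) (x j) (ycoord (P j)) i)"
      by (auto simp: reindex_def vpt_def fun_eq_iff)
    then show ?thesis unfolding p_def proj_point_def by blast
  qed
  moreover have "(\<Sum>j<s. reindex b (vpt n a b (P j))) = (\<lambda>i. \<Sum>j<s. reindex b (vpt n a b (P j)) i)"
    by (simp add: fun_eq_iff sum_fun_apply)
  ultimately have "proj_point (\<Sum>j<s. reindex b (vpt n a b (P j))) \<in> proj_span s p"
    unfolding proj_span_def
    by (intro CollectI exI[of _ "\<Sum>j<s. reindex b (vpt n a b (P j))"]
        exI[of _ "\<lambda>j. reindex b (vpt n a b (P j))"] conjI allI impI nz) simp_all
  then show ?thesis unfolding secant_points_def using \<open>\<And>j. p j \<in> segre_veronese (n, 1) (a, b)\<close> by blast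
qed

text \<open>One direction of Terracini's lemma: the sum of \<open>s\<close> points of the cone, as a
  function of their coordinates, has the tangent vectors as partial derivatives. Moving
  \<open>r\<close> suitable coordinates parametrises a part of the secant variety with injective
  derivative.\<close>

lemma secant_chain_exists:
  assumes a: "a \<ge> 1" and s: "s \<ge> 1" and rank: "sec_rank n a b s (Suc r)"
  shows "\<exists>Z. chain (sv_index (n, 1) (a, b)) r Z \<and> Z r \<subseteq> sv_secant (n, 1) (a, b) s"
proof -
  let ?I = "sv_index (n, 1) (a, b)"
  define w0 where "w0 q = (\<Sum>j<s. vpt n a b (pt q j))" for q
  \<comment> \<open>The coordinate of the monomial \<open>x 0 ^ a * y 0 ^ b\<close>, in which the
    sum of \<open>s\<close> points with all coordinates 1 has value \<open>s\<close>; so the sum is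
    nonzero for general points.\<close>
  let ?x0 = "((\<lambda>_. 0)(0 := a), 0) :: (nat \<Rightarrow> nat) \<times> nat"
  have "w0 (\<lambda>_. 1) ?x0 \<noteq> 0"
    using s by (simp add: w0_def sum_fun_apply vpt_def exponents_def xmono_def pt_def)
  moreover have "(\<lambda>q. vpt n a b (pt q j) ?x0) \<in> polyfn" for j
    using polyfn_comp[OF polyfn_tvec[of n a b None ?x0], of "\<lambda>q k. q (j, k)"]
    by (simp add: pt_def polyfn_coord)
  then have "(\<lambda>q. w0 q ?x0) \<in> polyfn"
    unfolding w0_def sum_fun_apply by (rule polyfn_sum)
  ultimately have "generic (\<lambda>q. w0 q ?x0 \<noteq> 0)"
    using generic_nonzero[of "\<lambda>q. w0 q ?x0" "\<lambda>_. 1"] by blast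
  from generic_ex[OF generic_conj[OF this sec_rank_generic[OF rank]]]
  obtain q where q: "w0 q ?x0 \<noteq> 0" "rank_ge (\<Union>j<s. tan_vecs n a b (pt q j)) (Suc r)" by blast
  let ?D = "(\<lambda>(j, k). vpd n a b k (pt q j)) ` ({..<s} \<times> {..Suc n})"
  obtain c where c: "a = Suc c" using a by (cases a) auto
  have "(\<Union>j<s. tan_vecs n a b (pt q j)) \<subseteq> fs.span ?D"
  proof -
    have "tan_vecs n a b (pt q j) \<subseteq> fs.span ?D" if "j < s" for j
    proof -
      have sub: "(\<lambda>k. vpd n a b k (pt q j)) ` {..Suc n} \<subseteq> ?D" using that by auto
      then have "vpt n a b (pt q j) \<in> fs.span ?D"
        using vpt_in_span_vpd[of n c b "pt q j"] fs.span_mono[OF sub] unfolding c by blast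
      then show ?thesis using sub by (auto simp: tan_vecs_def dirs_def intro!: fs.span_base)
    qed
    then show ?thesis by blast
  qed
  then have "rank_ge ?D (Suc r)" by (rule rank_ge_mono[OF q(2)])
  then have "rank_ge ({w0 q} \<union> ?D) (Suc r)" by (rule rank_ge_subset) auto
  moreover have "rank_ge {w0 q} (card {w0 q})"
    by (rule rank_ge_independent) (use q(1) in \<open>auto intro: fs.span_base\<close>)
  moreover have "?D \<noteq> {}" using s by (auto simp: lessThan_empty_iff)
  \<comment> \<open>The sum of the points is the value at the origin and must belong to the
    independent family; \<open>r\<close> derivatives complete it to \<open>r + 1\<close> vectors,
    one more than the projective dimension.\<close>
  ultimately obtain e where e: "\<forall>l<r. e l \<in> ?D" "rank_ge ({w0 q} \<union> e ` {..<r}) (Suc r)"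
    using rank_ge_extend[of "{w0 q}" 1 ?D "Suc r" r] by auto
  then have "\<forall>l\<in>{..<r}. \<exists>z. z \<in> {..<s} \<times> {..Suc n} \<and> e l = (case z of (j, k) \<Rightarrow> vpd n a b k (pt q j))" by blast
  from bchoice[OF this] obtain z where z: "\<And>l. l < r \<Longrightarrow> z l \<in> {..<s} \<times> {..Suc n}"
    "\<And>l. l < r \<Longrightarrow> e l = (case z l of (j, k) \<Rightarrow> vpd n a b k (pt q j))" by auto
  define J where "J l = fst (z l)" for l
  define K where "K l = snd (z l)" for l
  have JK: "J l < s" "K l \<le> Suc n" "e l = vpd n a b (K l) (pt q (J l))" if "l < r" for l
    using z[OF that] by (auto simp: J_def K_def case_prod_unfold)
  define W where "W j = (case j of 0 \<Rightarrow> w0 q | Suc l \<Rightarrow> e l)" for j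
  have "W ` {..r} = {w0 q} \<union> e ` {..<r}"
  proof -
    have "{..r} = insert 0 (Suc ` {..<r})"
      unfolding lessThan_Suc_atMost[symmetric] by (rule lessThan_Suc_eq_insert_0)
    then show ?thesis by (simp add: W_def image_image)
  qed
  then have "rank_ge (W ` {..r}) (Suc r)" using e(2) by simp
  then obtain M where M: "M \<subseteq> {..r}" "card M = Suc r" "indep_family M W"
    using rank_ge_family[of "{..r}" W] by auto
  then have "M = {..r}" by (intro card_subset_eq) auto
  then have W: "indep_family {..r} W" using M by simp
  \<comment> \<open>The parameter \<open>u l\<close> moves the coordinate \<open>K l\<close> of the
    point \<open>J l\<close>, starting from the general points \<open>q\<close>.\<close>
  define P where "P j u k = q (j, k) + (\<Sum>l<r. (if J l = j \<and> K l = k then u l else 0))" for j k and u :: "nat \<Rightarrow> complex"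
  define \<phi> where "\<phi> u = (\<Sum>j<s. reindex b (vpt n a b (P j u)))" for u
  define G where "G l = reindex b (vpd n a b (K l) (pt q (J l)))" for l
  have P0: "P j (\<lambda>_. 0) = pt q j" for j by (auto simp: P_def pt_def)
  have P_bounded: "(\<lambda>u. P j u k) \<in> bounded_polys r 1" for j k
  proof -
    have "(\<lambda>u. (if J l = j \<and> K l = k then u l else 0)) \<in> bounded_polys r 1" if "l < r" for l
      using bounded_polys_coord[OF that, of 0] by (cases "J l = j \<and> K l = k") (auto intro: bounded_polys_const)
    then show ?thesis unfolding P_def by (intro bounded_polys_add bounded_polys_const bounded_polys_sum) auto
  qed
  have P_poly: "(\<lambda>u. P j u k) \<in> polyfn" for j k
  proof -
    have "(\<lambda>u. (if J l = j \<and> K l = k then u l else 0)) \<in> polyfn" for l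
      by (cases "J l = j \<and> K l = k") (auto intro: polyfn_intros)
    then show ?thesis unfolding P_def by (intro polyfn_intros)
  qed
  have "\<exists>Z. chain ?I r Z \<and> Z r \<subseteq> zariski ?I closure_of (param_image \<phi>)"
  proof (rule chain_exists[where G = G and D = "a + b"])
    have rc: "reindex b (vpt n a b R) \<in> coord_space ?I" for R
      using reindex_tvec_coord[of b n a None R] by simp
    show "\<phi> u \<in> coord_space ?I" for u
      using rc by (auto simp: \<phi>_def coord_space_def sum_fun_apply)
    show "(\<lambda>u. \<phi> u i) \<in> polyfn" for i
      unfolding \<phi>_def sum_fun_apply by (intro polyfn_sum reindex_vpt_polyfn P_poly)
    show "(\<lambda>u. \<phi> u i) \<in> bounded_polys r (a + b)" for i
      unfolding \<phi>_def sum_fun_apply by (intro bounded_polys_sum reindex_vpt_bounded P_bounded)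
    show "G l \<in> coord_space ?I" for l
      unfolding G_def using reindex_tvec_coord[of b n a "Some (K l)"] by simp
    show "((\<lambda>t. \<phi> (\<lambda>l. t * x l) i) has_field_derivative (\<Sum>l<r. x l * G l i)) (at 0)" for x i
    proof -
      obtain \<alpha> \<beta> where i: "i = (\<alpha>, \<beta>)" by force
      define D where "D j k = (\<Sum>l<r. (if J l = j \<and> K l = k then x l else 0))" for j k
      have Pt: "P j (\<lambda>l. t * x l) = (\<lambda>k. pt q j k + t * D j k)" for j t
        by (auto simp: P_def pt_def D_def sum_distrib_left if_distrib cong: if_cong)
      show ?thesis
      proof (cases "\<beta> \<in> exponents 1 b")
        case True
        have "((\<lambda>t. \<Sum>j<s. vpt n a b (\<lambda>k. pt q j k + t * D j k) (\<alpha>, \<beta> 1)) has_field_derivative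
            (\<Sum>j<s. \<Sum>k\<le>Suc n. D j k * vpd n a b k (pt q j) (\<alpha>, \<beta> 1))) (at 0)"
        proof (rule DERIV_sum)
          fix j show "((\<lambda>t. vpt n a b (\<lambda>k. pt q j k + t * D j k) (\<alpha>, \<beta> 1)) has_field_derivative
            (\<Sum>k\<le>Suc n. D j k * vpd n a b k (pt q j) (\<alpha>, \<beta> 1))) (at 0)"
            using vpt_deriv[of n a b "pt q j" "D j" "(\<alpha>, \<beta> 1)" 0] by (simp del: sum.atMost_Suc)
        qed
        also have "(\<Sum>j<s. \<Sum>k\<le>Suc n. D j k * vpd n a b k (pt q j) (\<alpha>, \<beta> 1)) = (\<Sum>l<r. x l * G l i)"
        proof -
          have "(\<Sum>j<s. \<Sum>k\<le>Suc n. D j k * vpd n a b k (pt q j) (\<alpha>, \<beta> 1)) =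
            (\<Sum>j<s. \<Sum>k\<le>Suc n. \<Sum>l<r. (if J l = j \<and> K l = k then x l * vpd n a b k (pt q j) (\<alpha>, \<beta> 1) else 0))"
            unfolding D_def sum_distrib_right by (intro sum.cong refl) auto
          also have "\<dots> = (\<Sum>l<r. \<Sum>j<s. \<Sum>k\<le>Suc n. (if J l = j \<and> K l = k then x l * vpd n a b k (pt q j) (\<alpha>, \<beta> 1) else 0))"
            by (subst (2) sum.swap, subst sum.swap) (rule refl)
          also have "\<dots> = (\<Sum>l<r. x l * G l i)"
          proof (rule sum.cong)
            fix l assume "l \<in> {..<r}"
            then have l: "J l < s" "K l \<le> Suc n" using JK by auto
            have "(\<Sum>j<s. \<Sum>k\<le>Suc n. (if J l = j \<and> K l = k then x l * vpd n a b k (pt q j) (\<alpha>, \<beta> 1) else 0))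
              = (\<Sum>j<s. if j = J l then \<Sum>k\<le>Suc n. (if k = K l then x l * vpd n a b k (pt q j) (\<alpha>, \<beta> 1) else 0) else 0)"
              by (intro sum.cong refl) auto
            also have "\<dots> = x l * vpd n a b (K l) (pt q (J l)) (\<alpha>, \<beta> 1)"
              using l by (simp del: sum.atMost_Suc)
            finally show "(\<Sum>j<s. \<Sum>k\<le>Suc n. (if J l = j \<and> K l = k then x l * vpd n a b k (pt q j) (\<alpha>, \<beta> 1) else 0))
              = x l * G l i"
              using True by (simp add: G_def i reindex_def)
          qed simp
          finally show ?thesis .
        qed
        finally show ?thesis using True by (simp add: \<phi>_def sum_fun_apply i reindex_def Pt)
      next
        case False
        then show ?thesis by (simp add: \<phi>_def sum_fun_apply i reindex_def G_def)
      qed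
    qed
    have "indep_family {..r} (\<lambda>j. reindex b (W j))"
    proof (rule reindex_inj_family[OF W])
      fix j \<alpha> i assume "j \<in> {..r}" "b < i"
      then show "W j (\<alpha>, i) = 0"
        using JK(3) by (cases j) (auto simp: W_def w0_def sum_fun_apply vpt_def vpd_def)
    qed
    moreover have "reindex b (W j) = (case j of 0 \<Rightarrow> \<phi> (\<lambda>_. 0) | Suc l \<Rightarrow> G l)" if "j \<in> {..r}" for j
    proof (cases j)
      case 0
      then show ?thesis by (simp add: W_def w0_def \<phi>_def P0 fs.linear_sum[OF flinear_reindex])
    next
      case (Suc l)
      then show ?thesis using that JK(3)[of l] by (simp add: W_def G_def)
    qed
    ultimately show "indep_family {..r} (\<lambda>j. case j of 0 \<Rightarrow> \<phi> (\<lambda>_. 0) | Suc l \<Rightarrow> G l)"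
      unfolding indep_family_def by simp
  qed simp
  moreover have "param_image \<phi> \<subseteq> secant_points (n, 1) (a, b) s"
    using sum_points_secant[OF a] by (auto simp: param_image_def \<phi>_def)
  then have "zariski ?I closure_of (param_image \<phi>) \<subseteq> sv_secant (n, 1) (a, b) s"
    unfolding sv_secant_eq by (rule closure_of_mono)
  ultimately show ?thesis by blast
qed

section \<open>Upper bound by counting parameters\<close>

lemma sv_map_normalize:
  assumes "x 0 \<noteq> 0" "y 0 \<noteq> 0"
  shows "sv_map (n, 1) (a, b) x y =
    (\<lambda>i. (x 0 ^ a * y 0 ^ b) * reindex b (vpt n a b (\<lambda>k. case k of 0 \<Rightarrow> y 1 / y 0 | Suc l \<Rightarrow> x l / x 0)) i)"
proof
  fix i :: bidegree_index
  obtain \<alpha> \<beta> where i: "i = (\<alpha>, \<beta>)" by force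
  let ?P = "\<lambda>k. case k of 0 \<Rightarrow> y 1 / y 0 | Suc l \<Rightarrow> x l / x 0"
  show "sv_map (n, 1) (a, b) x y i = (x 0 ^ a * y 0 ^ b) * reindex b (vpt n a b ?P) i"
  proof (cases "i \<in> sv_index (n, 1) (a, b)")
    case True
    then have \<alpha>: "\<alpha> \<in> exponents n a" and \<beta>: "\<beta> \<in> exponents 1 b" by (auto simp: i sv_index_def)
    have "a = (\<Sum>l\<le>n. \<alpha> l)" using \<alpha> by (simp add: exponents_def)
    then have "x 0 ^ a = (\<Prod>l\<le>n. x 0 ^ \<alpha> l)" by (simp only: power_sum)
    then have "(\<Prod>l\<le>n. x l ^ \<alpha> l) = x 0 ^ a * xmono n \<alpha> ?P"
      using assms(1) by (simp add: xmono_def prod.distrib[symmetric] power_divide)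
    moreover have "b = \<beta> 0 + \<beta> 1" using \<beta> by (simp add: exponents_def)
    ultimately show ?thesis
      using \<alpha> \<beta> exponents_1_le[OF \<beta>] True assms(2)
      by (simp add: i sv_map_def reindex_def vpt_def power_add power_divide)
  next
    case False
    then show ?thesis by (auto simp: i sv_map_def sv_index_def reindex_def vpt_def)
  qed
qed

text \<open>Each of the \<open>s\<close> points has \<open>n + 1\<close> affine coordinates and a
  coefficient, and dividing by the last coefficient saves one parameter. Configurations with a zero
  coefficient or outside the chart are covered by density.\<close>

lemma secant_chain_length_le:
  assumes s: "s \<ge> 1" and Z: "chain (sv_index (n, 1) (a, b)) k Z" "Z k \<subseteq> sv_secant (n, 1) (a, b) s"
  shows "k \<le> s * (n + 2) - 1"
proof -
  let ?I = "sv_index (n, 1) (a, b)"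
  let ?N = "n + 2" and ?r = "s * (n + 2) - 1"
  have idx: "j * ?N + i < ?r" if "j < s" "i < ?N" "j \<noteq> s - 1 \<or> i \<noteq> n + 1" for i j
  proof -
    have "Suc j * ?N \<le> s * ?N" using that(1) by (intro mult_le_mono1) simp
    moreover have "Suc (Suc j) * ?N \<le> s * ?N" if "j \<noteq> s - 1"
      using that \<open>j < s\<close> by (intro mult_le_mono1) simp
    ultimately show ?thesis using that(2,3) by (cases "j = s - 1") auto
  qed
  \<comment> \<open>The slot \<open>j * ?N + i\<close> holds an affine coordinate of the first
    factor for \<open>i < n\<close>, that of the second for \<open>i = n\<close>, and the
    coefficient for \<open>i = n + 1\<close>. The very last slot is absent, as that coefficient is
    normalised to 1.\<close>
  define c where "c u j = (if j = s - 1 then 1 else u (j * ?N + (n + 1)))" for u :: "nat \<Rightarrow> complex" and j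
  define P where "P u j = (\<lambda>k. case k of 0 \<Rightarrow> u (j * ?N + n) | Suc 0 \<Rightarrow> 1 | Suc (Suc l) \<Rightarrow> if l < n then u (j * ?N + l) else 0)"
    for u :: "nat \<Rightarrow> complex" and j
  define \<phi> where "\<phi> u = (\<lambda>i. \<Sum>j<s. c u j * reindex b (vpt n a b (P u j)) i)" for u
  have P_bounded: "(\<lambda>u. P u j k) \<in> bounded_polys ?r 1" if j: "j < s" for j k
  proof -
    have co: "(\<lambda>u. u (j * ?N + i)) \<in> bounded_polys ?r 1" if "i \<le> n" for i
      using bounded_polys_coord[OF idx[OF j, of i], of 0] that by simp
    consider "k = 0" | "k = Suc 0" | l where "k = Suc (Suc l)" by (metis old.nat.exhaust)
    then show ?thesis
    proof cases
      case (3 l)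
      then show ?thesis using co[of l] by (cases "l < n") (auto simp: P_def intro: bounded_polys_const)
    qed (use co[of n] in \<open>auto simp: P_def intro: bounded_polys_const\<close>)
  qed
  have c_bounded: "(\<lambda>u. c u j) \<in> bounded_polys ?r 1" if j: "j < s" for j
    using bounded_polys_coord[OF idx[OF j, of "n + 1"], of 0]
    by (cases "j = s - 1") (auto simp: c_def intro: bounded_polys_const)
  have \<phi>_bounded: "(\<lambda>u. \<phi> u i) \<in> bounded_polys ?r (1 + (a + b))" for i
    unfolding \<phi>_def
    by (intro bounded_polys_sum bounded_polys_mult c_bounded reindex_vpt_bounded P_bounded) auto
  have dense: "\<forall>v\<in>\<Union>(sv_secant (n, 1) (a, b) s). poly_eval f v = 0"
    if f: "f \<in> forms ?I d" and 0: "\<forall>u. poly_eval f (\<phi> u) = 0" for f d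
    unfolding sv_secant_eq
  proof (rule closure_vanish[OF secant_points_subset f])
    fix v assume "proj_point v \<in> secant_points (n, 1) (a, b) s"
    then obtain c0 x0 y0 where v: "proj_point v = proj_point (\<lambda>i. \<Sum>j<s. c0 j * sv_map (n, 1) (a, b) (x0 j) (y0 j) i)"
      by (rule secant_points_rep)
    define X where "X q j i = q (j, i + 3)" for q :: "nat \<times> nat \<Rightarrow> complex" and i j :: nat
    define Y where "Y q j i = q (j, i + 1)" for q :: "nat \<times> nat \<Rightarrow> complex" and i j :: nat
    define C where "C q j = q (j, 0)" for q :: "nat \<times> nat \<Rightarrow> complex" and j :: nat
    define w where "w q = (\<lambda>i. \<Sum>j<s. C q j * sv_map (n, 1) (a, b) (X q j) (Y q j) i)" for q
    define q0 where "q0 = (\<lambda>(j, k). case k of 0 \<Rightarrow> c0 j | Suc 0 \<Rightarrow> y0 j 0 | Suc (Suc 0) \<Rightarrow> y0 j 1 | Suc (Suc (Suc i)) \<Rightarrow> x0 j i)"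
    have w0: "w q0 = (\<lambda>i. \<Sum>j<s. c0 j * sv_map (n, 1) (a, b) (x0 j) (y0 j) i)"
      unfolding w_def
      by (intro ext sum.cong) (auto simp: q0_def C_def X_def Y_def sv_map_def numeral_3_eq_3 split: prod.split)
    have sv_poly: "(\<lambda>q. sv_map (n, 1) (a, b) (X q j) (Y q j) i) \<in> polyfn" for i j
    proof -
      obtain \<alpha> \<beta> where i: "i = (\<alpha>, \<beta>)" by force
      show ?thesis
        by (cases "i \<in> sv_index (n, 1) (a, b)") (simp_all add: i sv_map_def X_def Y_def, (intro polyfn_intros)+)
    qed
    have w_poly: "(\<lambda>q. w q i) \<in> polyfn" for i
      unfolding w_def C_def by (intro polyfn_intros sv_poly)
    \<comment> \<open>Where \<open>g\<close> is nonzero, the normalised parametrisation applies; a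
      form that is nonzero at \<open>w q0\<close> is nonzero at some \<open>w q\<close> of this kind
      as well.\<close>
    define g where "g q = (\<Prod>j<s. C q j * Y q j 0 * X q j 0)" for q
    have g: "g \<in> polyfn" unfolding g_def C_def X_def Y_def by (intro polyfn_intros)
    have "g (\<lambda>_. 1) \<noteq> 0" by (simp add: g_def C_def X_def Y_def)
    have "poly_eval f (w q0) = 0"
    proof (rule ccontr)
      assume "poly_eval f (w q0) \<noteq> 0"
      moreover have "(\<lambda>q. poly_eval f (w q)) \<in> polyfn"
        by (rule polyfn_comp[OF polyfn_poly_eval w_poly])
      ultimately obtain q where q: "poly_eval f (w q) \<noteq> 0" "g q \<noteq> 0"
        using polyfn_common_nonzero[of "\<lambda>q. poly_eval f (w q)" g q0 "\<lambda>_. 1"] g \<open>g (\<lambda>_. 1) \<noteq> 0\<close>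
        by blast
      then have nz: "C q j \<noteq> 0" "Y q j 0 \<noteq> 0" "X q j 0 \<noteq> 0" if "j < s" for j
        using that by (auto simp: g_def)
      define A where "A j = C q j * (X q j 0 ^ a * Y q j 0 ^ b)" for j
      define R where "R j = (\<lambda>k. case k of 0 \<Rightarrow> Y q j 1 / Y q j 0 | Suc l \<Rightarrow> X q j l / X q j 0)" for j
      have wR: "w q i = (\<Sum>j<s. A j * reindex b (vpt n a b (R j)) i)" for i
        unfolding w_def A_def R_def
      proof (rule sum.cong)
        fix j assume "j \<in> {..<s}"
        then have "X q j 0 \<noteq> 0" "Y q j 0 \<noteq> 0" using nz by auto
        from fun_cong[OF sv_map_normalize[of "X q j" "Y q j" n a b, OF this], of i]
        show "C q j * sv_map (n, 1) (a, b) (X q j) (Y q j) i =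
          C q j * (X q j 0 ^ a * Y q j 0 ^ b) *
            reindex b (vpt n a b (\<lambda>k. case k of 0 \<Rightarrow> Y q j 1 / Y q j 0 | Suc l \<Rightarrow> X q j l / X q j 0)) i"
          by (simp only: mult.assoc)
      qed simp
      have A0: "A (s - 1) \<noteq> 0" using nz[of "s - 1"] s by (simp add: A_def)
      define u where "u i = (let j = i div ?N; l = i mod ?N in
        if l < n then R j (Suc (Suc l)) else if l = n then R j 0 else A j / A (s - 1))" for i
      have u: "u (j * ?N + l) = (if l < n then R j (Suc (Suc l)) else if l = n then R j 0 else A j / A (s - 1))"
        if "l < ?N" for j l
      proof -
        have "?N \<noteq> 0" by simp
        then have "(j * ?N + l) div ?N = j" "(j * ?N + l) mod ?N = l"
          using that by (simp_all only: div_mult_self3[OF \<open>?N \<noteq> 0\<close>] mod_mult_self3 div_less mod_less add_0_right)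
        then show ?thesis by (simp only: u_def Let_def)
      qed
      have cu: "c u j = A j / A (s - 1)" for j
        using A0 u[of "n + 1" j] by (auto simp: c_def)
      have Pu: "vpt n a b (P u j) = vpt n a b (R j)" if "j < s" for j
      proof -
        have "P u j k = R j k" if "k \<le> Suc n" for k
        proof -
          consider "k = 0" | "k = Suc 0" | l where "k = Suc (Suc l)" by (metis old.nat.exhaust)
          then show ?thesis
          proof cases
            case 1
            then show ?thesis using u[of n j] by (simp add: P_def)
          next
            case 2
            then show ?thesis using nz[OF \<open>j < s\<close>] by (simp add: P_def R_def)
          next
            case (3 l)
            then show ?thesis using u[of l j] that by (simp add: P_def)
          qed
        qed
        from tvec_cong[of n "P u j" "R j" a b None, OF this] show ?thesis by simp
      qed
      have "w q = (\<lambda>i. A (s - 1) * \<phi> u i)"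
        unfolding wR \<phi>_def sum_distrib_left
        using A0 by (intro ext sum.cong) (auto simp: cu Pu)
      then have "poly_eval f (w q) = A (s - 1) ^ d * poly_eval f (\<phi> u)"
        using poly_eval_scale[of d f "A (s - 1)" "\<phi> u"] f by (simp add: forms_def)
      then show False using 0 q(1) by simp
    qed
    then show "poly_eval f v = 0"
      using proj_point_eqD[OF _ f, of v "w q0"] v unfolding w0 by blast
  qed
  show ?thesis
    by (rule chain_length_le[where \<phi> = \<phi> and D = "1 + (a + b)" and C = "sv_secant (n, 1) (a, b) s",
          OF _ dense Z]) (use \<phi>_bounded in auto)
qed

section \<open>Chains in the ambient projective space\<close>

lemma poly_eval_cong_forms:
  assumes "f \<in> forms I d" "\<And>i. i \<in> I \<Longrightarrow> v i = w i"
  shows "poly_eval f v = poly_eval f w"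
proof -
  have "mono_eval m v = mono_eval m w" if "m \<in> Poly_Mapping.keys f" for m
    unfolding mono_eval_def
  proof (rule prod.cong)
    fix i assume "i \<in> Poly_Mapping.keys m"
    then have "i \<in> I" using assms(1) that by (auto simp: forms_def poly_vars_def)
    then show "v i ^ Poly_Mapping.lookup m i = w i ^ Poly_Mapping.lookup m i" using assms(2) by simp
  qed simp
  then show ?thesis unfolding poly_eval_def by (intro sum.cong) auto
qed

text \<open>The chart where the coordinate \<open>i0\<close> is 1. A form vanishing on it vanishes
  wherever this coordinate is nonzero, by homogeneity, and hence everywhere.\<close>

lemma affine_chart:
  assumes I: "finite I" "i0 \<in> I"
  obtains \<phi> :: "(nat \<Rightarrow> complex) \<Rightarrow> 'i \<Rightarrow> complex" where
    "\<And>i. (\<lambda>u. \<phi> u i) \<in> bounded_polys (card I - 1) 1" "\<And>i. (\<lambda>u. \<phi> u i) \<in> polyfn"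
    "\<And>u. \<phi> u \<in> coord_space I" "\<And>u. \<phi> u i0 = 1"
    "\<And>f d v. f \<in> forms I d \<Longrightarrow> (\<forall>u. poly_eval f (\<phi> u) = 0) \<Longrightarrow> poly_eval f v = 0"
proof -
  have "finite (I - {i0})" "card (I - {i0}) = card I - 1" using I by auto
  then obtain h where h: "bij_betw h {..<card I - 1} (I - {i0})"
    by (metis bij_betw_from_nat_into_finite)
  define g where "g = the_inv_into {..<card I - 1} h"
  have g: "g i < card I - 1" "h (g i) = i" if "i \<in> I" "i \<noteq> i0" for i
  proof -
    have "i \<in> h ` {..<card I - 1}" "inj_on h {..<card I - 1}" using h that by (auto simp: bij_betw_def)
    then show "g i < card I - 1" "h (g i) = i"
      unfolding g_def using the_inv_into_into[of h "{..<card I - 1}" i] f_the_inv_into_f[of h "{..<card I - 1}" i]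
      by auto
  qed
  define \<phi> :: "(nat \<Rightarrow> complex) \<Rightarrow> 'i \<Rightarrow> complex"
    where "\<phi> u i = (if i = i0 then 1 else if i \<in> I then u (g i) else 0)" for u i
  show ?thesis
  proof (rule that[of \<phi>])
    fix i
    show "(\<lambda>u. \<phi> u i) \<in> bounded_polys (card I - 1) 1"
      using bounded_polys_coord[OF g(1), of i 0]
      by (cases "i = i0"; cases "i \<in> I") (auto simp: \<phi>_def intro: bounded_polys_const)
    show "(\<lambda>u. \<phi> u i) \<in> polyfn"
      by (cases "i = i0"; cases "i \<in> I") (auto simp: \<phi>_def intro: polyfn_intros)
  next
    fix u
    show "\<phi> u \<in> coord_space I" "\<phi> u i0 = 1" using I by (auto simp: \<phi>_def coord_space_def)
  next
    fix f d v assume f: "f \<in> forms I d" and 0: "\<forall>u. poly_eval f (\<phi> u) = 0"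
    show "poly_eval f v = 0"
    proof (rule ccontr)
      assume "poly_eval f v \<noteq> 0"
      then obtain q where q: "poly_eval f q \<noteq> 0" "q i0 \<noteq> 0"
        using polyfn_common_nonzero[OF polyfn_poly_eval[of f] polyfn_coord[of i0], of v "\<lambda>_. 1"] by auto
      have "poly_eval f (\<phi> (\<lambda>l. inverse (q i0) * q (h l))) = poly_eval f (\<lambda>i. inverse (q i0) * q i)"
        by (rule poly_eval_cong_forms[OF f]) (use q g in \<open>auto simp: \<phi>_def\<close>)
      also have "\<dots> = inverse (q i0) ^ d * poly_eval f q"
        by (rule poly_eval_scale) (use f in \<open>simp add: forms_def\<close>)
      finally show False using 0 q by simp
    qed
  qed
qed

lemma chain_length_ambient:
  assumes "finite I" "I \<noteq> {}" "chain I k Z"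
  shows "k \<le> card I - 1"
proof -
  obtain i0 where "i0 \<in> I" using assms(2) by blast
  show ?thesis
  proof (rule affine_chart[OF assms(1) \<open>i0 \<in> I\<close>])
    fix \<phi> :: "(nat \<Rightarrow> complex) \<Rightarrow> 'a \<Rightarrow> complex"
    assume \<phi>: "\<And>i. (\<lambda>u. \<phi> u i) \<in> bounded_polys (card I - 1) 1" "\<And>i. (\<lambda>u. \<phi> u i) \<in> polyfn"
      "\<And>u. \<phi> u \<in> coord_space I" "\<And>u. \<phi> u i0 = 1"
      "\<And>f d v. f \<in> forms I d \<Longrightarrow> (\<forall>u. poly_eval f (\<phi> u) = 0) \<Longrightarrow> poly_eval f v = 0"
    show ?thesis
      by (rule chain_length_le[where \<phi> = \<phi> and C = UNIV, OF \<phi>(1) _ assms(3)]) (use \<phi>(5) in auto)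
  qed
qed

lemma irreducible_proj_space:
  assumes "finite I" "I \<noteq> {}"
  shows "irreducible_in (zariski I) (proj_space I)"
proof -
  obtain i0 where "i0 \<in> I" using assms(2) by blast
  show ?thesis
  proof (rule affine_chart[OF assms(1) \<open>i0 \<in> I\<close>])
    fix \<phi> :: "(nat \<Rightarrow> complex) \<Rightarrow> 'a \<Rightarrow> complex"
    assume \<phi>: "\<And>i. (\<lambda>u. \<phi> u i) \<in> bounded_polys (card I - 1) 1" "\<And>i. (\<lambda>u. \<phi> u i) \<in> polyfn"
      "\<And>u. \<phi> u \<in> coord_space I" "\<And>u. \<phi> u i0 = 1"
      "\<And>f d v. f \<in> forms I d \<Longrightarrow> (\<forall>u. poly_eval f (\<phi> u) = 0) \<Longrightarrow> poly_eval f v = 0"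
    let ?S = "zariski I closure_of param_image \<phi>"
    have nz: "\<phi> u \<noteq> (\<lambda>_. 0)" for u using \<phi>(4)[of u] by auto
    have "param_image \<phi> \<subseteq> ?S"
      using param_image_subset[of \<phi>, OF \<phi>(3)] by (intro closure_of_subset) (simp add: topspace_zariski)
    then have mem: "\<phi> u \<in> \<Union>?S" for u
      using nz[of u] proj_point_self[of "\<phi> u"] unfolding param_image_def by blast
    have "proj_space I \<subseteq> ?S"
    proof (rule subsetI, rule ccontr)
      fix p assume "p \<in> proj_space I" "p \<notin> ?S"
      then obtain f d v where f: "f \<in> forms I d" "\<forall>w\<in>\<Union>?S. poly_eval f w = 0" "poly_eval f v \<noteq> 0"
        using separating_form[OF closedin_closure_of] by metis
      then have "\<forall>u. poly_eval f (\<phi> u) = 0" by (intro allI bspec[OF f(2)] mem)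
      then show False using \<phi>(5)[OF f(1)] f(3) by simp
    qed
    then have "?S = proj_space I" using closure_of_subset_topspace[of "zariski I"] by (auto simp: topspace_zariski)
    then show ?thesis using irreducible_param_closure[of \<phi>, OF \<phi>(2,3) nz] by simp
  qed
qed

text \<open>The irreducible ambient space lengthens any chain in a proper closed subset by one, and
  the result has length at most \<open>card I - 1\<close>.\<close>

lemma top_dim_proper_subset:
  assumes I: "finite I" "card I \<ge> 2" and S: "closedin (zariski I) S" "S \<noteq> proj_space I"
  shows "top_dim (subtopology (zariski I) S) \<noteq> enat (card I - 1)"
proof -
  have ne: "I \<noteq> {}" using I by auto
  have "k \<le> card I - 2" if Z: "chain I k Z" "Z k \<subseteq> S" for k Z
  proof -
    have "S \<subset> proj_space I" using S closedin_subset topspace_zariski by (metis psubsetI)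
    then have "chain I (Suc k) (\<lambda>i. if i \<le> k then Z i else proj_space I)"
      using Z irreducible_proj_space[OF I(1) ne] closedin_topspace[of "zariski I"]
      by (auto simp: chain_def topspace_zariski le_Suc_eq less_Suc_eq)
    from chain_length_ambient[OF I(1) ne this] show ?thesis by simp
  qed
  then have "top_dim (subtopology (zariski I) S) \<le> enat (card I - 2)"
    unfolding top_dim_chains[OF S(1)] by (auto intro!: Sup_least)
  also have "\<dots> < enat (card I - 1)" using I(2) by simp
  finally show ?thesis by simp
qed

section \<open>The defective case\<close>

definition dbl :: "nat \<Rightarrow> nat \<Rightarrow> nat \<Rightarrow> nat" where
  "dbl i j = (\<lambda>l. (if l = i then 1 else 0) + (if l = j then 1 else 0))"

lemma dbl_exponents: "i \<le> n \<Longrightarrow> j \<le> n \<Longrightarrow> dbl i j \<in> exponents n 2"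
  by (auto simp: dbl_def exponents_def sum.distrib)

lemma dbl_eq_square: "dbl i j = dbl l l \<longleftrightarrow> i = l \<and> j = l"
proof
  assume *: "dbl i j = dbl l l"
  have "dbl i j i \<noteq> 0" "dbl i j j \<noteq> 0" by (simp_all add: dbl_def)
  then have "dbl l l i \<noteq> 0" "dbl l l j \<noteq> 0" by (simp_all only: *) auto
  then show "i = l \<and> j = l" by (simp add: dbl_def split: if_splits)
qed simp

lemma prod_power_dbl: "i \<le> n \<Longrightarrow> j \<le> n \<Longrightarrow> (\<Prod>l\<le>n. x l ^ dbl i j l) = x i * (x j :: complex)"
proof -
  assume ij: "i \<le> n" "j \<le> n"
  have *: "(\<Prod>l\<le>n. x l ^ (if l = m then 1 else 0)) = x m" if "m \<le> n" for m
    using that prod.remove[of "{..n}" m "\<lambda>l. x l ^ (if l = m then 1 else 0)"] by simp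
  show ?thesis unfolding dbl_def power_add prod.distrib using * ij by simp
qed

text \<open>
  The rows of the catalecticant matrix of the form of bidegree \<open>(2, 2 k)\<close> with coordinates \<open>v\<close>. It has
  rank at most \<open>1\<close> on the Segre-Veronese variety.
\<close>

definition cat_row :: "nat \<Rightarrow> nat \<Rightarrow> nat \<times> nat \<Rightarrow> (bidegree_index \<Rightarrow> complex) \<Rightarrow> nat \<times> nat \<Rightarrow> complex" where
  "cat_row n k = (\<lambda>(i, p) v (j, q). if j \<le> n \<and> q \<le> k then v (dbl i j, bin_exp (2 * k) (p + q)) else 0)"

lemma cat_row_sv_map:
  assumes "i \<le> n" "p \<le> k"
  shows "cat_row n k (i, p) (sv_map (n, 1) (2, 2 * k) x y) =
    fscale (x i * (y 0 ^ (k - p) * y 1 ^ p))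
      (\<lambda>(j, q). if j \<le> n \<and> q \<le> k then x j * (y 0 ^ (k - q) * y 1 ^ q) else 0)"
proof
  fix z :: "nat \<times> nat"
  obtain j q where z: "z = (j, q)" by force
  show "cat_row n k (i, p) (sv_map (n, 1) (2, 2 * k) x y) z = fscale (x i * (y 0 ^ (k - p) * y 1 ^ p))
      (\<lambda>(j, q). if j \<le> n \<and> q \<le> k then x j * (y 0 ^ (k - q) * y 1 ^ q) else 0) z"
  proof (cases "j \<le> n \<and> q \<le> k")
    case True
    have "2 * k - (p + q) = (k - p) + (k - q)" using True assms by simp
    then have "y 0 ^ (2 * k - (p + q)) = y 0 ^ (k - p) * y 0 ^ (k - q)" by (simp only: power_add)
    moreover have "bin_exp (2 * k) (p + q) \<in> exponents 1 (2 * k)"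
      using True assms by (intro bin_exp_exponents) simp
    ultimately show ?thesis
      using True assms prod_power_dbl[of i n j x] dbl_exponents[of i n j]
      by (simp add: z cat_row_def sv_map_def sv_index_def bin_exp_def power_add)
  qed (auto simp: z cat_row_def)
qed

text \<open>The rows at a sum of \<open>s\<close> points lie in a space of dimension at most
  \<open>s\<close>, too small for all of them to be independent. The form is the product of the
  pivots met in the elimination at \<open>w\<close>, and the rows are independent wherever it is
  nonzero.\<close>

lemma catalecticant:
  assumes s: "s < (n + 1) * (k + 1)"
  obtains f d w where "f \<in> forms (sv_index (n, 1) (2, 2 * k)) d"
    "w \<in> coord_space (sv_index (n, 1) (2, 2 * k))" "w \<noteq> (\<lambda>_. 0)" "poly_eval f w \<noteq> 0"
    "\<And>v. proj_point v \<in> secant_points (n, 1) (2, 2 * k) s \<Longrightarrow> poly_eval f v = 0"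
proof -
  let ?I = "sv_index (n, 1) (2, 2 * k)" and ?K = "{..n} \<times> {..k}"
  \<comment> \<open>Up to scaling of coordinates, the sum of the \<open>x l ^ 2\<close> times
    \<open>y 0 ^ k * y 1 ^ k\<close>. Its catalecticant is the permutation matrix that matches
    \<open>(i, p)\<close> with \<open>(i, k - p)\<close>.\<close>
  define w :: "bidegree_index \<Rightarrow> complex" where
    "w = (\<lambda>(\<alpha>, \<beta>). if (\<exists>l\<le>n. \<alpha> = dbl l l) \<and> \<beta> = bin_exp (2 * k) k then 1 else 0)"
  \<comment> \<open>Graded by degree, so that the elimination delivers a homogeneous form.\<close>
  define R where "R d = poly_eval ` forms ?I d" for d
  have bin_eq: "bin_exp (2 * k) p = bin_exp (2 * k) k \<longleftrightarrow> p = k" for p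
    by (auto simp: bin_exp_def fun_eq_iff dest: spec[of _ 1])
  have "indep_family ?K (\<lambda>z. cat_row n k z w)"
    unfolding indep_family_def
  proof (intro allI impI ballI)
    fix c z assume *: "(\<Sum>z\<in>?K. fscale (c z) (cat_row n k z w)) = 0" and z: "z \<in> ?K"
    obtain i p where ip: "z = (i, p)" "i \<le> n" "p \<le> k" using z by auto
    have "cat_row n k z' w (i, k - p) = (if z' = z then 1 else 0)" if K: "z' \<in> ?K" for z'
    proof -
      obtain i' p' where z': "z' = (i', p')" "i' \<le> n" "p' \<le> k" using K by auto
      have "p' + (k - p) = k \<longleftrightarrow> p' = p" using z' ip by auto
      then show ?thesis using z' ip by (auto simp: cat_row_def w_def dbl_eq_square bin_eq)
    qed
    then have "(\<Sum>z'\<in>?K. fscale (c z') (cat_row n k z' w)) (i, k - p) = (\<Sum>z'\<in>?K. if z' = z then c z' else 0)"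
      unfolding sum_fun_apply by (intro sum.cong) auto
    then show "c z = 0" using * z by simp
  qed
  moreover have "(\<lambda>v. cat_row n k z v x) \<in> R 1" if "z \<in> ?K" for z x
  proof -
    obtain i p j q where zx: "z = (i, p)" "x = (j, q)" by (metis surj_pair)
    show ?thesis
    proof (cases "j \<le> n \<and> q \<le> k")
      case True
      let ?y = "(dbl i j, bin_exp (2 * k) (p + q))"
      have "?y \<in> ?I"
        using True that dbl_exponents bin_exp_exponents[of "p + q" "2 * k"] by (auto simp: zx sv_index_def)
      then have "poly_eval (linear_form ?I (unit_vec ?y)) v = v ?y" for v
        by (simp add: poly_eval_linear_form unit_vec_def if_distrib[of "\<lambda>c. c * _"] cong: if_cong)
      moreover have "cat_row n k z v x = v ?y" for v using True by (simp add: zx cat_row_def)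
      ultimately have "(\<lambda>v. cat_row n k z v x) = poly_eval (linear_form ?I (unit_vec ?y))"
        by (simp only: fun_eq_iff) simp
      then show ?thesis unfolding R_def by (rule image_eqI[OF _ linear_form_forms])
    next
      case False
      then have "(\<lambda>v. cat_row n k z v x) = poly_eval 0" by (auto simp: zx cat_row_def fun_eq_iff)
      then show ?thesis unfolding R_def by (rule image_eqI[OF _ forms_0])
    qed
  qed
  moreover have "(\<lambda>_. 1) \<in> R 0"
    unfolding R_def
    by (rule image_eqI[OF _ forms_const[of 1]]) (simp add: fun_eq_iff poly_eval_single mono_eval_def del: single_one)
  moreover have "(\<lambda>v. f v * g v) \<in> R (d + e)" if "f \<in> R d" "g \<in> R e" for f g d e
  proof -
    obtain f' g' where "f' \<in> forms ?I d" "f = poly_eval f'" "g' \<in> forms ?I e" "g = poly_eval g'"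
      using \<open>f \<in> R d\<close> \<open>g \<in> R e\<close> unfolding R_def by blast
    then show ?thesis
      unfolding R_def by (intro image_eqI[OF _ forms_mult[of f' ?I d g' e]]) (auto simp: poly_eval_mult)
  qed
  moreover have "(\<lambda>v. f v - g v) \<in> R d" if "f \<in> R d" "g \<in> R d" for f g d
  proof -
    obtain f' g' where "f' \<in> forms ?I d" "f = poly_eval f'" "g' \<in> forms ?I d" "g = poly_eval g'"
      using \<open>f \<in> R d\<close> \<open>g \<in> R d\<close> unfolding R_def by blast
    then show ?thesis
      unfolding R_def
      by (intro image_eqI[OF _ forms_add[OF _ forms_scale[of g' ?I d "- 1"], of f']])
        (auto simp: poly_eval_add poly_eval_const)
  qed
  ultimately have "\<exists>F e. F \<in> R e \<and> F w \<noteq> 0 \<and> (\<forall>v. F v \<noteq> 0 \<longrightarrow> indep_family ?K (\<lambda>z. cat_row n k z v))"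
    by (intro indep_family_open) auto
  then obtain f d where f: "f \<in> forms ?I d" "poly_eval f w \<noteq> 0"
    "\<And>v. poly_eval f v \<noteq> 0 \<Longrightarrow> indep_family ?K (\<lambda>z. cat_row n k z v)"
    unfolding R_def by blast
  show ?thesis
  proof (rule that[OF f(1) _ _ f(2)])
    show "w \<in> coord_space ?I"
      using dbl_exponents bin_exp_exponents[of k "2 * k"]
      by (auto simp: coord_space_def w_def sv_index_def)
    have "w (dbl 0 0, bin_exp (2 * k) k) = 1" by (auto simp: w_def)
    then show "w \<noteq> (\<lambda>_. 0)" by auto
    fix v assume "proj_point v \<in> secant_points (n, 1) (2, 2 * k) s"
    then obtain c x y where v: "proj_point v = proj_point (\<lambda>i. \<Sum>j<s. c j * sv_map (n, 1) (2, 2 * k) (x j) (y j) i)"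
      by (rule secant_points_rep)
    let ?u = "\<lambda>i. \<Sum>j<s. c j * sv_map (n, 1) (2, 2 * k) (x j) (y j) i"
    define m :: "nat \<Rightarrow> nat \<times> nat \<Rightarrow> complex"
      where "m j = (\<lambda>(i, q). if i \<le> n \<and> q \<le> k then x j i * (y j 0 ^ (k - q) * y j 1 ^ q) else 0)" for j
    have "\<not> indep_family ?K (\<lambda>z. cat_row n k z ?u)"
    proof
      assume ind: "indep_family ?K (\<lambda>z. cat_row n k z ?u)"
      have "cat_row n k z ?u \<in> fs.span (m ` {..<s})" if z: "z \<in> ?K" for z
      proof -
        obtain i p where ip: "z = (i, p)" "i \<le> n" "p \<le> k" using z by auto
        have "cat_row n k z ?u = (\<Sum>j<s. fscale (c j) (cat_row n k z (sv_map (n, 1) (2, 2 * k) (x j) (y j))))"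
          by (auto simp: fun_eq_iff sum_fun_apply cat_row_def ip(1))
        also have "\<dots> = (\<Sum>j<s. fscale (c j) (fscale (x j i * (y j 0 ^ (k - p) * y j 1 ^ p)) (m j)))"
          unfolding ip(1) cat_row_sv_map[OF ip(2,3)] m_def ..
        also have "\<dots> \<in> fs.span (m ` {..<s})"
          by (intro fs.span_sum fs.span_scale fs.span_base) auto
        finally show ?thesis .
      qed
      then have "rank_ge (m ` {..<s}) (card ?K)"
        by (rule rank_geI[OF finite_cartesian_product[OF finite_atMost finite_atMost] ind])
      then have "card ?K \<le> card (m ` {..<s})" by (rule rank_ge_span_bound[OF _ fs.span_superset]) simp
      also have "\<dots> \<le> s" using card_image_le[of "{..<s}" m] by simp
      finally show False using s by (simp add: card_cartesian_product)
    qed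
    then have "poly_eval f ?u = 0" using f(3)[of ?u] by argo
    then show "poly_eval f v = 0" by (rule proj_point_eqD[OF v f(1)])
  qed
qed

lemma defective_even:
  assumes n: "n \<ge> 1"
  shows "defective (n, 1) (2, 2 * k)"
proof -
  let ?I = "sv_index (n, 1) (2, 2 * k)"
  \<comment> \<open>The largest number of points below the size of the catalecticant matrix.\<close>
  define s where "s = (n + 1) * (k + 1) - 1"
  have s: "Suc s = (n + 1) * (k + 1)" by (simp add: s_def)
  have N: "card ?I = ((n + 2) choose 2) * Suc (2 * k)" by (simp only: card_sv_index card_exponents)
  have C: "2 * ((n + 2) choose 2) = (n + 2) * (n + 1)"
    using choose_two[of "n + 2"] by (simp add: dvd_mult_div_cancel)
  have 2: "2 * card ?I = (n + 2) * ((n + 1) * (2 * k + 1))"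
    unfolding N mult.assoc[symmetric] C by simp
  \<comment> \<open>The right side exceeds the left by exactly \<open>n - 1\<close>; so for
    \<open>n \<ge> 1\<close> the parameter count reaches the ambient dimension.\<close>
  have "(n + 1) * (2 * k + 1) \<le> 2 * s" using n s by (simp add: algebra_simps)
  then have "2 * card ?I \<le> (n + 2) * (2 * s)" unfolding 2 by (rule mult_le_mono2)
  then have le: "card ?I \<le> s * (n + 2)" by (simp add: mult.commute)
  obtain f d w where f: "f \<in> forms ?I d" "w \<in> coord_space ?I" "w \<noteq> (\<lambda>_. 0)" "poly_eval f w \<noteq> 0"
    "\<And>v. proj_point v \<in> secant_points (n, 1) (2, 2 * k) s \<Longrightarrow> poly_eval f v = 0"
    using catalecticant[of s n k] s by (metis lessI)
  have "proj_point w \<notin> sv_secant (n, 1) (2, 2 * k) s"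
    using closure_vanish[OF secant_points_subset f(1,5)] f(4) proj_point_self[of w] unfolding sv_secant_eq by blast
  then have "sv_secant (n, 1) (2, 2 * k) s \<noteq> proj_space ?I"
    using f(2,3) by (auto simp: proj_space_def)
  moreover have "card ?I \<ge> 2"
  proof (rule ccontr)
    assume "\<not> ?thesis"
    moreover have "3 * (2 * 1) \<le> (n + 2) * ((n + 1) * (2 * k + 1))" using n by (intro mult_le_mono) auto
    ultimately show False using 2 by simp
  qed
  ultimately have "top_dim (subtopology (zariski ?I) (sv_secant (n, 1) (2, 2 * k) s)) \<noteq> enat (card ?I - 1)"
    by (intro top_dim_proper_subset closed_sv_secant) simp
  moreover have "min (sv_N (n, 1) (2, 2 * k) - 1) (s * (1 + fst (n, 1) + snd (n, 1)) - 1) = card ?I - 1"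
    using le unfolding sv_N_eq card_sv_index[symmetric] by simp
  ultimately have "\<not> expected_dimension (n, 1) (2, 2 * k) s" unfolding expected_dimension_def by simp
  moreover have "s > 0" using n by (simp add: s_def)
  ultimately show ?thesis unfolding defective_def by blast
qed

lemma nondefective:
  assumes "a \<ge> 1" "b \<ge> 3" "a = 2 \<Longrightarrow> odd b"
  shows "\<not> defective (n, 1) (a, b)"
proof -
  have "expected_dimension (n, 1) (a, b) s" if s: "s > 0" for s
  proof -
    let ?I = "sv_index (n, 1) (a, b)"
    have I: "?I \<noteq> {}"
    proof -
      have "card (exponents n a) > 0" by (simp add: card_exponents)
      then have "card ?I > 0" by (simp only: card_sv_index) simp
      then show ?thesis by auto
    qed
    then have "card ?I > 0" by (simp add: card_gt_0_iff)
    define r where "r = min (card ?I) (s * (n + 2)) - 1"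
    have r: "Suc r = min (card ?I) ((n + 2) * s)" using \<open>card ?I > 0\<close> s by (simp add: r_def mult.commute)
    have "sec_rank n a b s (Suc r)"
      unfolding r card_sv_index by (rule nondefective_tangents) (use assms in auto)
    then obtain Z where Z: "chain ?I r Z" "Z r \<subseteq> sv_secant (n, 1) (a, b) s"
      using secant_chain_exists[of a s n b r] assms s by auto
    have "k \<le> r" if "chain ?I k Z'" "Z' k \<subseteq> sv_secant (n, 1) (a, b) s" for k Z'
      using chain_length_ambient[OF _ I that(1)] secant_chain_length_le[OF _ that] s by (simp add: r_def)
    with Z have "top_dim (subtopology (zariski ?I) (sv_secant (n, 1) (a, b) s)) = enat r"
      by (intro top_dim_eqI closed_sv_secant)
    moreover have "min (sv_N (n, 1) (a, b) - 1) (s * (1 + fst (n, 1) + snd (n, 1)) - 1) = r"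
      unfolding sv_N_eq card_sv_index[symmetric] r_def by (simp add: min_diff)
    ultimately show ?thesis unfolding expected_dimension_def by simp
  qed
  then show ?thesis unfolding defective_def by blast
qed

theorem theorem1p2:
  fixes n a b :: nat
  assumes "n \<ge> 1" and "a \<ge> 1" and "b \<ge> 3"
  shows "defective (n, 1) (a, b) \<longleftrightarrow> a = 2 \<and> (\<exists>k. b = 2 * k)"
  using nondefective[of a b n] defective_even[of n] assms by (auto elim: evenE)

end
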